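(* Let $(M,X)$ be a dynamical system and $\Pi:M\rightarrow N$ a fibration. Let $l:=\dim M-\dim N$, let $\Lambda$ be an $l$-dimensional manifold and $F:M\rightarrow\Lambda$ a fibration such that $$\operatorname{Im}X\subset\operatorname{Ker}F_{\ast}$$ and $F$ and $\Pi$ are transverse, i.e. $TM=\operatorname{Ker}\Pi_{\ast}\oplus\operatorname{Ker}F_{\ast}$. Then, for every $m\in M$, there exists an open neighborhood $U$ of $m$ such that $(\Pi,F)|_U:U\rightarrow\Pi(U)\times F(U)$ is a diffeomorphism and $$\Sigma:=\left((\Pi,F)|_U\right)^{-1}:\Pi(U)\times F(U)\to U$$ is a complete solution of the $\Pi|_U$-HJE for $(U,X|_U)$. Moreover, $F|_U$ is the global momentum map related to $\Sigma$.
   Context: All manifolds are smooth and finite-dimensional and all maps are smooth; $f_*$ denotes the tangent map of $f$. A fibration is a surjective submersion. A dynamical system $(M,X)$ is a manifold $M$ with a vector field $X$ on $M$. Given a fibration $\Pi:M\to N$, a section $\sigma:N\to M$ of $\Pi$ is a solution of the $\Pi$-Hamilton-Jacobi equation ($\Pi$-HJE) for $(M,X)$ if $\sigma_{\ast}\circ\Pi_{\ast}\circ X\circ\sigma=X\circ\sigma$. Let $\Lambda$ be a manifold of dimension $\dim M-\dim N$. A complete solution of the $\Pi$-HJE for $(M,X)$ is a surjective local diffeomorphism $\Sigma:N\times\Lambda\to M$ such that, for each $\lambda\in\Lambda$, the map $\sigma_\lambda:=\Sigma(\cdot,\lambda):N\to M$ is a section of $\Pi$ that is a solution of the $\Pi$-HJE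 for $(M,X)$. For $U\subset M$ open, $\Pi|_U:U\to\Pi(U)$ is the restricted fibration and $X|_U$ the restricted vector field; a complete solution $\Sigma:\Pi(U)\times F(U)\to U$ of the $\Pi|_U$-HJE for $(U,X|_U)$ (here with $F(U)$ in place of $\Lambda$) is a surjective local diffeomorphism such that, for each $\lambda\in F(U)$, the map $\sigma_\lambda:=\Sigma(\cdot,\lambda):\Pi(U)\to U$ is a section of $\Pi|_U$ satisfying $(\sigma_\lambda)_{\ast}\circ(\Pi|_U)_{\ast}\circ X|_U\circ\sigma_\lambda=X|_U\circ\sigma_\lambda$. If a complete solution $\Sigma:N\times\Lambda\to M$ is a global diffeomorphism, the global momentum map related to $\Sigma$ is $p_\Lambda\circ\Sigma^{-1}:M\to\Lambda$, with $p_\Lambda:N\times\Lambda\to\Lambda$ the canonical projection. *)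

theory Defs
  imports "HOL-Analysis.Analysis"
begin

section \<open>Model spaces\<close>

text \<open>
  Manifolds are modelled on finite-dimensional real normed spaces rather than on types of class
  \<^class>\<open>euclidean_space\<close>, because the latter have dimension at least 1, which would exclude
  zero-dimensional manifolds; these are modelled on \<^typ>\<open>unit\<close>.
\<close>

class findim_normed_vector = real_normed_vector +
  assumes finite_spanning_set: "\<exists>B::'a set. finite B \<and> (\<forall>x. \<exists>u. x = (\<Sum>b\<in>B. u b *\<^sub>R b))"

lemma findim_span: "\<exists>B::'a::findim_normed_vector set. finite B \<and> span B = UNIV"
proof -
  obtain B :: "'a set" where B: "finite B" "\<And>x. \<exists>u. x = (\<Sum>b\<in>B. u b *\<^sub>R b)"
    using finite_spanning_set by blast
  have "x \<in> span B" for x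
    using B(1) B(2)[of x] by (auto simp: span_finite)
  with B(1) show ?thesis by blast
qed

instance euclidean_space \<subseteq> findim_normed_vector
proof
  show "\<exists>B::'a set. finite B \<and> (\<forall>x. \<exists>u. x = (\<Sum>b\<in>B. u b *\<^sub>R b))"
    by (intro exI[of _ Basis]) (metis euclidean_representation finite_Basis)
qed

instance prod :: (findim_normed_vector, findim_normed_vector) findim_normed_vector
proof
  obtain A :: "'a set" where A: "finite A" "span A = UNIV"
    using findim_span by blast
  obtain B :: "'b set" where B: "finite B" "span B = UNIV"
    using findim_span by blast
  let ?C = "(\<lambda>x. (x, 0::'b)) ` A \<union> (\<lambda>y. (0::'a, y)) ` B"
  have l1: "linear (\<lambda>x::'a. (x, 0::'b))" and l2: "linear (\<lambda>y::'b. (0::'a, y))"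
    by (auto intro!: linearI)
  have "z \<in> span ?C" for z
  proof -
    have "(fst z, 0) \<in> span ((\<lambda>x. (x, 0::'b)) ` A)"
      unfolding linear_span_image[OF l1] A(2) by blast
    moreover have "(0, snd z) \<in> span ((\<lambda>y. (0::'a, y)) ` B)"
      unfolding linear_span_image[OF l2] B(2) by blast
    ultimately have "(fst z, 0) + (0, snd z) \<in> span ?C"
      by (meson span_add span_mono subsetD sup_ge1 sup_ge2)
    then show ?thesis by simp
  qed
  moreover have fin: "finite ?C"
    using A(1) B(1) by simp
  ultimately have "\<exists>u. z = (\<Sum>c\<in>?C. u c *\<^sub>R c)" for z
    unfolding span_finite[OF fin] by blast
  with fin show "\<exists>C::('a \<times> 'b) set. finite C \<and> (\<forall>x. \<exists>u. x = (\<Sum>c\<in>C. u c *\<^sub>R c))"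
    by blast
qed

instantiation unit :: findim_normed_vector
begin

definition "(0::unit) = ()"
definition "(x::unit) + y = ()"
definition "r *\<^sub>R (x::unit) = ()"
definition "sgn (x::unit) = ()"
definition "norm (x::unit) = (0::real)"
definition "dist (x::unit) y = (0::real)"
definition "uniformity = (INF e\<in>{0<..}. principal {(x::unit, y). dist x y < e})"
definition "open (U::unit set) = (\<forall>x\<in>U. \<forall>\<^sub>F (x', y) in uniformity. x' = x \<longrightarrow> y \<in> U)"

instance
  by standard
    (auto simp: norm_unit_def dist_unit_def uniformity_unit_def open_unit_def intro: exI[of _ "{}"])

end

text \<open>
  \<open>C\<^sup>k\<close> and smooth maps between finite-dimensional normed spaces; to be used on open sets only,
  as derivatives are taken at full neighbourhoods.  In finite dimension, continuity of the
  \<open>k\<close>-th derivative is equivalent to continuity of all its directional components.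
\<close>

fun Ck_on :: "nat \<Rightarrow> 'a::real_normed_vector set \<Rightarrow> ('a \<Rightarrow> 'b::real_normed_vector) \<Rightarrow> bool" where
  "Ck_on 0 S f \<longleftrightarrow> continuous_on S f"
| "Ck_on (Suc k) S f \<longleftrightarrow>
     (\<forall>x\<in>S. f differentiable (at x)) \<and> (\<forall>v. Ck_on k S (\<lambda>x. frechet_derivative f (at x) v))"

definition smooth_on :: "'a::real_normed_vector set \<Rightarrow> ('a \<Rightarrow> 'b::real_normed_vector) \<Rightarrow> bool" where
  "smooth_on S f \<longleftrightarrow> (\<forall>k. Ck_on k S f)"

section \<open>Manifolds\<close>

text \<open>
  A chart is a pair of its domain and its coordinate map, whose values outside the domain are
  irrelevant.  Atlases are not required to be maximal: a smooth structure is represented by any of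
  its atlases, and the notions below do not depend on the choice.
\<close>

type_synonym ('m, 'e) chart = "'m set \<times> ('m \<Rightarrow> 'e)"

record ('m, 'e) manifold =
  mtop :: "'m topology"
  atlas :: "('m, 'e) chart set"

abbreviation carr :: "('m, 'e) manifold \<Rightarrow> 'm set" where
  "carr M \<equiv> topspace (mtop M)"

definition chart_inv :: "('m, 'e) chart \<Rightarrow> 'e \<Rightarrow> 'm" where
  "chart_inv c = inv_into (fst c) (snd c)"

definition charts_at :: "('m, 'e) manifold \<Rightarrow> 'm \<Rightarrow> ('m, 'e) chart set" where
  "charts_at M p = {c \<in> atlas M. p \<in> fst c}"

definition smooth_manifold :: "('m, 'e::findim_normed_vector) manifold \<Rightarrow> bool" where
  "smooth_manifold M \<longleftrightarrow>
     Hausdorff_space (mtop M) \<and> second_countable (mtop M) \<and>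
     (\<forall>(V, \<phi>) \<in> atlas M. openin (mtop M) V \<and> open (\<phi> ` V) \<and>
        homeomorphic_map (subtopology (mtop M) V) (top_of_set (\<phi> ` V)) \<phi>) \<and>
     (\<Union>(V, \<phi>) \<in> atlas M. V) = carr M \<and>
     (\<forall>c \<in> atlas M. \<forall>d \<in> atlas M. smooth_on (snd c ` (fst c \<inter> fst d)) (snd d \<circ> chart_inv c))"

definition mdim :: "('m, 'e::findim_normed_vector) manifold \<Rightarrow> nat" where
  "mdim M = dim (UNIV :: 'e set)"

text \<open>Meaningful for open subsets \<open>U\<close> of \<open>M\<close>.\<close>

definition open_submanifold :: "('m, 'e) manifold \<Rightarrow> 'm set \<Rightarrow> ('m, 'e) manifold" where
  "open_submanifold M U =
     \<lparr>mtop = subtopology (mtop M) U, atlas = (\<lambda>(V, \<phi>). (U \<inter> V, \<phi>)) ` atlas M\<rparr>"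

definition prod_manifold ::
    "('m, 'e) manifold \<Rightarrow> ('n, 'f) manifold \<Rightarrow> ('m \<times> 'n, 'e \<times> 'f) manifold" where
  "prod_manifold M N =
     \<lparr>mtop = prod_topology (mtop M) (mtop N),
      atlas = (\<lambda>((V, \<phi>), (W, \<psi>)). (V \<times> W, map_prod \<phi> \<psi>)) ` (atlas M \<times> atlas N)\<rparr>"

text \<open>
  Maps between manifolds are represented by total functions whose values outside the carrier of
  the domain are irrelevant; hence a map restricted to an open submanifold is written as the same
  function.
\<close>

definition smooth_map ::
    "('m, 'e::findim_normed_vector) manifold \<Rightarrow> ('n, 'f::findim_normed_vector) manifold
       \<Rightarrow> ('m \<Rightarrow> 'n) \<Rightarrow> bool" where
  "smooth_map M N f \<longleftrightarrow>
     continuous_map (mtop M) (mtop N) f \<and>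
     (\<forall>c \<in> atlas M. \<forall>d \<in> atlas N.
        smooth_on (snd c ` (fst c \<inter> f -` fst d)) (snd d \<circ> f \<circ> chart_inv c))"

definition diffeomorphism ::
    "('m, 'e::findim_normed_vector) manifold \<Rightarrow> ('n, 'f::findim_normed_vector) manifold
       \<Rightarrow> ('m \<Rightarrow> 'n) \<Rightarrow> bool" where
  "diffeomorphism M N f \<longleftrightarrow>
     bij_betw f (carr M) (carr N) \<and> smooth_map M N f \<and> smooth_map N M (inv_into (carr M) f)"

definition local_diffeomorphism ::
    "('m, 'e::findim_normed_vector) manifold \<Rightarrow> ('n, 'f::findim_normed_vector) manifold
       \<Rightarrow> ('m \<Rightarrow> 'n) \<Rightarrow> bool" where
  "local_diffeomorphism M N f \<longleftrightarrow>
     (\<forall>p \<in> carr M. \<exists>U. openin (mtop M) U \<and> p \<in> U \<and> openin (mtop N) (f ` U) \<and>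
        diffeomorphism (open_submanifold M U) (open_submanifold N (f ` U)) f)"

section \<open>Tangent bundle and tangent maps\<close>

text \<open>
  A tangent vector at \<open>p\<close> is a family of coordinate vectors indexed by the charts of the atlas
  around \<open>p\<close> (extended by \<open>0\<close> to all other charts), whose members are related by the derivatives of
  the coordinate changes.  Elements of the tangent bundle carry their base point.
\<close>

definition tangent_space ::
    "('m, 'e::findim_normed_vector) manifold \<Rightarrow> 'm \<Rightarrow> (('m, 'e) chart \<Rightarrow> 'e) set" where
  "tangent_space M p =
     {v. (\<forall>c \<in> charts_at M p. \<forall>d \<in> charts_at M p.
            v d = frechet_derivative (snd d \<circ> chart_inv c) (at (snd c p)) (v c)) \<and>
         (\<forall>c. c \<notin> charts_at M p \<longrightarrow> v c = 0)}"

definition tangent_bundle ::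
    "('m, 'e::findim_normed_vector) manifold \<Rightarrow> ('m \<times> (('m, 'e) chart \<Rightarrow> 'e)) set" where
  "tangent_bundle M = (SIGMA p : carr M. tangent_space M p)"

definition tangent_map ::
    "('m, 'e::findim_normed_vector) manifold \<Rightarrow> ('n, 'f::findim_normed_vector) manifold
       \<Rightarrow> ('m \<Rightarrow> 'n)
       \<Rightarrow> 'm \<times> (('m, 'e) chart \<Rightarrow> 'e) \<Rightarrow> 'n \<times> (('n, 'f) chart \<Rightarrow> 'f)" where
  "tangent_map M N f = (\<lambda>(p, v).
     (f p,
      \<lambda>d. if d \<in> charts_at N (f p)
          then let c = (SOME c. c \<in> charts_at M p)
               in frechet_derivative (snd d \<circ> f \<circ> chart_inv c) (at (snd c p)) (v c)
          else 0))"

definition tangent_kernel ::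
    "('m, 'e::findim_normed_vector) manifold \<Rightarrow> ('n, 'f::findim_normed_vector) manifold
       \<Rightarrow> ('m \<Rightarrow> 'n) \<Rightarrow> ('m \<times> (('m, 'e) chart \<Rightarrow> 'e)) set" where
  "tangent_kernel M N f = {\<xi> \<in> tangent_bundle M. snd (tangent_map M N f \<xi>) = (\<lambda>_. 0)}"

text \<open>\<open>TM = E \<oplus> E'\<close> for families of subspaces \<open>E\<close>, \<open>E'\<close> of the tangent spaces.\<close>

definition tangent_direct_sum ::
    "('m, 'e::findim_normed_vector) manifold
       \<Rightarrow> ('m \<times> (('m, 'e) chart \<Rightarrow> 'e)) set \<Rightarrow> ('m \<times> (('m, 'e) chart \<Rightarrow> 'e)) set \<Rightarrow> bool" where
  "tangent_direct_sum M E E' \<longleftrightarrow>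
     (\<forall>p \<in> carr M.
        tangent_space M p = {(\<lambda>c. v c + w c) | v w. v \<in> E `` {p} \<and> w \<in> E' `` {p}} \<and>
        E `` {p} \<inter> E' `` {p} = {\<lambda>_. 0})"

definition fibration ::
    "('m, 'e::findim_normed_vector) manifold \<Rightarrow> ('n, 'f::findim_normed_vector) manifold
       \<Rightarrow> ('m \<Rightarrow> 'n) \<Rightarrow> bool" where
  "fibration M N f \<longleftrightarrow>
     smooth_manifold M \<and> smooth_manifold N \<and> smooth_map M N f \<and> f ` carr M = carr N \<and>
     (\<forall>p \<in> carr M. tangent_map M N f ` ({p} \<times> tangent_space M p) = {f p} \<times> tangent_space N (f p))"

definition transverse ::
    "('m, 'e::findim_normed_vector) manifold \<Rightarrow> ('n, 'f::findim_normed_vector) manifold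
       \<Rightarrow> ('l, 'g::findim_normed_vector) manifold \<Rightarrow> ('m \<Rightarrow> 'n) \<Rightarrow> ('m \<Rightarrow> 'l) \<Rightarrow> bool" where
  "transverse M N L P F \<longleftrightarrow> tangent_direct_sum M (tangent_kernel M N P) (tangent_kernel M L F)"

text \<open>Smoothness of a section of the tangent bundle is smoothness of its components in charts.\<close>

definition vector_field ::
    "('m, 'e::findim_normed_vector) manifold
       \<Rightarrow> ('m \<Rightarrow> 'm \<times> (('m, 'e) chart \<Rightarrow> 'e)) \<Rightarrow> bool" where
  "vector_field M X \<longleftrightarrow>
     (\<forall>p \<in> carr M. X p \<in> tangent_bundle M \<and> fst (X p) = p) \<and>
     (\<forall>c \<in> atlas M. smooth_on (snd c ` fst c) (\<lambda>x. snd (X (chart_inv c x)) c))"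

definition dynamical_system ::
    "('m, 'e::findim_normed_vector) manifold
       \<Rightarrow> ('m \<Rightarrow> 'm \<times> (('m, 'e) chart \<Rightarrow> 'e)) \<Rightarrow> bool" where
  "dynamical_system M X \<longleftrightarrow> smooth_manifold M \<and> vector_field M X"

text \<open>
  For open \<open>U\<close>, the tangent map of the inclusion \<open>U \<rightarrow> M\<close> identifies \<open>T\<^sub>pU\<close> with \<open>T\<^sub>pM\<close>; the
  restricted field is the one corresponding to \<open>X\<close> under this identification.
\<close>

definition restrict_field ::
    "('m, 'e::findim_normed_vector) manifold \<Rightarrow> 'm set
       \<Rightarrow> ('m \<Rightarrow> 'm \<times> (('m, 'e) chart \<Rightarrow> 'e)) \<Rightarrow> ('m \<Rightarrow> 'm \<times> (('m, 'e) chart \<Rightarrow> 'e))" where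
  "restrict_field M U X =
     (\<lambda>p. THE \<xi>. \<xi> \<in> tangent_bundle (open_submanifold M U) \<and>
                tangent_map (open_submanifold M U) M id \<xi> = X p)"

section \<open>The Hamilton-Jacobi equation\<close>

definition smooth_section ::
    "('m, 'e::findim_normed_vector) manifold \<Rightarrow> ('n, 'f::findim_normed_vector) manifold
       \<Rightarrow> ('m \<Rightarrow> 'n) \<Rightarrow> ('n \<Rightarrow> 'm) \<Rightarrow> bool" where
  "smooth_section M N P \<sigma> \<longleftrightarrow> smooth_map N M \<sigma> \<and> (\<forall>n \<in> carr N. P (\<sigma> n) = n)"

definition HJE_solution ::
    "('m, 'e::findim_normed_vector) manifold \<Rightarrow> ('m \<Rightarrow> 'm \<times> (('m, 'e) chart \<Rightarrow> 'e))
       \<Rightarrow> ('n, 'f::findim_normed_vector) manifold \<Rightarrow> ('m \<Rightarrow> 'n) \<Rightarrow> ('n \<Rightarrow> 'm) \<Rightarrow> bool" where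
  "HJE_solution M X N P \<sigma> \<longleftrightarrow>
     smooth_section M N P \<sigma> \<and>
     (\<forall>n \<in> carr N. (tangent_map N M \<sigma> \<circ> tangent_map M N P \<circ> X \<circ> \<sigma>) n = (X \<circ> \<sigma>) n)"

definition complete_solution ::
    "('m, 'e::findim_normed_vector) manifold \<Rightarrow> ('m \<Rightarrow> 'm \<times> (('m, 'e) chart \<Rightarrow> 'e))
       \<Rightarrow> ('n, 'f::findim_normed_vector) manifold \<Rightarrow> ('m \<Rightarrow> 'n)
       \<Rightarrow> ('l, 'g::findim_normed_vector) manifold \<Rightarrow> ('n \<times> 'l \<Rightarrow> 'm) \<Rightarrow> bool" where
  "complete_solution M X N P L \<Sigma> \<longleftrightarrow>
     dynamical_system M X \<and> fibration M N P \<and>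
     smooth_manifold L \<and> int (mdim L) = int (mdim M) - int (mdim N) \<and>
     local_diffeomorphism (prod_manifold N L) M \<Sigma> \<and> \<Sigma> ` (carr N \<times> carr L) = carr M \<and>
     (\<forall>l \<in> carr L. HJE_solution M X N P (\<lambda>n. \<Sigma> (n, l)))"

text \<open>\<open>G\<close> is the global momentum map \<open>M \<rightarrow> L\<close> related to the complete solution \<open>\<Sigma>\<close>.\<close>

definition global_momentum_map ::
    "('m, 'e::findim_normed_vector) manifold \<Rightarrow> ('m \<Rightarrow> 'm \<times> (('m, 'e) chart \<Rightarrow> 'e))
       \<Rightarrow> ('n, 'f::findim_normed_vector) manifold \<Rightarrow> ('m \<Rightarrow> 'n)
       \<Rightarrow> ('l, 'g::findim_normed_vector) manifold \<Rightarrow> ('n \<times> 'l \<Rightarrow> 'm) \<Rightarrow> ('m \<Rightarrow> 'l) \<Rightarrow> bool" where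
  "global_momentum_map M X N P L \<Sigma> G \<longleftrightarrow>
     complete_solution M X N P L \<Sigma> \<and> diffeomorphism (prod_manifold N L) M \<Sigma> \<and>
     (\<forall>m \<in> carr M. G m = (snd \<circ> inv_into (carr N \<times> carr L) \<Sigma>) m)"

end

theory Submission
  imports Defs
begin

text \<open>
  Because \<open>P\<close> and \<open>F\<close> are submersions whose vertical spaces are complementary, the map
  \<open>\<xi> \<mapsto> (P\<^sub>* \<xi>, F\<^sub>* \<xi>)\<close> is a bijection from \<open>T\<^sub>pM\<close> to \<open>TN \<times> TL\<close> at every point \<open>p\<close>
  (\<open>tangent_splitting_if_transverse\<close>); everything else rests on this bijection.

  Its bijectivity in charts says that \<open>(P, F) : M \<rightarrow> N \<times> L\<close> has invertible derivatives.  By the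
  inverse function theorem \<open>(P, F)\<close> is open, and injective near \<open>m\<close>.  Inside the image of a
  neighbourhood on which it is injective there is a box \<open>V \<times> W\<close> around \<open>(P m, F m)\<close>, and the part \<open>U\<close>
  of that neighbourhood lying over the box is mapped bijectively onto \<open>V \<times> W = P(U) \<times> F(U)\<close>
  (\<open>box_neighbourhood\<close>).  A smooth bijection with invertible derivatives has a smooth inverse
  (\<open>diffeomorphism_if_bijective_derivative\<close>), which is the map \<open>\<Sigma>\<close>.

  Its leaves \<open>\<sigma> = \<Sigma>(\<cdot>, \<lambda>)\<close> are the sections of \<open>P\<close> along which \<open>F\<close> has the constant value \<open>\<lambda>\<close>.
  For \<open>\<xi> = X(\<sigma>(n))\<close> and \<open>\<zeta> = \<sigma>\<^sub>* P\<^sub>* \<xi>\<close>, functoriality gives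
  \<open>P\<^sub>* \<zeta> = (P \<circ> \<sigma>)\<^sub>* P\<^sub>* \<xi> = P\<^sub>* \<xi>\<close> and \<open>F\<^sub>* \<zeta> = (F \<circ> \<sigma>)\<^sub>* P\<^sub>* \<xi> = 0 = F\<^sub>* \<xi>\<close>, the last
  equality because \<open>X\<close> takes values in the kernel of \<open>F\<^sub>*\<close>.  Injectivity of the splitting yields
  \<open>\<zeta> = \<xi>\<close>, which is the Hamilton-Jacobi equation (\<open>HJE_solution_if_constant_momentum\<close>).
  The inverse of \<open>\<Sigma>\<close> being \<open>(P, F)\<close>, its second component is \<open>F\<close>, the global momentum map.

  This argument is carried out for \<open>U = M\<close> in \<open>complete_solution_if_bijective\<close>.  It applies to
  \<open>(U, X|\<^sub>U)\<close> because the tangent map of the inclusion of an open submanifold is bijective on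
  tangent spaces and natural, so that all hypotheses restrict.
\<close>

section \<open>Finite-dimensional normed spaces\<close>

text \<open>
  The vector \<open>b\<close> has a positive distance \<open>\<delta>\<close> from \<open>K\<close>, and \<open>x - k b \<in> K\<close> with \<open>k \<noteq> 0\<close> exhibits
  \<open>b - x / k\<close> as a point of \<open>K\<close>.  This estimate yields both the completeness of finite-dimensional
  spaces and the boundedness of linear functionals on them.
\<close>

lemma bounded_coefficient_modulo_closed_subspace:
  fixes K :: "'a::real_normed_vector set"
  assumes "closed K" "subspace K" "b \<notin> K"
  obtains \<delta> where "\<delta> > 0" "\<And>x k. x - k *\<^sub>R b \<in> K \<Longrightarrow> \<bar>k\<bar> * \<delta> \<le> norm x"
proof -
  have "open (- K)" "b \<in> - K" using assms by auto
  then obtain \<delta> where \<delta>: "\<delta> > 0" "ball b \<delta> \<subseteq> - K"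
    by (meson open_contains_ball)
  have "\<bar>k\<bar> * \<delta> \<le> norm x" if "x - k *\<^sub>R b \<in> K" for x k
  proof (cases "k = 0")
    case False
    have "(- inverse k) *\<^sub>R (x - k *\<^sub>R b) \<in> K"
      using that assms(2) subspace_scale by blast
    also have "(- inverse k) *\<^sub>R (x - k *\<^sub>R b) = b - inverse k *\<^sub>R x"
      using False by (simp add: algebra_simps)
    finally have "\<not> dist b (b - inverse k *\<^sub>R x) < \<delta>"
      using \<delta>(2) by (metis ComplD mem_ball subsetD)
    then have "\<delta> \<le> norm x / \<bar>k\<bar>"
      using False by (simp add: dist_norm divide_inverse mult.commute)
    then show ?thesis using False by (simp add: field_simps)
  qed simp
  with \<delta>(1) that show ?thesis by blast
qed

lemma Cauchy_diff:
  fixes f g :: "nat \<Rightarrow> 'a::real_normed_vector"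
  assumes "Cauchy f" "Cauchy g"
  shows "Cauchy (\<lambda>n. f n - g n)"
proof (rule CauchyI)
  fix e :: real assume "e > 0"
  then have "e / 2 > 0" by simp
  then obtain M N where MN: "\<forall>m\<ge>M. \<forall>n\<ge>M. norm (f m - f n) < e / 2" "\<forall>m\<ge>N. \<forall>n\<ge>N. norm (g m - g n) < e / 2"
    using CauchyD assms by metis
  have "norm ((f m - g m) - (f n - g n)) < e" if "m \<ge> max M N" "n \<ge> max M N" for m n
  proof -
    have eq: "(f m - g m) - (f n - g n) = (f m - f n) - (g m - g n)" by simp
    have "norm (f m - f n) < e / 2" "norm (g m - g n) < e / 2" using that MN by auto
    then show ?thesis unfolding eq
      using norm_triangle_ineq4[of "f m - f n" "g m - g n"] by linarith
  qed
  then show "\<exists>K. \<forall>m\<ge>K. \<forall>n\<ge>K. norm ((f m - g m) - (f n - g n)) < e" by blast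
qed

text \<open>
  Induction on the generators: along a generator outside the span of the others, the coefficients
  of a Cauchy sequence are Cauchy by the preceding estimate, so the remainders are Cauchy in the
  smaller span.
\<close>

lemma complete_span_finite:
  fixes B :: "'a::real_normed_vector set"
  assumes "finite B"
  shows "complete (span B)"
  using assms
proof (induction B)
  case empty
  then show ?case by (simp add: compact_imp_complete)
next
  case (insert b B)
  show ?case
  proof (cases "b \<in> span B")
    case True
    then show ?thesis using insert.IH by (simp add: span_redundant)
  next
    case False
    obtain \<delta> where \<delta>: "\<delta> > 0" "\<And>x k. x - k *\<^sub>R b \<in> span B \<Longrightarrow> \<bar>k\<bar> * \<delta> \<le> norm x"
      using bounded_coefficient_modulo_closed_subspace[OF complete_imp_closed[OF insert.IH]
          subspace_span False] by blast
    show ?thesis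
    proof (rule completeI)
      fix f :: "nat \<Rightarrow> 'a"
      assume f: "\<forall>n. f n \<in> span (insert b B)" and cf: "Cauchy f"
      then have "\<forall>n. \<exists>k. f n - k *\<^sub>R b \<in> span B" by (simp add: span_insert)
      then obtain k where k: "\<And>n. f n - k n *\<^sub>R b \<in> span B" by metis
      have kb: "\<bar>k n - k m\<bar> * \<delta> \<le> norm (f n - f m)" for n m
      proof (rule \<delta>(2))
        have "(f n - k n *\<^sub>R b) - (f m - k m *\<^sub>R b) \<in> span B"
          using k span_diff by blast
        then show "f n - f m - (k n - k m) *\<^sub>R b \<in> span B"
          by (simp add: algebra_simps)
      qed
      have "Cauchy k"
      proof (rule CauchyI)
        fix e :: real assume "e > 0"
        then obtain N where "\<forall>m\<ge>N. \<forall>n\<ge>N. norm (f m - f n) < e * \<delta>"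
          using CauchyD[OF cf, of "e * \<delta>"] \<delta>(1) by auto
        then have "\<bar>k m - k n\<bar> * \<delta> < e * \<delta>" if "m \<ge> N" "n \<ge> N" for m n
          using kb[of m n] that by (meson order_le_less_trans)
        then show "\<exists>M. \<forall>m\<ge>M. \<forall>n\<ge>M. norm (k m - k n) < e"
          using \<delta>(1) by (auto simp: mult_less_cancel_right)
      qed
      then obtain l where l: "k \<longlonglongrightarrow> l" using Cauchy_convergent convergent_def by blast
      have "(\<lambda>n. k n *\<^sub>R b) \<longlonglongrightarrow> l *\<^sub>R b" by (intro tendsto_intros l)
      then have "Cauchy (\<lambda>n. k n *\<^sub>R b)" using LIMSEQ_imp_Cauchy by blast
      then have "Cauchy (\<lambda>n. f n - k n *\<^sub>R b)" using cf by (rule Cauchy_diff[rotated])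
      then obtain s where s: "s \<in> span B" "(\<lambda>n. f n - k n *\<^sub>R b) \<longlonglongrightarrow> s"
        using insert.IH[unfolded complete_def, THEN spec, of "\<lambda>n. f n - k n *\<^sub>R b"] k by auto
      have "(\<lambda>n. (f n - k n *\<^sub>R b) + k n *\<^sub>R b) \<longlonglongrightarrow> s + l *\<^sub>R b"
        by (intro tendsto_intros s l)
      then have "f \<longlonglongrightarrow> s + l *\<^sub>R b" by simp
      moreover have "s + l *\<^sub>R b \<in> span (insert b B)"
        unfolding span_insert using s(1) by (auto intro!: exI[of _ l])
      ultimately show "\<exists>l\<in>span (insert b B). f \<longlonglongrightarrow> l" by blast
    qed
  qed
qed

lemma complete_subspace:
  fixes K :: "'a::findim_normed_vector set"
  assumes "subspace K"
  shows "complete K"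
proof -
  obtain A :: "'a set" where A: "finite A" "span A = UNIV" using findim_span by blast
  obtain B where B: "B \<subseteq> K" "independent B" "K \<subseteq> span B"
    using maximal_independent_subset by blast
  have "finite B" using independent_span_bound[OF A(1) B(2)] A(2) by simp
  moreover have "span B = K"
    using B(1,3) span_minimal[OF _ assms] by blast
  ultimately show ?thesis using complete_span_finite by blast
qed

text \<open>
  The kernel is complete, hence closed; for \<open>f b = 1\<close> the coefficient of \<open>x\<close> modulo the kernel along
  \<open>b\<close> is \<open>f x\<close>.
\<close>

lemma linear_functional_bounded:
  fixes f :: "'a::findim_normed_vector \<Rightarrow> real"
  assumes "linear f"
  shows "bounded_linear f"
proof (cases "\<forall>x. f x = 0")
  case True
  then have "f = (\<lambda>x. 0)" by blast
  then show ?thesis by (metis bounded_linear_zero)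
next
  case False
  from False obtain a where a: "f a \<noteq> 0" by blast
  define b where "b = a /\<^sub>R f a"
  have fb: "f b = 1" using a by (simp add: b_def linear_cmul[OF assms])
  let ?K = "{x. f x = 0}"
  have K: "subspace ?K" by (simp add: subspace_def linear_add[OF assms] linear_cmul[OF assms] linear_0[OF assms])
  have "b \<notin> ?K" using fb by simp
  then obtain \<delta> where \<delta>: "\<delta> > 0" "\<And>x k. x - k *\<^sub>R b \<in> ?K \<Longrightarrow> \<bar>k\<bar> * \<delta> \<le> norm x"
    using bounded_coefficient_modulo_closed_subspace[OF complete_imp_closed[OF complete_subspace[OF K]] K, of b thesis] by blast
  have "norm (f x) \<le> norm x * (1 / \<delta>)" for x
  proof -
    have "f (x - f x *\<^sub>R b) = 0" by (simp add: linear_diff[OF assms] linear_cmul[OF assms] fb)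
    then have "\<bar>f x\<bar> * \<delta> \<le> norm x" using \<delta>(2) by blast
    then show ?thesis using \<delta>(1) by (simp add: field_simps)
  qed
  then show ?thesis by (intro bounded_linear_intro[of f "1 / \<delta>"] linear_add[OF assms] linear_cmul[OF assms])
qed

lemma findim_coordinates:
  obtains B :: "'a::findim_normed_vector set" and \<kappa> :: "'a \<Rightarrow> 'a \<Rightarrow> real"
  where "finite B" "\<And>b. bounded_linear (\<kappa> b)" "\<And>x. (\<Sum>b\<in>B. \<kappa> b x *\<^sub>R b) = x"
proof -
  obtain A :: "'a set" where A: "finite A" "span A = UNIV" using findim_span by blast
  obtain B :: "'a set" where B: "independent B" "UNIV \<subseteq> span B"
    using maximal_independent_subset[of UNIV] by blast
  have fin: "finite B" using independent_span_bound[OF A(1) B(1)] A(2) by simp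
  have sp: "x \<in> span B" for x using B(2) by blast
  have "bounded_linear (\<lambda>x. representation B x b)" for b
    by (intro linear_functional_bounded linearI)
      (simp_all add: representation_add[OF B(1) sp sp] representation_scale[OF B(1) sp])
  moreover have "(\<Sum>b\<in>B. representation B x b *\<^sub>R b) = x" for x
    using sum_representation_eq[OF B(1) sp fin subset_refl] .
  ultimately show ?thesis using that[of B "\<lambda>b x. representation B x b"] fin by blast
qed

lemma linear_expand:
  assumes "linear f" "\<And>x. (\<Sum>b\<in>B. \<kappa> b x *\<^sub>R b) = x"
  shows "f x = (\<Sum>b\<in>B. \<kappa> b x *\<^sub>R f b)"
proof -
  have "f (\<Sum>b\<in>B. \<kappa> b x *\<^sub>R b) = (\<Sum>b\<in>B. \<kappa> b x *\<^sub>R f b)"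
    by (simp add: linear_sum[OF assms(1)] linear_cmul[OF assms(1)] o_def)
  then show ?thesis using assms(2) by simp
qed

lemma linear_imp_bounded_linear:
  fixes f :: "'a::findim_normed_vector \<Rightarrow> 'b::real_normed_vector"
  assumes "linear f"
  shows "bounded_linear f"
proof -
  obtain B :: "'a set" and \<kappa> where B: "finite B" "\<And>b. bounded_linear (\<kappa> b)"
    "\<And>x. (\<Sum>b\<in>B. \<kappa> b x *\<^sub>R b) = x"
    by (rule findim_coordinates) blast
  have "f = (\<lambda>x. \<Sum>b\<in>B. \<kappa> b x *\<^sub>R f b)"
    using linear_expand[OF assms B(3)] by blast
  moreover have "bounded_linear (\<lambda>x. \<Sum>b\<in>B. \<kappa> b x *\<^sub>R f b)"
    by (intro bounded_linear_sum bounded_linear_compose[OF bounded_linear_scaleR_left B(2)])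
  ultimately show ?thesis by simp
qed

text \<open>
  An operator is controlled by its values on a finite basis.  This bridges the definition of \<open>C\<^sup>k\<close>,
  which speaks of directional derivatives only, and the operator norm estimates below.
\<close>

lemma pointwise_imp_operator_norm_convergence:
  fixes A :: "'y \<Rightarrow> 'a::findim_normed_vector \<Rightarrow> 'b::real_normed_vector"
  assumes lin: "\<forall>\<^sub>F y in G. linear (A y)" and lin0: "linear A0"
    and lim: "\<And>w. ((\<lambda>y. A y w) \<longlongrightarrow> A0 w) G" and "e > 0"
  shows "\<forall>\<^sub>F y in G. \<forall>x. norm (A y x - A0 x) \<le> e * norm x"
proof -
  obtain B :: "'a set" and \<kappa> where B: "finite B" "\<And>b. bounded_linear (\<kappa> b)"
    "\<And>x. (\<Sum>b\<in>B. \<kappa> b x *\<^sub>R b) = x"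
    by (rule findim_coordinates) blast
  have "\<forall>b. \<exists>C. \<forall>x. \<bar>\<kappa> b x\<bar> \<le> norm x * C"
    using bounded_linear.bounded[OF B(2)] by simp
  then obtain C where C: "\<And>b x. \<bar>\<kappa> b x\<bar> \<le> norm x * C b" by metis
  define s where "s = 1 + (\<Sum>b\<in>B. \<bar>C b\<bar>)"
  have s: "s > 0" unfolding s_def by (simp add: add_pos_nonneg sum_nonneg)
  have "\<forall>\<^sub>F y in G. \<forall>b\<in>B. dist (A y b) (A0 b) < e / s"
    using B(1) tendstoD[OF lim] s \<open>e > 0\<close> by (intro eventually_ball_finite ballI) auto
  with lin show ?thesis
  proof eventually_elim
    case (elim y)
    show ?case
    proof
      fix x
      have "linear (\<lambda>x. A y x - A0 x)" using elim(1) lin0 by (rule linear_compose_sub)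
      then have "A y x - A0 x = (\<Sum>b\<in>B. \<kappa> b x *\<^sub>R (A y b - A0 b))"
        using linear_expand B(3) by blast
      also have "norm \<dots> \<le> (\<Sum>b\<in>B. (norm x * \<bar>C b\<bar>) * (e / s))"
      proof (rule sum_norm_le)
        fix b assume "b \<in> B"
        have "\<bar>\<kappa> b x\<bar> \<le> norm x * \<bar>C b\<bar>"
          using C[of b x] by (meson abs_ge_self mult_left_mono norm_ge_zero order_trans)
        then show "norm (\<kappa> b x *\<^sub>R (A y b - A0 b)) \<le> (norm x * \<bar>C b\<bar>) * (e / s)"
          unfolding norm_scaleR using elim(2) \<open>b \<in> B\<close>
          by (intro mult_mono) (auto simp: dist_norm less_imp_le)
      qed
      also have "\<dots> = (\<Sum>b\<in>B. \<bar>C b\<bar>) * (norm x * (e / s))"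
        by (simp only: sum_distrib_right) (simp add: mult_ac)
      also have "\<dots> \<le> s * (norm x * (e / s))"
        using s \<open>e > 0\<close> by (intro mult_right_mono) (auto simp: s_def)
      also have "\<dots> = e * norm x" using s by simp
      finally show "norm (A y x - A0 x) \<le> e * norm x" .
    qed
  qed
qed

section \<open>Calculus of \<open>C\<^sup>k\<close> maps\<close>

lemma frechet_derivative_cong_open:
  assumes "open S" "x \<in> S" "\<And>y. y \<in> S \<Longrightarrow> f y = g y"
  shows "frechet_derivative f (at x) = frechet_derivative g (at x)"
    and "f differentiable (at x) \<longleftrightarrow> g differentiable (at x)"
proof -
  have "(f has_derivative D) (at x) \<longleftrightarrow> (g has_derivative D) (at x)" for D
    using has_derivative_transform_within_open[OF _ assms(1,2), of f D UNIV g]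
      has_derivative_transform_within_open[OF _ assms(1,2), of g D UNIV f] assms(3) by auto
  then show "frechet_derivative f (at x) = frechet_derivative g (at x)"
    and "f differentiable (at x) \<longleftrightarrow> g differentiable (at x)"
    by (auto simp: frechet_derivative_def differentiable_def)
qed

lemma frechet_derivative_unique:
  assumes "(f has_derivative D) (at x)"
  shows "frechet_derivative f (at x) = D"
  using frechet_derivative_at[OF assms] by simp

lemma Ck_on_subset: "Ck_on k S f \<Longrightarrow> T \<subseteq> S \<Longrightarrow> Ck_on k T f"
  by (induction k arbitrary: f) (auto intro: continuous_on_subset)

lemma Ck_on_cong:
  assumes "open S" "\<And>x. x \<in> S \<Longrightarrow> f x = g x"
  shows "Ck_on k S f \<longleftrightarrow> Ck_on k S g"
  using assms(2)
proof (induction k arbitrary: f g)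
  case 0
  then show ?case by (simp cong: continuous_on_cong)
next
  case (Suc k)
  have *: "frechet_derivative f (at x) = frechet_derivative g (at x)"
    "f differentiable (at x) \<longleftrightarrow> g differentiable (at x)" if "x \<in> S" for x
    using frechet_derivative_cong_open[OF assms(1) that, of f g] Suc.prems by auto
  have "Ck_on k S (\<lambda>x. frechet_derivative f (at x) v)
      \<longleftrightarrow> Ck_on k S (\<lambda>x. frechet_derivative g (at x) v)" for v
    by (rule Suc.IH) (simp add: *(1))
  with *(2) show ?case by simp
qed

lemma Ck_on_local:
  assumes "\<And>x. x \<in> S \<Longrightarrow> \<exists>T. open T \<and> x \<in> T \<and> Ck_on k T f"
  shows "Ck_on k S f"
  using assms
proof (induction k arbitrary: f)
  case 0
  have "isCont f x" if "x \<in> S" for x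
    using 0[OF that] by (auto simp: continuous_on_eq_continuous_at)
  then show ?case by (simp add: continuous_at_imp_continuous_on)
next
  case (Suc k)
  have "f differentiable (at x)" if "x \<in> S" for x
    using Suc.prems[OF that] by auto
  moreover have "Ck_on k S (\<lambda>x. frechet_derivative f (at x) v)" for v
  proof (rule Suc.IH)
    fix x assume "x \<in> S"
    then obtain T where "open T" "x \<in> T" "Ck_on (Suc k) T f" using Suc.prems by blast
    then show "\<exists>T. open T \<and> x \<in> T \<and> Ck_on k T (\<lambda>x. frechet_derivative f (at x) v)"
      by (intro exI[of _ T]) simp
  qed
  ultimately show ?case by simp
qed

lemma Ck_on_Suc_imp: "Ck_on (Suc k) S f \<Longrightarrow> Ck_on k S f"
proof (induction k arbitrary: f)
  case 0
  then show ?case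
    by (auto intro!: continuous_at_imp_continuous_on differentiable_imp_continuous_within)
next
  case (Suc k)
  then show ?case by (metis Ck_on.simps(2))
qed

lemma Ck_on_SucI:
  assumes "open S" "\<And>x. x \<in> S \<Longrightarrow> (f has_derivative D x) (at x)" "\<And>v. Ck_on k S (\<lambda>x. D x v)"
  shows "Ck_on (Suc k) S f"
proof -
  have "Ck_on k S (\<lambda>x. frechet_derivative f (at x) v) \<longleftrightarrow> Ck_on k S (\<lambda>x. D x v)" for v
    by (rule Ck_on_cong[OF assms(1)]) (simp add: frechet_derivative_unique[OF assms(2)])
  then show ?thesis using assms(2,3) by (auto simp: differentiable_def)
qed

lemma Ck_on_SucD:
  assumes "Ck_on (Suc k) S f"
  shows "\<And>x. x \<in> S \<Longrightarrow> (f has_derivative frechet_derivative f (at x)) (at x)"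
    "\<And>v. Ck_on k S (\<lambda>x. frechet_derivative f (at x) v)"
  using assms by (auto simp: frechet_derivative_works[symmetric])

lemma Ck_on_const: "Ck_on k S (\<lambda>x. c)"
  by (induction k arbitrary: c) auto

lemma Ck_on_bounded_linear_compose:
  assumes "open S" "bounded_linear h" "Ck_on k S f"
  shows "Ck_on k S (\<lambda>x. h (f x))"
  using assms(3)
proof (induction k arbitrary: f)
  case 0
  then show ?case using bounded_linear.continuous_on[OF assms(2)] by simp
next
  case (Suc k)
  show ?case
    by (rule Ck_on_SucI[OF assms(1)],
        rule bounded_linear.has_derivative[OF assms(2) Ck_on_SucD(1)[OF Suc.prems]], assumption,
        rule Suc.IH, rule Ck_on_SucD(2)[OF Suc.prems])
qed

lemma Ck_on_bounded_linear: "open S \<Longrightarrow> bounded_linear h \<Longrightarrow> Ck_on k S h"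
proof (induction k)
  case 0
  then show ?case by (simp add: linear_continuous_on)
next
  case (Suc k)
  show ?case
    by (rule Ck_on_SucI[OF Suc.prems(1) bounded_linear_imp_has_derivative[OF Suc.prems(2)] Ck_on_const])
qed

lemma Ck_on_add:
  assumes "open S" "Ck_on k S f" "Ck_on k S g"
  shows "Ck_on k S (\<lambda>x. f x + g x)"
  using assms(2,3)
proof (induction k arbitrary: f g)
  case 0
  then show ?case by (simp add: continuous_on_add)
next
  case (Suc k)
  show ?case
    by (rule Ck_on_SucI[OF assms(1)], rule has_derivative_add,
        erule Ck_on_SucD(1)[OF Suc.prems(1)], erule Ck_on_SucD(1)[OF Suc.prems(2)])
      (intro Suc.IH Ck_on_SucD(2)[OF Suc.prems(1)] Ck_on_SucD(2)[OF Suc.prems(2)])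
qed

lemma Ck_on_sum:
  assumes "open S" "finite B" "\<And>b. b \<in> B \<Longrightarrow> Ck_on k S (f b)"
  shows "Ck_on k S (\<lambda>x. \<Sum>b\<in>B. f b x)"
  using assms(2,3)
  by (induction B) (auto intro!: Ck_on_add[OF assms(1)] Ck_on_const)

lemma Ck_on_scaleR:
  assumes "open S" "Ck_on k S r" "Ck_on k S f"
  shows "Ck_on k S (\<lambda>x. r x *\<^sub>R f x)"
  using assms(2,3)
proof (induction k arbitrary: r f)
  case 0
  then show ?case by (simp add: continuous_on_scaleR)
next
  case (Suc k)
  show ?case
    by (rule Ck_on_SucI[OF assms(1)], rule has_derivative_scaleR,
        erule Ck_on_SucD(1)[OF Suc.prems(1)], erule Ck_on_SucD(1)[OF Suc.prems(2)])
      (intro Ck_on_add[OF assms(1)] Suc.IH Ck_on_SucD(2)[OF Suc.prems(1)]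
        Ck_on_SucD(2)[OF Suc.prems(2)] Ck_on_Suc_imp[OF Suc.prems(1)] Ck_on_Suc_imp[OF Suc.prems(2)])
qed

text \<open>
  In coordinates, \<open>A y (u y)\<close> is a finite sum of products of \<open>C\<^sup>k\<close> functions.  The derivative of a
  composition has this shape, as does the derivative of an inverse operator.
\<close>

lemma Ck_on_apply_linear:
  fixes u :: "'y::real_normed_vector \<Rightarrow> 'a::findim_normed_vector"
  assumes "open S" "\<And>y. y \<in> S \<Longrightarrow> linear (A y)" "\<And>w. Ck_on k S (\<lambda>y. A y w)" "Ck_on k S u"
  shows "Ck_on k S (\<lambda>y. A y (u y))"
proof -
  obtain B :: "'a set" and \<kappa> where B: "finite B" "\<And>b. bounded_linear (\<kappa> b)"
    "\<And>x. (\<Sum>b\<in>B. \<kappa> b x *\<^sub>R b) = x"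
    by (rule findim_coordinates) blast
  have "Ck_on k S (\<lambda>y. \<Sum>b\<in>B. \<kappa> b (u y) *\<^sub>R A y b)"
    by (rule Ck_on_sum[OF assms(1) B(1)], rule Ck_on_scaleR[OF assms(1) _ assms(3)],
        rule Ck_on_bounded_linear_compose[OF assms(1) B(2) assms(4)])
  moreover have "Ck_on k S (\<lambda>y. A y (u y)) \<longleftrightarrow> Ck_on k S (\<lambda>y. \<Sum>b\<in>B. \<kappa> b (u y) *\<^sub>R A y b)"
    by (rule Ck_on_cong[OF assms(1) linear_expand[OF assms(2) B(3)]])
  ultimately show ?thesis by blast
qed

lemma Ck_on_compose:
  fixes f :: "'a::real_normed_vector \<Rightarrow> 'b::findim_normed_vector"
  assumes "open S" "open T" "f ` S \<subseteq> T" "Ck_on k S f" "Ck_on k T g"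
  shows "Ck_on k S (g \<circ> f)"
  using assms(4,5)
proof (induction k arbitrary: g)
  case 0
  then show ?case 
    using continuous_on_compose[of S f g] continuous_on_subset[OF _ assms(3), of g] by simp
next
  case (Suc k)
  have g: "(g has_derivative frechet_derivative g (at (f x))) (at (f x))" if "x \<in> S" for x
    using Ck_on_SucD(1)[OF Suc.prems(2)] that assms(3) by blast
  show ?case
  proof (rule Ck_on_SucI[OF assms(1)])
    show "(g \<circ> f has_derivative
        frechet_derivative g (at (f x)) \<circ> frechet_derivative f (at x)) (at x)" if "x \<in> S" for x
      using diff_chain_at[OF Ck_on_SucD(1)[OF Suc.prems(1) that] g[OF that]] .
    show "Ck_on k S (\<lambda>x. (frechet_derivative g (at (f x)) \<circ> frechet_derivative f (at x)) v)" for v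
      unfolding o_apply
    proof (rule Ck_on_apply_linear[OF assms(1) _ _ Ck_on_SucD(2)[OF Suc.prems(1)]])
      show "linear (frechet_derivative g (at (f y)))" if "y \<in> S" for y
        using g[OF that] has_derivative_linear by blast
      show "Ck_on k S (\<lambda>y. frechet_derivative g (at (f y)) w)" for w
        using Suc.IH[OF Ck_on_Suc_imp[OF Suc.prems(1)] Ck_on_SucD(2)[OF Suc.prems(2)]]
        by (simp add: o_def)
    qed
  qed
qed

lemma Ck_on_Pair:
  fixes f :: "'a::real_normed_vector \<Rightarrow> 'b::real_normed_vector" and g :: "'a \<Rightarrow> 'c::real_normed_vector"
  assumes "open S" "Ck_on k S f" "Ck_on k S g"
  shows "Ck_on k S (\<lambda>x. (f x, g x))"
proof -
  have "bounded_linear (\<lambda>x::'b. (x, 0::'c))" "bounded_linear (\<lambda>x::'c. (0::'b, x))"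
    by (intro bounded_linear_Pair bounded_linear_ident bounded_linear_zero)+
  from Ck_on_add[OF assms(1) Ck_on_bounded_linear_compose[OF assms(1) this(1) assms(2)]
      Ck_on_bounded_linear_compose[OF assms(1) this(2) assms(3)]]
  show ?thesis by simp
qed

lemma linear_inv:
  assumes "linear f" "bij f"
  shows "linear (inv f)"
proof (rule linearI)
  have f: "f (inv f x) = x" for x using assms(2) by (simp add: bij_is_surj surj_f_inv_f)
  show "inv f (x + y) = inv f x + inv f y" for x y
    using assms(2) by (intro inv_f_eq bij_is_inj) (simp_all add: linear_add[OF assms(1)] f)
  show "inv f (c *\<^sub>R x) = c *\<^sub>R inv f x" for c x
    using assms(2) by (intro inv_f_eq bij_is_inj) (simp_all add: linear_cmul[OF assms(1)] f)
qed

text \<open>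
  The increment of the continuous factor \<open>r\<close> tends to 0 and is multiplied by \<open>h\<close>, which is
  \<open>O(\<parallel>y - x\<parallel>)\<close> because it vanishes at \<open>x\<close>; so it contributes only \<open>o(\<parallel>y - x\<parallel>)\<close>.
\<close>

lemma has_derivative_scaleR_vanishing:
  fixes r :: "'a::real_normed_vector \<Rightarrow> real"
  assumes r: "isCont r x" and h: "(h has_derivative h') (at x)" "h x = 0"
  shows "((\<lambda>y. r y *\<^sub>R h y) has_derivative (\<lambda>v. r x *\<^sub>R h' v)) (at x)"
proof -
  have 1: "((\<lambda>y. (r y - r x) *\<^sub>R h y) has_derivative (\<lambda>v. 0)) (at x)"
    unfolding has_derivative_iff_norm
  proof (intro conjI)
    obtain K where K: "\<And>y. norm (h' y) \<le> norm y * K" 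
      using bounded_linear.bounded[OF has_derivative_bounded_linear[OF h(1)]] by blast
    have q: "((\<lambda>y. norm (h y - h x - h' (y - x)) / norm (y - x)) \<longlongrightarrow> 0) (at x)"
      using h(1) unfolding has_derivative_iff_norm by blast
    have "((\<lambda>y. \<bar>r y - r x\<bar> * (norm (h y - h x - h' (y - x)) / norm (y - x) + K)) \<longlongrightarrow> \<bar>r x - r x\<bar> * (0 + K)) (at x)"
      using r unfolding isCont_def by (intro tendsto_intros q)
    then have lim: "((\<lambda>y. \<bar>r y - r x\<bar> * (norm (h y - h x - h' (y - x)) / norm (y - x) + K)) \<longlongrightarrow> 0) (at x)"
      by simp
    show "((\<lambda>y. norm ((r y - r x) *\<^sub>R h y - (r x - r x) *\<^sub>R h x - 0) / norm (y - x)) \<longlongrightarrow> 0) (at x)"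
    proof (rule Lim_null_comparison[OF _ lim], rule eventually_at_topological[THEN iffD2], 
        intro exI[of _ UNIV] conjI ballI impI)
      fix y assume "y \<noteq> x"
      then have n: "norm (y - x) > 0" by simp
      have "norm (h y) \<le> norm (h y - h x - h' (y - x)) + norm (h' (y - x))"
        using norm_triangle_ineq[of "h y - h x - h' (y - x)" "h' (y - x)"] h(2) by simp
      also have "\<dots> \<le> norm (h y - h x - h' (y - x)) + norm (y - x) * K" using K by simp
      finally have "norm (h y) / norm (y - x) \<le> norm (h y - h x - h' (y - x)) / norm (y - x) + K"
        using n by (simp add: field_simps)
      then have "\<bar>r y - r x\<bar> * (norm (h y) / norm (y - x)) \<le> \<bar>r y - r x\<bar> * (norm (h y - h x - h' (y - x)) / norm (y - x) + K)"
        by (rule mult_left_mono) simp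
      then show "norm (norm ((r y - r x) *\<^sub>R h y - (r x - r x) *\<^sub>R h x - 0) / norm (y - x))
          \<le> \<bar>r y - r x\<bar> * (norm (h y - h x - h' (y - x)) / norm (y - x) + K)"
        by simp
    qed (use open_UNIV in auto)
  qed simp
  have "((\<lambda>y. (r y - r x) *\<^sub>R h y + r x *\<^sub>R h y) has_derivative (\<lambda>v. 0 + r x *\<^sub>R h' v)) (at x)"
    by (intro has_derivative_add 1 bounded_linear.has_derivative[OF bounded_linear_scaleR_right h(1)])
  then show ?thesis by (simp add: algebra_simps)
qed

text \<open>
  With \<open>u y = A(y)\<^sup>-\<^sup>1 v\<close> one has \<open>u y - u y\<^sub>0 = A(y\<^sub>0)\<^sup>-\<^sup>1 (A(y\<^sub>0) - A(y)) (u y)\<close>.  When \<open>A(y)\<close> is close to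
  \<open>A(y\<^sub>0)\<close> in operator norm, this first bounds \<open>u y\<close> by twice \<open>u y\<^sub>0\<close> and then makes the difference small.
\<close>

lemma continuous_inverse_operator:
  fixes A :: "'y::real_normed_vector \<Rightarrow> 'a::findim_normed_vector \<Rightarrow> 'b::findim_normed_vector"
  assumes "open S" "\<And>y. y \<in> S \<Longrightarrow> linear (A y)" "\<And>y. y \<in> S \<Longrightarrow> bij (A y)"
    and cont: "\<And>w. continuous_on S (\<lambda>y. A y w)"
  shows "continuous_on S (\<lambda>y. inv (A y) v)"
proof (rule continuous_at_imp_continuous_on, intro ballI)
  fix y0 assume y0: "y0 \<in> S"
  define R where "R = inv (A y0)"
  define u where "u y = inv (A y) v" for y
  have "bounded_linear R" unfolding R_def
    using y0 assms linear_inv linear_imp_bounded_linear by blast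
  then obtain K where K: "K > 0" "\<And>x. norm (R x) \<le> norm x * K"
    using bounded_linear.pos_bounded by blast
  have ev: "\<forall>\<^sub>F y in at y0. y \<in> S" using assms(1) y0 by (rule eventually_at_in_open')
  have Au: "A y (u y) = v" if "y \<in> S" for y
    using that assms(3) by (simp add: u_def bij_is_surj surj_f_inv_f)
  have RA: "R (A y0 x) = x" for x using y0 assms(3) by (simp add: R_def bij_is_inj)
  interpret R: bounded_linear R by fact
  have est: "norm (u y - u y0) \<le> K * (e * norm (u y))" 
    if "y \<in> S" "\<forall>x. norm (A y x - A y0 x) \<le> e * norm x" for y e
  proof -
    have "u y - u y0 = R (A y0 (u y)) - R (A y0 (u y0))" by (simp add: RA)
    also have "\<dots> = R (- (A y (u y) - A y0 (u y)))" using Au[OF that(1)] Au[OF y0] by (simp add: R.diff)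
    also have "norm \<dots> \<le> norm (A y (u y) - A y0 (u y)) * K" using K(2)[of "- (A y (u y) - A y0 (u y))"] by (simp add: norm_minus_commute)
    also have "\<dots> \<le> (e * norm (u y)) * K" using that(2) K(1) by (intro mult_right_mono) auto
    finally show ?thesis by (simp add: mult_ac)
  qed
  have conv: "\<forall>\<^sub>F y in at y0. \<forall>x. norm (A y x - A y0 x) \<le> e * norm x" if "e > 0" for e
  proof (rule pointwise_imp_operator_norm_convergence[OF _ _ _ that])
    show "\<forall>\<^sub>F y in at y0. linear (A y)" using ev by eventually_elim (rule assms(2))
    show "linear (A y0)" using assms y0 by blast
    show "((\<lambda>y. A y w) \<longlongrightarrow> A y0 w) (at y0)" for w
      using cont[of w] assms(1) y0 by (simp add: continuous_on_eq_continuous_at isCont_def)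
  qed
  have "(u \<longlongrightarrow> u y0) (at y0)"
  proof (rule tendstoI)
    fix \<epsilon> :: real assume "\<epsilon> > 0"
    \<comment> \<open>The first bound gives \<open>K e \<le> 1/2\<close>, hence \<open>\<parallel>u y\<parallel> \<le> 2 \<parallel>u y\<^sub>0\<parallel>\<close>; the second then gives \<open>\<parallel>u y - u y\<^sub>0\<parallel> \<le> \<epsilon>/2\<close>.\<close>
    define e where "e = min (1 / (2 * K)) (\<epsilon> / (2 * K * (2 * norm (u y0) + 1)))"
    have e: "e > 0" using K(1) \<open>\<epsilon> > 0\<close> by (auto simp: e_def intro!: divide_pos_pos mult_pos_pos add_nonneg_pos)
    have e1: "K * e \<le> 1 / 2" using K(1) by (simp add: e_def min_def field_simps)
    have e2: "K * e * (2 * norm (u y0) + 1) \<le> \<epsilon> / 2"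
    proof -
      have "e \<le> \<epsilon> / (2 * K * (2 * norm (u y0) + 1))" by (simp add: e_def)
      moreover have "2 * K * (2 * norm (u y0) + 1) > 0" using K(1) by (intro mult_pos_pos add_nonneg_pos) auto
      ultimately have "e * (2 * K * (2 * norm (u y0) + 1)) \<le> \<epsilon>" by (simp add: pos_le_divide_eq)
      then show ?thesis by (simp add: algebra_simps)
    qed
    from conv[OF e] ev show "\<forall>\<^sub>F y in at y0. dist (u y) (u y0) < \<epsilon>"
    proof eventually_elim
      case (elim y)
      have 1: "norm (u y - u y0) \<le> K * e * norm (u y)" using est[OF elim(2,1)] by (simp add: mult_ac)
      also have "\<dots> \<le> 1 / 2 * norm (u y)" using e1 by (rule mult_right_mono) simp
      finally have "norm (u y) \<le> 2 * norm (u y0)" using norm_triangle_ineq2[of "u y" "u y0"] by simp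
      then have "K * e * norm (u y) \<le> K * e * (2 * norm (u y0) + 1)" using K(1) e by (intro mult_left_mono) auto
      with 1 e2 \<open>\<epsilon> > 0\<close> show ?case by (simp add: dist_norm)
    qed
  qed
  then show "isCont (\<lambda>y. inv (A y) v) y0" by (simp add: isCont_def u_def[abs_def])
qed

text \<open>
  The identity behind the continuity of \<open>u y = A(y)\<^sup>-\<^sup>1 v\<close> also differentiates \<open>u\<close>: written in
  coordinates of \<open>u y\<close>, each summand is a continuous function times a differentiable one vanishing at
  \<open>y\<^sub>0\<close>.  The derivative \<open>-A\<^sup>-\<^sup>1 (DA) A\<^sup>-\<^sup>1 v\<close> involves only \<open>DA\<close> and \<open>A\<^sup>-\<^sup>1\<close>, so the order of
  differentiability can be raised by induction.
\<close>

lemma Ck_on_inverse_operator: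
  fixes A :: "'y::real_normed_vector \<Rightarrow> 'a::findim_normed_vector \<Rightarrow> 'b::findim_normed_vector"
  assumes "open S" "\<And>y. y \<in> S \<Longrightarrow> linear (A y)" "\<And>y. y \<in> S \<Longrightarrow> bij (A y)"
    and "\<And>w. Ck_on k S (\<lambda>y. A y w)"
  shows "Ck_on k S (\<lambda>y. inv (A y) v)"
  using assms(4)
proof (induction k arbitrary: v)
  case 0
  then show ?case using continuous_inverse_operator[OF assms(1-3)] by simp
next
  case (Suc k)
  obtain B :: "'a set" and \<kappa> where B: "finite B" "\<And>b. bounded_linear (\<kappa> b)"
    "\<And>x. (\<Sum>b\<in>B. \<kappa> b x *\<^sub>R b) = x"
    by (rule findim_coordinates) blast
  define u where "u y = inv (A y) v" for y
  define DA where "DA y w b = frechet_derivative (\<lambda>y. A y b) (at y) w" for y w b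
  have A0: "continuous_on S (\<lambda>y. A y w)" for w
    using Ck_on_SucD(1)[OF Suc.prems[of w]]
    by (meson continuous_at_imp_continuous_on has_derivative_continuous)
  have DA: "((\<lambda>y. A y b) has_derivative (\<lambda>w. DA y w b)) (at y)" if "y \<in> S" for y b
    unfolding DA_def using Ck_on_SucD(1)[OF Suc.prems that] .
  have IH: "Ck_on k S (\<lambda>y. inv (A y) w)" for w by (rule Suc.IH[OF Ck_on_Suc_imp[OF Suc.prems]])
  have u: "Ck_on k S u" unfolding u_def by (rule IH)
  have linv: "linear (inv (A y))" if "y \<in> S" for y using linear_inv assms that by blast
  have Au: "A y (u y) = v" if "y \<in> S" for y
    using that assms(3) by (simp add: u_def bij_is_surj surj_f_inv_f)
  have contu: "isCont u y" if "y \<in> S" for y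
    using continuous_inverse_operator[OF assms(1-3) A0, of v] assms(1) that
    by (simp add: continuous_on_eq_continuous_at u_def[abs_def])
  have der: "(u has_derivative (\<lambda>w. \<Sum>b\<in>B. \<kappa> b (u y0) *\<^sub>R inv (A y0) (- DA y0 w b))) (at y0)"
    if y0: "y0 \<in> S" for y0
  proof -
    define R where "R = inv (A y0)"
    have R: "bounded_linear R" unfolding R_def using linv[OF y0] by (rule linear_imp_bounded_linear)
    interpret R: bounded_linear R by fact
    have RA: "R (A y0 x) = x" for x using y0 assms(3) by (simp add: R_def bij_is_inj)
    have eq: "u y = u y0 + (\<Sum>b\<in>B. \<kappa> b (u y) *\<^sub>R R (A y0 b - A y b))" if "y \<in> S" for y
    proof -
      have "linear (\<lambda>x. R (A y0 x - A y x))"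
        using assms(2)[OF that] assms(2)[OF y0] 
        by (intro linear_compose[OF linear_compose_sub R.linear, unfolded o_def]) auto
      from linear_expand[OF this B(3), of "u y"]
      have "(\<Sum>b\<in>B. \<kappa> b (u y) *\<^sub>R R (A y0 b - A y b)) = R (A y0 (u y) - A y (u y))" by (rule sym)
      also have "\<dots> = R (A y0 (u y)) - R (A y0 (u y0))" using Au[OF that] Au[OF y0] by (simp add: R.diff)
      finally show ?thesis by (simp add: RA)
    qed
    have "((\<lambda>y. u y0 + (\<Sum>b\<in>B. \<kappa> b (u y) *\<^sub>R R (A y0 b - A y b))) has_derivative
        (\<lambda>w. 0 + (\<Sum>b\<in>B. \<kappa> b (u y0) *\<^sub>R R (0 - DA y0 w b)))) (at y0)"
      by (intro has_derivative_add has_derivative_const has_derivative_sum 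
          has_derivative_scaleR_vanishing isCont_o2[OF contu[OF y0]] linear_continuous_at B(2)
          bounded_linear.has_derivative[OF R] has_derivative_diff DA[OF y0])
        (simp add: R.zero)
    then have "((\<lambda>y. u y0 + (\<Sum>b\<in>B. \<kappa> b (u y) *\<^sub>R R (A y0 b - A y b))) has_derivative
        (\<lambda>w. (\<Sum>b\<in>B. \<kappa> b (u y0) *\<^sub>R R (- DA y0 w b)))) (at y0)" by simp
    then show ?thesis unfolding R_def[symmetric]
      by (rule has_derivative_transform_within_open[OF _ assms(1) y0]) (rule eq[symmetric])
  qed
  have "Ck_on (Suc k) S u"
  proof (rule Ck_on_SucI[OF assms(1) der])
    have "Ck_on k S (\<lambda>y. - DA y w b)" for w b
      using Ck_on_bounded_linear_compose[OF assms(1) bounded_linear_minus[OF bounded_linear_ident] Ck_on_SucD(2)[OF Suc.prems]]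
      unfolding DA_def .
    then show "Ck_on k S (\<lambda>y. \<Sum>b\<in>B. \<kappa> b (u y) *\<^sub>R inv (A y) (- DA y w b))" for w
      by (intro Ck_on_sum[OF assms(1) B(1)] Ck_on_scaleR[OF assms(1)]
          Ck_on_bounded_linear_compose[OF assms(1) B(2) u] Ck_on_apply_linear[OF assms(1) linv IH])
  qed
  then show ?case by (simp add: u_def[abs_def])
qed

section \<open>The inverse function theorem\<close>

text \<open>
  With \<open>R\<close> inverse to the derivative at \<open>x\<^sub>0\<close>, the map \<open>g x = x - R (f x)\<close> is a contraction near \<open>x\<^sub>0\<close>.
  This makes \<open>f\<close> injective there, and a fixed point of \<open>x \<mapsto> g x + R y\<close> is a solution of \<open>f x = y\<close>.
  The solution is found in arbitrarily small balls, which is what openness of \<open>f\<close> requires.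
\<close>

lemma local_inverse_at_point:
  fixes f :: "'a::findim_normed_vector \<Rightarrow> 'b::findim_normed_vector"
  assumes "open S" "Ck_on 1 S f" "x0 \<in> S" "bij (frechet_derivative f (at x0))"
  obtains r where "r > 0" "inj_on f (cball x0 r)"
    "\<And>\<rho>. 0 < \<rho> \<Longrightarrow> \<rho> \<le> r \<Longrightarrow> \<exists>s>0. ball (f x0) s \<subseteq> f ` cball x0 \<rho>"
proof -
  define D where "D x = frechet_derivative f (at x)" for x
  have C: "Ck_on (Suc 0) S f" using assms(2) by simp
  have der: "(f has_derivative D x) (at x)" if "x \<in> S" for x
    unfolding D_def using Ck_on_SucD(1)[OF C that] .
  have contD: "continuous_on S (\<lambda>x. D x v)" for v
    unfolding D_def using Ck_on_SucD(2)[OF C, of v] by simp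
  have linD: "linear (D x)" if "x \<in> S" for x using der[OF that] has_derivative_linear by blast
  have bij: "bij (D x0)" using assms(4) by (simp add: D_def)
  define R where "R = inv (D x0)"
  have R: "bounded_linear R" unfolding R_def 
    using linear_inv[OF linD[OF assms(3)] bij] by (rule linear_imp_bounded_linear)
  interpret R: bounded_linear R by fact
  have RD: "R (D x0 x) = x" for x using bij by (simp add: R_def bij_is_inj)
  have injR: "inj R" unfolding R_def using bij bij_imp_bij_inv bij_is_inj by blast
  obtain K where K: "K > 0" "\<And>x. norm (R x) \<le> norm x * K" using R.pos_bounded by blast
  have ev: "\<forall>\<^sub>F x in at x0. x \<in> S" using assms(1,3) by (rule eventually_at_in_open')
  \<comment> \<open>The factor \<open>1/(2K)\<close> makes \<open>id - R \<circ> Df(x)\<close> have norm at most 1/2.\<close>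
  have "\<forall>\<^sub>F x in at x0. \<forall>v. norm (D x v - D x0 v) \<le> (1 / (2 * K)) * norm v"
  proof (rule pointwise_imp_operator_norm_convergence)
    show "\<forall>\<^sub>F y in at x0. linear (D y)" using ev by eventually_elim (rule linD)
    show "((\<lambda>y. D y w) \<longlongrightarrow> D x0 w) (at x0)" for w
      using contD[of w] assms(1,3) by (simp add: continuous_on_eq_continuous_at isCont_def)
  qed (use K linD assms(3) in auto)
  with ev have "\<forall>\<^sub>F x in at x0. x \<in> S \<and> (\<forall>v. norm (D x v - D x0 v) \<le> (1 / (2 * K)) * norm v)"
    by eventually_elim simp
  then obtain d where d: "d > 0" "\<And>x. x \<noteq> x0 \<Longrightarrow> dist x x0 < d \<Longrightarrow> 
      x \<in> S \<and> (\<forall>v. norm (D x v - D x0 v) \<le> (1 / (2 * K)) * norm v)"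
    unfolding eventually_at by blast
  define r where "r = d / 2"
  have r: "r > 0" using d(1) by (simp add: r_def)
  have near: "x \<in> S \<and> (\<forall>v. norm (D x v - D x0 v) \<le> (1 / (2 * K)) * norm v)" if "x \<in> cball x0 r" for x
  proof (cases "x = x0")
    case False
    then show ?thesis using d that by (auto simp: r_def dist_commute)
  qed (use assms(3) K(1) in auto)
  define g where "g x = x - R (f x)" for x
  have contr: "norm (g x - g y) \<le> (1 / 2) * norm (x - y)" if "x \<in> cball x0 r" "y \<in> cball x0 r" for x y
  proof (rule differentiable_bound[where S = "cball x0 r" and f' = "\<lambda>x v. v - R (D x v)"])
    fix z assume z: "z \<in> cball x0 r"
    show "(g has_derivative (\<lambda>v. v - R (D z v))) (at z within cball x0 r)"
      unfolding g_def using near[OF z]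
      by (intro has_derivative_diff has_derivative_ident bounded_linear.has_derivative[OF R]
          has_derivative_at_withinI[OF der]) auto
    show "onorm (\<lambda>v. v - R (D z v)) \<le> 1 / 2"
    proof (rule onorm_bound)
      fix v
      have "v - R (D z v) = R (- (D z v - D x0 v))" by (simp add: R.diff RD)
      also have "norm \<dots> \<le> norm (- (D z v - D x0 v)) * K" by (rule K(2))
      also have "\<dots> \<le> ((1 / (2 * K)) * norm v) * K"
        unfolding norm_minus_cancel using near[OF z] K(1) by (intro mult_right_mono) auto
      finally show "norm (v - R (D z v)) \<le> 1 / 2 * norm v" using K(1) by simp
    qed simp
  qed (use that in auto)
  have "inj_on f (cball x0 r)"
  proof (rule inj_onI)
    fix x y assume "x \<in> cball x0 r" "y \<in> cball x0 r" "f x = f y"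
    then show "x = y" using contr[of x y] by (simp add: g_def)
  qed
  moreover have "\<exists>s>0. ball (f x0) s \<subseteq> f ` cball x0 \<rho>" if \<rho>: "0 < \<rho>" "\<rho> \<le> r" for \<rho>
  proof (intro exI conjI subsetI)
    \<comment> \<open>On this ball \<open>R (f x\<^sub>0 - y)\<close> has norm at most \<open>\<rho>/2\<close>; the contraction supplies the other half of \<open>\<rho>\<close>.\<close>
    show "\<rho> / (2 * K) > 0" using \<rho> K(1) by simp
    fix y assume y: "y \<in> ball (f x0) (\<rho> / (2 * K))"
    have sub: "cball x0 \<rho> \<subseteq> cball x0 r" using \<rho> by auto
    have "\<exists>!x\<in>cball x0 \<rho>. g x + R y = x"
    proof (rule Banach_fix)
      show "(\<lambda>x. g x + R y) ` cball x0 \<rho> \<subseteq> cball x0 \<rho>"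
      proof (clarsimp simp: dist_norm)
        fix x assume x: "norm (x0 - x) \<le> \<rho>"
        have "norm (x0 - (g x + R y)) = norm ((g x0 - g x) + R (f x0 - y))" 
          by (simp add: g_def R.diff algebra_simps)
        also have "\<dots> \<le> norm (g x0 - g x) + norm (R (f x0 - y))" by (rule norm_triangle_ineq)
        also have "norm (g x0 - g x) \<le> 1 / 2 * norm (x0 - x)" 
          using x \<rho> r by (intro contr) (auto simp: dist_norm)
        also have "norm (R (f x0 - y)) \<le> norm (f x0 - y) * K" by (rule K(2))
        also have "\<dots> \<le> \<rho> / 2" using y K(1) by (simp add: dist_norm field_simps)
        finally show "norm (x0 - (g x + R y)) \<le> \<rho>" using x by simp
      qed
      show "dist (g x + R y) (g z + R y) \<le> 1 / 2 * dist x z" 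
        if "x \<in> cball x0 \<rho>" "z \<in> cball x0 \<rho>" for x z
        using contr that sub by (simp add: dist_norm subset_iff)
      show "complete (cball x0 \<rho>)" 
        using complete_Int_closed[OF complete_subspace[OF subspace_UNIV] closed_cball] by simp
    qed (use \<rho> in auto)
    then obtain x where "x \<in> cball x0 \<rho>" "g x + R y = x" by blast
    then have "x \<in> cball x0 \<rho>" "f x = y" using injR by (auto simp: g_def inj_eq)
    then show "y \<in> f ` cball x0 \<rho>" by blast
  qed
  ultimately show ?thesis using that r by blast
qed

lemma open_image_of_bijective_derivative:
  fixes f :: "'a::findim_normed_vector \<Rightarrow> 'b::findim_normed_vector"
  assumes "open S" "Ck_on 1 S f" "\<And>x. x \<in> S \<Longrightarrow> bij (frechet_derivative f (at x))"
  shows "open (f ` S)"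
  unfolding open_contains_ball
proof
  fix y assume "y \<in> f ` S"
  then obtain x where x: "x \<in> S" "y = f x" by blast
  obtain r where r: "r > 0" "\<And>\<rho>. 0 < \<rho> \<Longrightarrow> \<rho> \<le> r \<Longrightarrow> \<exists>s>0. ball (f x) s \<subseteq> f ` cball x \<rho>"
    using local_inverse_at_point[OF assms(1,2) x(1) assms(3)[OF x(1)]] by blast
  obtain t where t: "t > 0" "cball x t \<subseteq> S" using assms(1) x(1) open_contains_cball by blast
  obtain s where "s > 0" "ball (f x) s \<subseteq> f ` cball x (min r t)" using r t(1) by (meson min.cobounded1 min_less_iff_conj)
  moreover have "cball x (min r t) \<subseteq> S" using t by auto
  ultimately show "\<exists>e>0. ball y e \<subseteq> f ` S" using x(2) by blast
qed

text \<open>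
  The inverse is continuous since \<open>f\<close> is open, and its derivative at \<open>y\<close> is the inverse of the
  operator \<open>Df(g y)\<close>.  If \<open>g\<close> is \<open>C\<^sup>k\<close>, then so is \<open>y \<mapsto> Df(g y)\<close> and hence, by
  \<open>Ck_on_inverse_operator\<close>, the derivative of \<open>g\<close>.
\<close>

lemma smooth_inverse:
  fixes f :: "'a::findim_normed_vector \<Rightarrow> 'b::findim_normed_vector"
  assumes "open S" "smooth_on S f" "\<And>x. x \<in> S \<Longrightarrow> bij (frechet_derivative f (at x))"
    and g: "\<And>x. x \<in> S \<Longrightarrow> g (f x) = x"
  shows "smooth_on (f ` S) g"
  unfolding smooth_on_def
proof
  have Ck: "Ck_on k S f" for k using assms(2) by (simp add: smooth_on_def)
  have op: "open (f ` S')" if "open S'" "S' \<subseteq> S" for S'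
    using open_image_of_bijective_derivative[OF that(1) Ck_on_subset[OF Ck that(2)]] assms(3) that by blast
  have oT: "open (f ` S)" using op assms(1) by blast
  have contg: "continuous_on (f ` S) g"
  proof (rule continuous_on_open_invariant[THEN iffD2], intro allI impI)
    fix B :: "'a set" assume "open B"
    moreover have "f ` (S \<inter> B) \<inter> f ` S = g -` B \<inter> f ` S" using g by force
    ultimately show "\<exists>A. open A \<and> A \<inter> f ` S = g -` B \<inter> f ` S"
      using op[of "S \<inter> B"] assms(1) by blast
  qed
  have gS: "g y \<in> S" "f (g y) = y" if "y \<in> f ` S" for y using that g by auto
  define D where "D x = frechet_derivative f (at x)" for x
  have C1: "Ck_on (Suc 0) S f" by (rule Ck)
  have derf: "(f has_derivative D x) (at x)" if "x \<in> S" for x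
    unfolding D_def using Ck_on_SucD(1)[OF C1 that] .
  have linD: "linear (D x)" if "x \<in> S" for x using derf[OF that] has_derivative_linear by blast
  have derg: "(g has_derivative inv (D (g y))) (at y)" if y: "y \<in> f ` S" for y
  proof (rule has_derivative_inverse_basic[where f = f and f' = "D (g y)" and T = "f ` S"])
    show "bounded_linear (inv (D (g y)))"
      using linear_inv linear_imp_bounded_linear linD gS(1)[OF y] assms(3) D_def by metis
    show "inv (D (g y)) \<circ> D (g y) = id"
      using assms(3)[OF gS(1)[OF y]] by (simp add: D_def bij_is_inj)
    show "continuous (at y) g" 
      using bspec[OF iffD1[OF continuous_on_eq_continuous_at[OF oT] contg] y] .
    show "(f has_derivative D (g y)) (at (g y))" using derf[OF gS(1)[OF y]] .
  qed (fact oT y gS(2))+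
  show "Ck_on k (f ` S) g" for k
  proof (induction k)
    case 0
    then show ?case using contg by simp
  next
    case (Suc k)
    show ?case
    proof (rule Ck_on_SucI[OF oT derg])
      show "Ck_on k (f ` S) (\<lambda>y. inv (D (g y)) v)" for v
      proof (rule Ck_on_inverse_operator[OF oT])
        show "Ck_on k (f ` S) (\<lambda>y. D (g y) w)" for w
          using Ck_on_compose[OF oT assms(1) _ Suc.IH Ck_on_SucD(2)[OF Ck], of w] gS(1)
          unfolding D_def o_def by (simp add: image_subset_iff)
        show "linear (D (g y))" "bij (D (g y))" if "y \<in> f ` S" for y
          using linD[OF gS(1)[OF that]] assms(3)[OF gS(1)[OF that]] by (simp_all add: D_def)
      qed
    qed
  qed
qed

section \<open>Charts and smooth maps\<close>

text \<open>
  The conditions that a chart is a homeomorphism onto an open set, stated through images and preimages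
  of open sets; in this form they pass directly to restrictions and products of charts.
\<close>

definition open_chart :: "'m topology \<Rightarrow> ('m, 'e::topological_space) chart \<Rightarrow> bool" where
  "open_chart T c \<longleftrightarrow> openin T (fst c) \<and> inj_on (snd c) (fst c) \<and>
     (\<forall>A. openin T A \<and> A \<subseteq> fst c \<longrightarrow> open (snd c ` A)) \<and>
     (\<forall>B. open B \<longrightarrow> openin T {p \<in> fst c. snd c p \<in> B})"

lemma open_chart_iff_homeomorphic:
  "open_chart T (V, \<phi>) \<longleftrightarrow> openin T V \<and> open (\<phi> ` V) \<and>
     homeomorphic_map (subtopology T V) (top_of_set (\<phi> ` V)) \<phi>" (is "?L \<longleftrightarrow> ?R")
proof
  assume L: ?L
  then have V: "openin T V" and inj: "inj_on \<phi> V" and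
    im: "\<And>A. openin T A \<Longrightarrow> A \<subseteq> V \<Longrightarrow> open (\<phi> ` A)" and
    pre: "\<And>B. open B \<Longrightarrow> openin T {p \<in> V. \<phi> p \<in> B}"
    by (auto simp: open_chart_def)
  have op: "open (\<phi> ` V)" using im V by blast
  have sub: "topspace T \<inter> V = V" using openin_subset[OF V] by blast
  have "homeomorphic_map (subtopology T V) (top_of_set (\<phi> ` V)) \<phi>"
  proof (rule bijective_open_imp_homeomorphic_map)
    show "continuous_map (subtopology T V) (top_of_set (\<phi> ` V)) \<phi>"
    proof (rule continuous_map_into_subtopology)
      show "continuous_map (subtopology T V) euclidean \<phi>"
        unfolding continuous_map
      proof (intro conjI allI impI)
        fix B :: "'b set" assume "openin euclidean B"
        then have "openin T {p \<in> V. \<phi> p \<in> B}" using pre by simp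
        then show "openin (subtopology T V) {x \<in> topspace (subtopology T V). \<phi> x \<in> B}"
          using V by (simp add: openin_open_subtopology sub)
      qed simp
    qed (simp add: sub)
    show "open_map (subtopology T V) (top_of_set (\<phi> ` V)) \<phi>"
      unfolding open_map_def
    proof (intro allI impI)
      fix A assume "openin (subtopology T V) A"
      then have A: "openin T A" "A \<subseteq> V" using V by (simp_all add: openin_open_subtopology)
      then show "openin (top_of_set (\<phi> ` V)) (\<phi> ` A)"
        using im[OF A] op by (simp add: openin_open_eq image_mono)
    qed
  qed (simp_all add: sub inj)
  with V op show ?R by simp
next
  assume R: ?R
  then have V: "openin T V" and op: "open (\<phi> ` V)"
    and h: "homeomorphic_map (subtopology T V) (top_of_set (\<phi> ` V)) \<phi>" by auto
  have sub: "topspace T \<inter> V = V" using openin_subset[OF V] by blast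
  have "inj_on \<phi> V" using homeomorphic_imp_injective_map[OF h] by (simp add: sub)
  moreover have "open (\<phi> ` A)" if "openin T A" "A \<subseteq> V" for A
  proof -
    have "openin (subtopology T V) A" using that V by (simp add: openin_open_subtopology)
    then have "openin (top_of_set (\<phi> ` V)) (\<phi> ` A)"
      using homeomorphic_imp_open_map[OF h] by (simp add: open_map_def)
    then show ?thesis using op by (rule openin_open_trans)
  qed
  moreover have "openin T {p \<in> V. \<phi> p \<in> B}" if "open B" for B
  proof -
    have c: "continuous_map (subtopology T V) euclidean \<phi>"
      using homeomorphic_imp_continuous_map[OF h] by (simp add: continuous_map_in_subtopology)
    have "openin (subtopology T V) {p \<in> topspace (subtopology T V). \<phi> p \<in> B}"
      using that by (intro openin_continuous_map_preimage[OF c]) simp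
    then show ?thesis using V by (simp add: openin_open_subtopology sub)
  qed
  ultimately show ?L using V by (simp add: open_chart_def)
qed

lemma smooth_manifold_iff:
  "smooth_manifold M \<longleftrightarrow>
     Hausdorff_space (mtop M) \<and> second_countable (mtop M) \<and>
     (\<forall>c \<in> atlas M. open_chart (mtop M) c) \<and> (\<Union>c \<in> atlas M. fst c) = carr M \<and>
     (\<forall>c \<in> atlas M. \<forall>d \<in> atlas M. smooth_on (snd c ` (fst c \<inter> fst d)) (snd d \<circ> chart_inv c))"
proof -
  have "(\<Union>(V, \<phi>) \<in> atlas M. V) = (\<Union>c \<in> atlas M. fst c)" by (simp add: case_prod_unfold)
  moreover have "(\<forall>(V, \<phi>) \<in> atlas M. openin (mtop M) V \<and> open (\<phi> ` V) \<and>
        homeomorphic_map (subtopology (mtop M) V) (top_of_set (\<phi> ` V)) \<phi>)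
      \<longleftrightarrow> (\<forall>c \<in> atlas M. open_chart (mtop M) c)"
    by (intro ball_cong refl) (simp add: open_chart_iff_homeomorphic[symmetric] case_prod_unfold)
  ultimately show ?thesis unfolding smooth_manifold_def by simp
qed

lemma open_chartD:
  assumes "open_chart T c"
  shows "openin T (fst c)" "inj_on (snd c) (fst c)"
    "\<And>A. openin T A \<Longrightarrow> A \<subseteq> fst c \<Longrightarrow> open (snd c ` A)"
    "\<And>B. open B \<Longrightarrow> openin T {p \<in> fst c. snd c p \<in> B}"
    "fst c \<subseteq> topspace T"
    "\<And>p. p \<in> fst c \<Longrightarrow> chart_inv c (snd c p) = p"
  using assms openin_subset[of T "fst c"] by (auto simp: open_chart_def chart_inv_def)

lemma charts_atD:
  assumes "c \<in> charts_at M p"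
  shows "c \<in> atlas M" "p \<in> fst c"
  using assms by (auto simp: charts_at_def)

lemma atlas_chart: "smooth_manifold M \<Longrightarrow> c \<in> atlas M \<Longrightarrow> open_chart (mtop M) c"
  by (simp add: smooth_manifold_iff)

lemma transition_smooth:
  "smooth_manifold M \<Longrightarrow> c \<in> atlas M \<Longrightarrow> d \<in> atlas M \<Longrightarrow>
    smooth_on (snd c ` (fst c \<inter> fst d)) (snd d \<circ> chart_inv c)"
  by (simp add: smooth_manifold_iff)

lemma charts_at_exists:
  assumes "smooth_manifold M" "p \<in> carr M"
  obtains c where "c \<in> charts_at M p"
proof -
  have "(\<Union>c \<in> atlas M. fst c) = carr M" using assms(1) by (simp add: smooth_manifold_iff)
  then obtain c where "c \<in> atlas M" "p \<in> fst c" using assms(2) by blast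
  then show ?thesis using that by (simp add: charts_at_def)
qed

lemma charts_at_in_carr:
  assumes "smooth_manifold M" "c \<in> charts_at M p"
  shows "p \<in> carr M"
  using open_chartD(5)[OF atlas_chart[OF assms(1) charts_atD(1)[OF assms(2)]]] charts_atD(2)[OF assms(2)] by blast

lemma openin_chart_overlap:
  assumes "smooth_manifold M" "smooth_manifold N" "continuous_map (mtop M) (mtop N) f"
    "c \<in> atlas M" "d \<in> atlas N"
  shows "openin (mtop M) (fst c \<inter> f -` fst d)"
proof -
  note c = open_chartD[OF atlas_chart[OF assms(1,4)]] and d = open_chartD[OF atlas_chart[OF assms(2,5)]]
  have "openin (mtop M) (fst c \<inter> {x \<in> carr M. f x \<in> fst d})"
    using openin_continuous_map_preimage[OF assms(3) d(1)] c(1) by blast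
  moreover have "fst c \<inter> f -` fst d = fst c \<inter> {x \<in> carr M. f x \<in> fst d}" using c(5) by blast
  ultimately show ?thesis by simp
qed

lemma smooth_mapD:
  assumes "smooth_map M N f"
  shows "continuous_map (mtop M) (mtop N) f"
    "\<And>c d. c \<in> atlas M \<Longrightarrow> d \<in> atlas N \<Longrightarrow>
      smooth_on (snd c ` (fst c \<inter> f -` fst d)) (snd d \<circ> f \<circ> chart_inv c)"
    "\<And>p. p \<in> carr M \<Longrightarrow> f p \<in> carr N"
  using assms continuous_map_image_subset_topspace[of "mtop M" "mtop N" f]
  by (auto simp: smooth_map_def)

lemma open_overlap_image:
  assumes "smooth_manifold M" "smooth_manifold N" "smooth_map M N f" "c \<in> atlas M" "d \<in> atlas N"
  shows "open (snd c ` (fst c \<inter> f -` fst d))"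
  by (rule open_chartD(3)[OF atlas_chart[OF assms(1,4)]
      openin_chart_overlap[OF assms(1,2) smooth_mapD(1)[OF assms(3)] assms(4,5)]]) blast

lemma smooth_on_cong:
  assumes "open S" "\<And>x. x \<in> S \<Longrightarrow> f x = g x"
  shows "smooth_on S f \<longleftrightarrow> smooth_on S g"
  unfolding smooth_on_def using Ck_on_cong[OF assms] by simp

lemma smooth_on_subset: "smooth_on S f \<Longrightarrow> T \<subseteq> S \<Longrightarrow> smooth_on T f"
  unfolding smooth_on_def using Ck_on_subset by blast

lemma smooth_map_cong:
  assumes M: "smooth_manifold M" and N: "smooth_manifold N" and f: "smooth_map M N f"
    and eq: "\<And>p. p \<in> carr M \<Longrightarrow> f p = g p"
  shows "smooth_map M N g"
  unfolding smooth_map_def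
proof (intro conjI ballI)
  show cont: "continuous_map (mtop M) (mtop N) g"
    using smooth_mapD(1)[OF f] eq by (rule continuous_map_eq)
  fix c d assume c: "c \<in> atlas M" and d: "d \<in> atlas N"
  note C = open_chartD[OF atlas_chart[OF M c]]
  have fg: "fst c \<inter> g -` fst d = fst c \<inter> f -` fst d" using C(5) eq by auto
  have "smooth_on (snd c ` (fst c \<inter> f -` fst d)) (snd d \<circ> f \<circ> chart_inv c)"
    by (rule smooth_mapD(2)[OF f c d])
  moreover have "(snd d \<circ> f \<circ> chart_inv c) x = (snd d \<circ> g \<circ> chart_inv c) x"
    if "x \<in> snd c ` (fst c \<inter> f -` fst d)" for x
    using that C(5,6) eq by auto
  ultimately show "smooth_on (snd c ` (fst c \<inter> g -` fst d)) (snd d \<circ> g \<circ> chart_inv c)"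
    unfolding fg using smooth_on_cong[OF open_overlap_image[OF M N f c d]] by blast
qed

lemma smooth_map_id:
  assumes "smooth_manifold M"
  shows "smooth_map M M id"
  unfolding smooth_map_def using assms by (auto simp: smooth_manifold_iff)

text \<open>
  Smoothness is local, and near each point the composition factors through a single chart of the
  middle manifold.
\<close>

lemma smooth_map_compose:
  assumes M: "smooth_manifold M" and N: "smooth_manifold N" and Q: "smooth_manifold Q"
    and f: "smooth_map M N f" and g: "smooth_map N Q g"
  shows "smooth_map M Q (g \<circ> f)"
  unfolding smooth_map_def
proof (intro conjI ballI)
  show cont: "continuous_map (mtop M) (mtop Q) (g \<circ> f)"
    using smooth_mapD(1)[OF f] smooth_mapD(1)[OF g] by (rule continuous_map_compose)
  fix c e assume c: "c \<in> atlas M" and e: "e \<in> atlas Q"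
  note C = open_chartD[OF atlas_chart[OF M c]]
  show "smooth_on (snd c ` (fst c \<inter> (g \<circ> f) -` fst e)) (snd e \<circ> (g \<circ> f) \<circ> chart_inv c)"
    unfolding smooth_on_def
  proof (intro allI Ck_on_local)
    fix k x assume "x \<in> snd c ` (fst c \<inter> (g \<circ> f) -` fst e)"
    then obtain p where p: "p \<in> fst c" "g (f p) \<in> fst e" "x = snd c p" by auto
    have "f p \<in> carr N" using smooth_mapD(3)[OF f] p(1) C(5) by blast
    then obtain d where "d \<in> charts_at N (f p)" using charts_at_exists[OF N] by blast
    then have d: "d \<in> atlas N" "f p \<in> fst d" by (auto dest: charts_atD)
    note D = open_chartD[OF atlas_chart[OF N d(1)]]
    define A where "A = snd d \<circ> f \<circ> chart_inv c"
    define B where "B = snd e \<circ> g \<circ> chart_inv d"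
    define W where "W = (fst c \<inter> f -` fst d) \<inter> (fst c \<inter> (g \<circ> f) -` fst e)"
    have W: "open (snd c ` W)" unfolding W_def
      by (rule C(3)[OF openin_Int[OF openin_chart_overlap[OF M N smooth_mapD(1)[OF f] c d(1)]
            openin_chart_overlap[OF M Q cont c e]]]) blast
    have "Ck_on k (snd c ` W) (B \<circ> A)"
    proof (rule Ck_on_compose[OF W open_overlap_image[OF N Q g d(1) e]])
      show "A ` snd c ` W \<subseteq> snd d ` (fst d \<inter> g -` fst e)"
        using C(6) by (auto simp: W_def A_def)
      have "Ck_on k (snd c ` (fst c \<inter> f -` fst d)) A"
        using smooth_mapD(2)[OF f c d(1)] by (simp add: A_def smooth_on_def)
      then show "Ck_on k (snd c ` W) A" by (rule Ck_on_subset) (auto simp: W_def)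
      show "Ck_on k (snd d ` (fst d \<inter> g -` fst e)) B"
        using smooth_mapD(2)[OF g d(1) e] by (simp add: B_def smooth_on_def)
    qed
    moreover have "(B \<circ> A) y = (snd e \<circ> (g \<circ> f) \<circ> chart_inv c) y" if "y \<in> snd c ` W" for y
      using that C(6) D(6) by (auto simp: W_def A_def B_def)
    ultimately have "Ck_on k (snd c ` W) (snd e \<circ> (g \<circ> f) \<circ> chart_inv c)"
      using Ck_on_cong[OF W] by blast
    moreover have "x \<in> snd c ` W" using p d(2) by (auto simp: W_def)
    ultimately show "\<exists>T. open T \<and> x \<in> T \<and> Ck_on k T (snd e \<circ> (g \<circ> f) \<circ> chart_inv c)"
      using W by blast
  qed
qed

section \<open>Open submanifolds\<close>

abbreviation restrict_chart :: "'m set \<Rightarrow> ('m, 'e) chart \<Rightarrow> ('m, 'e) chart" where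
  "restrict_chart U c \<equiv> (U \<inter> fst c, snd c)"

lemma open_submanifold_simps:
  "mtop (open_submanifold M U) = subtopology (mtop M) U"
  "atlas (open_submanifold M U) = restrict_chart U ` atlas M"
  by (auto simp: open_submanifold_def case_prod_unfold)

lemma carr_open_submanifold:
  "openin (mtop M) U \<Longrightarrow> carr (open_submanifold M U) = U"
  using openin_subset[of "mtop M" U] by (auto simp: open_submanifold_simps)

lemma charts_at_open_submanifold:
  "p \<in> U \<Longrightarrow> charts_at (open_submanifold M U) p = restrict_chart U ` charts_at M p"
  by (auto simp: charts_at_def open_submanifold_simps)

lemma open_chart_restrict:
  assumes "open_chart T c" "openin T U"
  shows "open_chart (subtopology T U) (restrict_chart U c)"
  unfolding open_chart_def fst_conv snd_conv
proof (intro conjI allI impI)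
  note C = open_chartD[OF assms(1)]
  show "openin (subtopology T U) (U \<inter> fst c)" using C(1) assms(2) by (simp add: openin_subtopology_Int2)
  show "inj_on (snd c) (U \<inter> fst c)" using C(2) by (rule inj_on_subset) simp
  show "open (snd c ` A)" if "openin (subtopology T U) A \<and> A \<subseteq> U \<inter> fst c" for A
    using that assms(2) C(3) by (simp add: openin_open_subtopology)
  show "openin (subtopology T U) {p \<in> U \<inter> fst c. snd c p \<in> B}" if "open B" for B
  proof -
    have "{p \<in> U \<inter> fst c. snd c p \<in> B} = U \<inter> {p \<in> fst c. snd c p \<in> B}" by blast
    then show ?thesis using C(4)[OF that] by (simp add: openin_subtopology_Int2)
  qed
qed

lemma restricted_transition_smooth:
  assumes M: "smooth_manifold M" and U: "openin (mtop M) U" and c: "c \<in> atlas M" and d: "d \<in> atlas M"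
  shows "smooth_on (snd c ` (U \<inter> fst c \<inter> fst d)) (snd d \<circ> chart_inv (restrict_chart U c))"
proof -
  note C = open_chartD[OF atlas_chart[OF M c]] and D = open_chartD[OF atlas_chart[OF M d]]
  note R = open_chartD[OF open_chart_restrict[OF atlas_chart[OF M c] U]]
  have op: "open (snd c ` (U \<inter> fst c \<inter> fst d))"
    using U C(1) D(1) by (intro C(3) openin_Int) auto
  have "smooth_on (snd c ` (fst c \<inter> fst d)) (snd d \<circ> chart_inv c)"
    using M c d by (simp add: smooth_manifold_iff)
  then have "smooth_on (snd c ` (U \<inter> fst c \<inter> fst d)) (snd d \<circ> chart_inv c)"
    by (rule smooth_on_subset) auto
  moreover have "(snd d \<circ> chart_inv c) x = (snd d \<circ> chart_inv (restrict_chart U c)) x"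
    if "x \<in> snd c ` (U \<inter> fst c \<inter> fst d)" for x
    using that C(6) R(6) by auto
  ultimately show ?thesis using smooth_on_cong[OF op] by blast
qed

lemma smooth_manifold_open_submanifold:
  assumes M: "smooth_manifold M" and U: "openin (mtop M) U"
  shows "smooth_manifold (open_submanifold M U)"
  unfolding smooth_manifold_iff open_submanifold_simps
proof (intro conjI ballI)
  show "Hausdorff_space (subtopology (mtop M) U)"
    using M by (simp add: smooth_manifold_iff Hausdorff_space_subtopology)
  show "second_countable (subtopology (mtop M) U)"
    using M by (simp add: smooth_manifold_iff second_countable_subtopology)
  have "(\<Union>c \<in> atlas M. fst c) = carr M" using M by (simp add: smooth_manifold_iff)
  then show "(\<Union>c \<in> restrict_chart U ` atlas M. fst c) = topspace (subtopology (mtop M) U)"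
    by auto
  show "open_chart (subtopology (mtop M) U) c" if "c \<in> restrict_chart U ` atlas M" for c
    using that atlas_chart[OF M] open_chart_restrict U by blast
  fix c d assume "c \<in> restrict_chart U ` atlas M" "d \<in> restrict_chart U ` atlas M"
  then obtain c' d' where cd: "c' \<in> atlas M" "c = restrict_chart U c'"
    "d' \<in> atlas M" "d = restrict_chart U d'" by blast
  show "smooth_on (snd c ` (fst c \<inter> fst d)) (snd d \<circ> chart_inv c)"
    unfolding cd fst_conv snd_conv
    by (rule smooth_on_subset[OF restricted_transition_smooth[OF M U cd(1,3)]]) auto
qed

lemma smooth_map_inclusion:
  assumes M: "smooth_manifold M" and U: "openin (mtop M) U"
  shows "smooth_map (open_submanifold M U) M id"
  unfolding smooth_map_def
proof (intro conjI ballI)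
  show "continuous_map (mtop (open_submanifold M U)) (mtop M) id"
    unfolding open_submanifold_simps by (rule continuous_map_from_subtopology) simp
  fix c d assume "c \<in> atlas (open_submanifold M U)" and d: "d \<in> atlas M"
  then obtain c' where c: "c' \<in> atlas M" "c = restrict_chart U c'"
    unfolding open_submanifold_simps by blast
  show "smooth_on (snd c ` (fst c \<inter> id -` fst d)) (snd d \<circ> id \<circ> chart_inv c)"
    using restricted_transition_smooth[OF M U c(1) d] by (simp add: c(2))
qed

lemma smooth_map_into_open_submanifold:
  assumes f: "smooth_map M N f" and W: "f ` carr M \<subseteq> W" and M: "smooth_manifold M"
  shows "smooth_map M (open_submanifold N W) f"
  unfolding smooth_map_def
proof (intro conjI ballI)
  show "continuous_map (mtop M) (mtop (open_submanifold N W)) f"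
    unfolding open_submanifold_simps
    using smooth_mapD(1)[OF f] W by (intro continuous_map_into_subtopology) auto
  fix c d assume c: "c \<in> atlas M" and "d \<in> atlas (open_submanifold N W)"
  then obtain d' where d: "d' \<in> atlas N" "d = restrict_chart W d'"
    unfolding open_submanifold_simps by blast
  have "fst c \<inter> f -` fst d = fst c \<inter> f -` fst d'"
    using W open_chartD(5)[OF atlas_chart[OF M c]] d(2) by auto
  then show "smooth_on (snd c ` (fst c \<inter> f -` fst d)) (snd d \<circ> f \<circ> chart_inv c)"
    using smooth_mapD(2)[OF f c d(1)] by (simp add: d(2))
qed

lemma smooth_map_restrict:
  assumes M: "smooth_manifold M" and N: "smooth_manifold N" and f: "smooth_map M N f"
    and U: "openin (mtop M) U" and W: "f ` U \<subseteq> W"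
  shows "smooth_map (open_submanifold M U) (open_submanifold N W) f"
proof (rule smooth_map_into_open_submanifold)
  show "smooth_manifold (open_submanifold M U)" using M U by (rule smooth_manifold_open_submanifold)
  then have "smooth_map (open_submanifold M U) N (f \<circ> id)"
    by (rule smooth_map_compose[OF _ M N smooth_map_inclusion[OF M U] f])
  then show "smooth_map (open_submanifold M U) N f" by simp
  show "f ` carr (open_submanifold M U) \<subseteq> W" using W by (simp add: carr_open_submanifold[OF U])
qed

lemma open_submanifold_carr:
  assumes "smooth_manifold M"
  shows "open_submanifold M (carr M) = M"
proof -
  have "restrict_chart (carr M) c = c" if "c \<in> atlas M" for c
    using open_chartD(5)[OF atlas_chart[OF assms that]] by (simp add: Int_absorb1)
  then have "restrict_chart (carr M) ` atlas M = atlas M" by force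
  then show ?thesis
    by (simp add: open_submanifold_def case_prod_unfold subtopology_topspace)
qed

section \<open>Products\<close>

abbreviation prod_chart :: "('m, 'e) chart \<Rightarrow> ('n, 'f) chart \<Rightarrow> ('m \<times> 'n, 'e \<times> 'f) chart" where
  "prod_chart c d \<equiv> (fst c \<times> fst d, map_prod (snd c) (snd d))"

lemma prod_manifold_simps:
  "mtop (prod_manifold M N) = prod_topology (mtop M) (mtop N)"
  "atlas (prod_manifold M N) = (\<lambda>(c, d). prod_chart c d) ` (atlas M \<times> atlas N)"
  by (auto simp: prod_manifold_def case_prod_unfold)

lemma carr_prod_manifold: "carr (prod_manifold M N) = carr M \<times> carr N"
  by (simp add: prod_manifold_simps)

lemma prod_atlasE:
  assumes "c \<in> atlas (prod_manifold M N)"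
  obtains a b where "a \<in> atlas M" "b \<in> atlas N" "c = prod_chart a b"
  using assms by (auto simp: prod_manifold_simps)

lemma open_chart_prod:
  assumes "open_chart S c" "open_chart T d"
  shows "open_chart (prod_topology S T) (prod_chart c d)"
  unfolding open_chart_def fst_conv snd_conv
proof (intro conjI allI impI)
  note C = open_chartD[OF assms(1)] and D = open_chartD[OF assms(2)]
  show "openin (prod_topology S T) (fst c \<times> fst d)" using C(1) D(1) by (simp add: openin_prod_Times_iff)
  show "inj_on (map_prod (snd c) (snd d)) (fst c \<times> fst d)" using C(2) D(2) by (rule map_prod_inj_on)
  show "open (map_prod (snd c) (snd d) ` A)"
    if A: "openin (prod_topology S T) A \<and> A \<subseteq> fst c \<times> fst d" for A
    unfolding open_prod_def
  proof
    fix z assume "z \<in> map_prod (snd c) (snd d) ` A"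
    then obtain x y where xy: "(x, y) \<in> A" "z = (snd c x, snd d y)" by auto
    then obtain V W where VW: "openin S V" "openin T W" "x \<in> V" "y \<in> W" "V \<times> W \<subseteq> A"
      using A unfolding openin_prod_topology_alt by metis
    have "V \<subseteq> fst c" "W \<subseteq> fst d" using VW A by blast+
    then have "open (snd c ` V)" "open (snd d ` W)" using C(3) D(3) VW by auto
    moreover have "z \<in> snd c ` V \<times> snd d ` W" using VW xy by blast
    moreover have "snd c ` V \<times> snd d ` W \<subseteq> map_prod (snd c) (snd d) ` A" using VW(5) by force
    ultimately show "\<exists>A' B'. open A' \<and> open B' \<and> z \<in> A' \<times> B' \<and> A' \<times> B' \<subseteq> map_prod (snd c) (snd d) ` A"
      by blast
  qed
  show "openin (prod_topology S T) {p \<in> fst c \<times> fst d. map_prod (snd c) (snd d) p \<in> B}"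
    if B: "open B" for B
    unfolding openin_prod_topology_alt
  proof (intro allI impI)
    fix x y assume "(x, y) \<in> {p \<in> fst c \<times> fst d. map_prod (snd c) (snd d) p \<in> B}"
    then have xy: "x \<in> fst c" "y \<in> fst d" "(snd c x, snd d y) \<in> B" by auto
    then obtain V W where VW: "open V" "open W" "snd c x \<in> V" "snd d y \<in> W" "V \<times> W \<subseteq> B"
      using open_prod_elim[OF B xy(3)] by (metis mem_Sigma_iff)
    show "\<exists>V W. openin S V \<and> openin T W \<and> x \<in> V \<and> y \<in> W \<and>
        V \<times> W \<subseteq> {p \<in> fst c \<times> fst d. map_prod (snd c) (snd d) p \<in> B}"
      using C(4)[OF VW(1)] D(4)[OF VW(2)] xy VW(3-5)
      by (intro exI[of _ "{p \<in> fst c. snd c p \<in> V}"] exI[of _ "{p \<in> fst d. snd d p \<in> W}"]) auto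
  qed
qed

lemma chart_inv_prod:
  assumes "open_chart S c" "open_chart T d" "x \<in> snd c ` fst c" "y \<in> snd d ` fst d"
  shows "chart_inv (prod_chart c d) (x, y) = (chart_inv c x, chart_inv d y)"
proof -
  obtain p q where pq: "p \<in> fst c" "q \<in> fst d" "x = snd c p" "y = snd d q" using assms by blast
  have "chart_inv (prod_chart c d) (snd (prod_chart c d) (p, q)) = (p, q)"
    using open_chartD(6)[OF open_chart_prod[OF assms(1,2)], of "(p, q)"] pq by simp
  then show ?thesis using pq open_chartD(6)[OF assms(1)] open_chartD(6)[OF assms(2)] by simp
qed

lemma second_countable_prod_topology:
  assumes "second_countable S" "second_countable T"
  shows "second_countable (prod_topology S T)"
proof -
  obtain A where A: "countable A" "\<forall>V\<in>A. openin S V"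
    "\<forall>U x. openin S U \<and> x \<in> U \<longrightarrow> (\<exists>V\<in>A. x \<in> V \<and> V \<subseteq> U)"
    using assms(1) unfolding second_countable_def by (elim exE conjE) (rule that)
  obtain B where B: "countable B" "\<forall>V\<in>B. openin T V"
    "\<forall>U x. openin T U \<and> x \<in> U \<longrightarrow> (\<exists>V\<in>B. x \<in> V \<and> V \<subseteq> U)"
    using assms(2) unfolding second_countable_def by (elim exE conjE) (rule that)
  show ?thesis
    unfolding second_countable_def
  proof (intro exI conjI allI impI ballI)
    show "countable ((\<lambda>(V, W). V \<times> W) ` (A \<times> B))" using A(1) B(1) by simp
    show "openin (prod_topology S T) Z" if "Z \<in> (\<lambda>(V, W). V \<times> W) ` (A \<times> B)" for Z
      using that A(2) B(2) by (auto simp: openin_prod_Times_iff)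
    fix U z assume U: "openin (prod_topology S T) U \<and> z \<in> U"
    obtain x y where z: "z = (x, y)" by (cases z)
    then obtain V W where VW: "openin S V" "openin T W" "x \<in> V" "y \<in> W" "V \<times> W \<subseteq> U"
      using U unfolding openin_prod_topology_alt by meson
    obtain V' where V': "V' \<in> A" "x \<in> V'" "V' \<subseteq> V" using A(3) VW(1,3) by meson
    obtain W' where W': "W' \<in> B" "y \<in> W'" "W' \<subseteq> W" using B(3) VW(2,4) by meson
    have "V' \<times> W' \<in> (\<lambda>(V, W). V \<times> W) ` (A \<times> B)" using V'(1) W'(1) by force
    moreover have "z \<in> V' \<times> W'" "V' \<times> W' \<subseteq> U" using z V' W' VW(5) by auto
    ultimately show "\<exists>V\<in>(\<lambda>(V, W). V \<times> W) ` (A \<times> B). z \<in> V \<and> V \<subseteq> U" by blast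
  qed
qed

lemma smooth_on_Pair_components:
  fixes f :: "'a::findim_normed_vector \<Rightarrow> 'b::findim_normed_vector"
    and g :: "'c::findim_normed_vector \<Rightarrow> 'd::findim_normed_vector"
  assumes "open S" "open T" "smooth_on S f" "smooth_on T g"
  shows "smooth_on (S \<times> T) (\<lambda>z. (f (fst z), g (snd z)))"
  unfolding smooth_on_def
proof
  fix k
  have ST: "open (S \<times> T)" using assms(1,2) by (rule open_Times)
  have "Ck_on k (S \<times> T) (f \<circ> fst)"
    using assms by (intro Ck_on_compose[OF ST assms(1)] Ck_on_bounded_linear[OF ST bounded_linear_fst])
      (auto simp: smooth_on_def)
  moreover have "Ck_on k (S \<times> T) (g \<circ> snd)"
    using assms by (intro Ck_on_compose[OF ST assms(2)] Ck_on_bounded_linear[OF ST bounded_linear_snd])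
      (auto simp: smooth_on_def)
  ultimately show "Ck_on k (S \<times> T) (\<lambda>z. (f (fst z), g (snd z)))"
    using Ck_on_Pair[OF ST] by (simp add: o_def)
qed

lemma smooth_manifold_prod_manifold:
  assumes M: "smooth_manifold M" and N: "smooth_manifold N"
  shows "smooth_manifold (prod_manifold M N)"
  unfolding smooth_manifold_iff
proof (intro conjI ballI)
  show "Hausdorff_space (mtop (prod_manifold M N))"
    using M N by (simp add: smooth_manifold_iff prod_manifold_simps Hausdorff_space_prod_topology)
  show "second_countable (mtop (prod_manifold M N))"
    using M N by (simp add: smooth_manifold_iff prod_manifold_simps second_countable_prod_topology)
  show "open_chart (mtop (prod_manifold M N)) c" if "c \<in> atlas (prod_manifold M N)" for c
    using that
  proof (rule prod_atlasE)
    fix a b assume "a \<in> atlas M" "b \<in> atlas N" and c: "c = prod_chart a b"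
    then show "open_chart (mtop (prod_manifold M N)) c"
      unfolding c prod_manifold_simps using M N by (intro open_chart_prod atlas_chart)
  qed
  have "(\<Union>c \<in> atlas M. fst c) = carr M" "(\<Union>c \<in> atlas N. fst c) = carr N"
    using M N by (simp_all add: smooth_manifold_iff)
  then show "(\<Union>c \<in> atlas (prod_manifold M N). fst c) = carr (prod_manifold M N)"
    unfolding carr_prod_manifold by (simp only: prod_manifold_simps set_eq_iff) fastforce
  fix c d assume "c \<in> atlas (prod_manifold M N)" "d \<in> atlas (prod_manifold M N)"
  then obtain a b a' b' where ab: "a \<in> atlas M" "b \<in> atlas N" "c = prod_chart a b"
    "a' \<in> atlas M" "b' \<in> atlas N" "d = prod_chart a' b'"
    by (metis prod_atlasE)
  note a = atlas_chart[OF M ab(1)] and b = atlas_chart[OF N ab(2)]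
  have S: "open (snd a ` (fst a \<inter> fst a'))" "open (snd b ` (fst b \<inter> fst b'))"
    using open_overlap_image[OF M M smooth_map_id[OF M] ab(1,4)]
      open_overlap_image[OF N N smooth_map_id[OF N] ab(2,5)] by simp_all
  have im: "snd c ` (fst c \<inter> fst d) = snd a ` (fst a \<inter> fst a') \<times> snd b ` (fst b \<inter> fst b')"
    unfolding ab(3,6) by force
  have "smooth_on (snd a ` (fst a \<inter> fst a') \<times> snd b ` (fst b \<inter> fst b'))
      (\<lambda>z. ((snd a' \<circ> chart_inv a) (fst z), (snd b' \<circ> chart_inv b) (snd z)))"
    by (intro smooth_on_Pair_components S transition_smooth[OF M ab(1,4)] transition_smooth[OF N ab(2,5)])
  moreover have "(snd d \<circ> chart_inv c) z = ((snd a' \<circ> chart_inv a) (fst z), (snd b' \<circ> chart_inv b) (snd z))"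
    if "z \<in> snd a ` (fst a \<inter> fst a') \<times> snd b ` (fst b \<inter> fst b')" for z
  proof -
    have "fst z \<in> snd a ` fst a" "snd z \<in> snd b ` fst b" using that by auto
    then show ?thesis
      using chart_inv_prod[OF a b, of "fst z" "snd z"] by (simp add: ab(3,6))
  qed
  ultimately show "smooth_on (snd c ` (fst c \<inter> fst d)) (snd d \<circ> chart_inv c)"
    unfolding im by (subst smooth_on_cong[OF open_Times[OF S]]) auto
qed

lemma smooth_map_Pair:
  assumes M: "smooth_manifold M" and N: "smooth_manifold N" and L: "smooth_manifold L"
    and f: "smooth_map M N f" and g: "smooth_map M L g"
  shows "smooth_map M (prod_manifold N L) (\<lambda>p. (f p, g p))"
  unfolding smooth_map_def
proof (intro conjI ballI)
  show cont: "continuous_map (mtop M) (mtop (prod_manifold N L)) (\<lambda>p. (f p, g p))"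
    unfolding prod_manifold_simps continuous_map_paired
    using smooth_mapD(1)[OF f] smooth_mapD(1)[OF g] by simp
  fix c d assume c: "c \<in> atlas M" and "d \<in> atlas (prod_manifold N L)"
  then obtain a b where ab: "a \<in> atlas N" "b \<in> atlas L" "d = prod_chart a b"
    using prod_atlasE by metis
  note C = open_chartD[OF atlas_chart[OF M c]]
  have eq: "fst c \<inter> (\<lambda>p. (f p, g p)) -` fst d = (fst c \<inter> f -` fst a) \<inter> (fst c \<inter> g -` fst b)"
    unfolding ab(3) by auto
  have op: "open (snd c ` ((fst c \<inter> f -` fst a) \<inter> (fst c \<inter> g -` fst b)))"
    by (rule C(3)[OF openin_Int[OF openin_chart_overlap[OF M N smooth_mapD(1)[OF f] c ab(1)]
            openin_chart_overlap[OF M L smooth_mapD(1)[OF g] c ab(2)]]]) blast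
  have fun_eq: "snd d \<circ> (\<lambda>p. (f p, g p)) \<circ> chart_inv c =
      (\<lambda>x. ((snd a \<circ> f \<circ> chart_inv c) x, (snd b \<circ> g \<circ> chart_inv c) x))"
    unfolding ab(3) by (simp add: fun_eq_iff)
  show "smooth_on (snd c ` (fst c \<inter> (\<lambda>p. (f p, g p)) -` fst d)) (snd d \<circ> (\<lambda>p. (f p, g p)) \<circ> chart_inv c)"
    unfolding eq fun_eq smooth_on_def
  proof (intro allI Ck_on_Pair[OF op])
    fix k
    have "Ck_on k (snd c ` (fst c \<inter> f -` fst a)) (snd a \<circ> f \<circ> chart_inv c)"
      using smooth_mapD(2)[OF f c ab(1)] by (simp add: smooth_on_def)
    then show "Ck_on k (snd c ` ((fst c \<inter> f -` fst a) \<inter> (fst c \<inter> g -` fst b))) (snd a \<circ> f \<circ> chart_inv c)"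
      by (rule Ck_on_subset) auto
    have "Ck_on k (snd c ` (fst c \<inter> g -` fst b)) (snd b \<circ> g \<circ> chart_inv c)"
      using smooth_mapD(2)[OF g c ab(2)] by (simp add: smooth_on_def)
    then show "Ck_on k (snd c ` ((fst c \<inter> f -` fst a) \<inter> (fst c \<inter> g -` fst b))) (snd b \<circ> g \<circ> chart_inv c)"
      by (rule Ck_on_subset) auto
  qed
qed

lemma smooth_map_const:
  assumes M: "smooth_manifold M" and "q \<in> carr N"
  shows "smooth_map M N (\<lambda>_. q)"
  unfolding smooth_map_def
proof (intro conjI ballI)
  show "continuous_map (mtop M) (mtop N) (\<lambda>_. q)" using assms(2) by simp
  show "smooth_on (snd c ` (fst c \<inter> (\<lambda>_. q) -` fst d)) (snd d \<circ> (\<lambda>_. q) \<circ> chart_inv c)" for c d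
    by (simp add: smooth_on_def o_def Ck_on_const)
qed

section \<open>Derivatives in charts\<close>

definition coord_deriv ::
    "('m, 'e::real_normed_vector) chart \<Rightarrow> ('n, 'f::real_normed_vector) chart \<Rightarrow> ('m \<Rightarrow> 'n) \<Rightarrow> 'm \<Rightarrow> 'e \<Rightarrow> 'f" where
  "coord_deriv c d f p = frechet_derivative (snd d \<circ> f \<circ> chart_inv c) (at (snd c p))"

lemma has_derivative_coord_deriv:
  assumes M: "smooth_manifold M" and N: "smooth_manifold N" and f: "smooth_map M N f"
    and c: "c \<in> charts_at M p" and d: "d \<in> charts_at N (f p)"
  shows "((snd d \<circ> f \<circ> chart_inv c) has_derivative coord_deriv c d f p) (at (snd c p))"
proof -
  note cd = charts_atD[OF c] charts_atD[OF d]
  have "Ck_on (Suc 0) (snd c ` (fst c \<inter> f -` fst d)) (snd d \<circ> f \<circ> chart_inv c)"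
    using smooth_mapD(2)[OF f cd(1,3)] unfolding smooth_on_def by blast
  from Ck_on_SucD(1)[OF this, of "snd c p"] show ?thesis
    using cd(2,4) by (simp add: coord_deriv_def)
qed

lemma linear_coord_deriv:
  assumes "smooth_manifold M" "smooth_manifold N" "smooth_map M N f"
    "c \<in> charts_at M p" "d \<in> charts_at N (f p)"
  shows "linear (coord_deriv c d f p)"
  using has_derivative_coord_deriv[OF assms] by (rule has_derivative_linear)

text \<open>
  The chain rule; with \<open>f = id\<close> or \<open>g = id\<close> it is the transformation behaviour under changes of charts.
\<close>

lemma coord_deriv_compose:
  assumes M: "smooth_manifold M" and N: "smooth_manifold N" and Q: "smooth_manifold Q"
    and f: "smooth_map M N f" and g: "smooth_map N Q g"
    and c: "c \<in> charts_at M p" and d: "d \<in> charts_at N (f p)" and e: "e \<in> charts_at Q (g (f p))"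
  shows "coord_deriv c e (g \<circ> f) p = coord_deriv d e g (f p) \<circ> coord_deriv c d f p"
proof -
  note cs = charts_atD[OF c] charts_atD[OF d]
  note C = open_chartD[OF atlas_chart[OF M cs(1)]] and D = open_chartD[OF atlas_chart[OF N cs(3)]]
  define A where "A = snd d \<circ> f \<circ> chart_inv c"
  define B where "B = snd e \<circ> g \<circ> chart_inv d"
  have "A (snd c p) = snd d (f p)" using C(6)[OF cs(2)] by (simp add: A_def)
  then have "(B has_derivative coord_deriv d e g (f p)) (at (A (snd c p)))"
    using has_derivative_coord_deriv[OF N Q g d e] by (simp add: B_def)
  from diff_chain_at[OF has_derivative_coord_deriv[OF M N f c d, folded A_def] this]
  have "((snd e \<circ> (g \<circ> f) \<circ> chart_inv c) has_derivative
      coord_deriv d e g (f p) \<circ> coord_deriv c d f p) (at (snd c p))"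
  proof (rule has_derivative_transform_within_open)
    show "open (snd c ` (fst c \<inter> f -` fst d))" by (rule open_overlap_image[OF M N f cs(1,3)])
    show "snd c p \<in> snd c ` (fst c \<inter> f -` fst d)" using cs(2,4) by blast
    show "(B \<circ> A) x = (snd e \<circ> (g \<circ> f) \<circ> chart_inv c) x" if "x \<in> snd c ` (fst c \<inter> f -` fst d)" for x
      using that C(6) D(6) by (auto simp: A_def B_def)
  qed
  then show ?thesis unfolding coord_deriv_def by (rule frechet_derivative_unique)
qed

text \<open>
  The derivative depends only on the germs of the map and of the coordinates; this compares charts of
  \<open>M\<close> with their restrictions to open submanifolds, which are different charts formally.
\<close>

lemma coord_deriv_germ:
  assumes c: "open_chart T c" and c': "open_chart T' c'" "snd c' = snd c"
    and A: "openin T A" "p \<in> A" "A \<subseteq> fst c" "A \<subseteq> fst c'"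
    and eq: "\<And>q. q \<in> A \<Longrightarrow> snd d' (f' q) = snd d (f q)"
  shows "coord_deriv c' d' f' p = coord_deriv c d f p"
  unfolding coord_deriv_def c'(2)
proof (rule frechet_derivative_cong_open(1))
  show "open (snd c ` A)" using open_chartD(3)[OF c A(1,3)] .
  show "snd c p \<in> snd c ` A" using A(2) by blast
  fix x assume "x \<in> snd c ` A"
  then obtain q where q: "q \<in> A" "x = snd c q" by blast
  have "chart_inv c (snd c q) = q" "chart_inv c' (snd c q) = q"
    using open_chartD(6)[OF c, of q] open_chartD(6)[OF c'(1), of q] q A(3,4) c'(2) by auto
  then show "(snd d' \<circ> f' \<circ> chart_inv c') x = (snd d \<circ> f \<circ> chart_inv c) x"
    using q eq by simp
qed

lemma coord_deriv_id:
  assumes M: "smooth_manifold M" and c: "c \<in> charts_at M p"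
  shows "coord_deriv c c id p = id"
proof -
  note C = open_chartD[OF atlas_chart[OF M charts_atD(1)[OF c]]]
  have "(id has_derivative id) (at (snd c p))" by (simp add: id_def)
  then have "((snd c \<circ> id \<circ> chart_inv c) has_derivative id) (at (snd c p))"
  proof (rule has_derivative_transform_within_open)
    show "open (snd c ` fst c)" using C(1,3) by blast
    show "snd c p \<in> snd c ` fst c" using charts_atD(2)[OF c] by blast
  qed (use C(6) in auto)
  then show ?thesis unfolding coord_deriv_def by (rule frechet_derivative_unique)
qed

lemma coord_deriv_restrict_chart:
  assumes M: "smooth_manifold M" and U: "openin (mtop M) U" "p \<in> U" and c: "c \<in> charts_at M p"
    and d: "snd d' = snd d"
  shows "coord_deriv (restrict_chart U c) d' f p = coord_deriv c d f p"
proof (rule coord_deriv_germ[where A = "U \<inter> fst c"])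
  note C = atlas_chart[OF M charts_atD(1)[OF c]]
  show "open_chart (mtop M) c" by (rule C)
  show "open_chart (subtopology (mtop M) U) (restrict_chart U c)" using C U(1) by (rule open_chart_restrict)
  show "openin (mtop M) (U \<inter> fst c)" using U(1) open_chartD(1)[OF C] by blast
qed (use U(2) charts_atD(2)[OF c] d in auto)

lemma coord_deriv_Pair:
  assumes M: "smooth_manifold M" and N: "smooth_manifold N" and L: "smooth_manifold L"
    and f: "smooth_map M N f" and g: "smooth_map M L g"
    and c: "c \<in> charts_at M p" and a: "a \<in> charts_at N (f p)" and b: "b \<in> charts_at L (g p)"
  shows "coord_deriv c (prod_chart a b) (\<lambda>q. (f q, g q)) p v = (coord_deriv c a f p v, coord_deriv c b g p v)"
proof -
  have "(snd (prod_chart a b) \<circ> (\<lambda>q. (f q, g q)) \<circ> chart_inv c) =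
      (\<lambda>x. ((snd a \<circ> f \<circ> chart_inv c) x, (snd b \<circ> g \<circ> chart_inv c) x))"
    by (simp add: fun_eq_iff)
  with has_derivative_Pair[OF has_derivative_coord_deriv[OF M N f c a] has_derivative_coord_deriv[OF M L g c b]]
  have "((snd (prod_chart a b) \<circ> (\<lambda>q. (f q, g q)) \<circ> chart_inv c) has_derivative
      (\<lambda>v. (coord_deriv c a f p v, coord_deriv c b g p v))) (at (snd c p))" by simp
  from frechet_derivative_unique[OF this] show ?thesis by (simp add: coord_deriv_def)
qed

section \<open>The inverse function theorem on manifolds\<close>

definition bijective_derivative ::
    "('m, 'e::findim_normed_vector) manifold \<Rightarrow> ('n, 'f::findim_normed_vector) manifold \<Rightarrow> ('m \<Rightarrow> 'n) \<Rightarrow> bool" where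
  "bijective_derivative M N f \<longleftrightarrow>
     (\<forall>p c d. c \<in> charts_at M p \<longrightarrow> d \<in> charts_at N (f p) \<longrightarrow> bij (coord_deriv c d f p))"

context
  fixes M :: "('m, 'e::findim_normed_vector) manifold" and N :: "('n, 'f::findim_normed_vector) manifold"
    and f :: "'m \<Rightarrow> 'n"
  assumes M: "smooth_manifold M" and N: "smooth_manifold N" and f: "smooth_map M N f"
    and bij: "bijective_derivative M N f"
begin

lemma bij_frechet_derivative_in_charts:
  assumes "c \<in> atlas M" "d \<in> atlas N" "x \<in> snd c ` (fst c \<inter> f -` fst d)"
  shows "bij (frechet_derivative (snd d \<circ> f \<circ> chart_inv c) (at x))"
  using bij assms unfolding bijective_derivative_def coord_deriv_def charts_at_def by blast

lemma Ck_in_charts: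
  assumes "c \<in> atlas M" "d \<in> atlas N"
  shows "Ck_on k (snd c ` (fst c \<inter> f -` fst d)) (snd d \<circ> f \<circ> chart_inv c)"
  using smooth_mapD(2)[OF f assms] by (simp add: smooth_on_def)

lemma open_image_if_bijective_derivative:
  assumes A: "openin (mtop M) A"
  shows "openin (mtop N) (f ` A)"
  unfolding openin_subopen[of "mtop N" "f ` A"]
proof
  fix q assume "q \<in> f ` A"
  then obtain p where p: "p \<in> A" "q = f p" by blast
  then have pM: "p \<in> carr M" using openin_subset[OF A] by blast
  obtain c where c: "c \<in> charts_at M p" using charts_at_exists[OF M pM] by blast
  obtain d where d: "d \<in> charts_at N (f p)" using charts_at_exists[OF N smooth_mapD(3)[OF f pM]] by blast
  note cd = charts_atD[OF c] charts_atD[OF d]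
  note C = open_chartD[OF atlas_chart[OF M cd(1)]] and D = open_chartD[OF atlas_chart[OF N cd(3)]]
  let ?W = "(fst c \<inter> f -` fst d) \<inter> A"
  have W: "open (snd c ` ?W)"
    by (rule C(3)[OF openin_Int[OF openin_chart_overlap[OF M N smooth_mapD(1)[OF f] cd(1,3)] A]]) blast
  have "open ((snd d \<circ> f \<circ> chart_inv c) ` snd c ` ?W)"
    by (rule open_image_of_bijective_derivative[OF W Ck_on_subset[OF Ck_in_charts[OF cd(1,3)]]
        bij_frechet_derivative_in_charts[OF cd(1,3)]]) auto
  moreover have "(snd d \<circ> f \<circ> chart_inv c) ` snd c ` ?W = snd d ` f ` ?W"
    using C(6) by (force simp: image_iff)
  ultimately have op: "open (snd d ` f ` ?W)" by simp
  let ?B = "{r \<in> fst d. snd d r \<in> snd d ` f ` ?W}"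
  have "?B \<subseteq> f ` A" using D(2) by (auto simp: inj_on_def)
  moreover have "q \<in> ?B" using cd p by auto
  ultimately show "\<exists>T. openin (mtop N) T \<and> q \<in> T \<and> T \<subseteq> f ` A" using D(4)[OF op] by blast
qed

lemma locally_injective_if_bijective_derivative:
  assumes p: "p \<in> carr M"
  obtains A where "openin (mtop M) A" "p \<in> A" "inj_on f A"
proof -
  obtain c where c: "c \<in> charts_at M p" using charts_at_exists[OF M p] by blast
  obtain d where d: "d \<in> charts_at N (f p)" using charts_at_exists[OF N smooth_mapD(3)[OF f p]] by blast
  note cd = charts_atD[OF c] charts_atD[OF d]
  note C = open_chartD[OF atlas_chart[OF M cd(1)]]
  have x: "snd c p \<in> snd c ` (fst c \<inter> f -` fst d)" using cd by blast
  obtain r where r: "r > 0" "inj_on (snd d \<circ> f \<circ> chart_inv c) (cball (snd c p) r)"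
    by (rule local_inverse_at_point[OF open_overlap_image[OF M N f cd(1,3)] Ck_in_charts[OF cd(1,3)] x
          bij_frechet_derivative_in_charts[OF cd(1,3) x]]) blast
  let ?A = "{q \<in> fst c. snd c q \<in> ball (snd c p) r}"
  have "inj_on f ?A"
  proof (rule inj_onI)
    fix q q' assume q: "q \<in> ?A" "q' \<in> ?A" "f q = f q'"
    then have "(snd d \<circ> f \<circ> chart_inv c) (snd c q) = (snd d \<circ> f \<circ> chart_inv c) (snd c q')"
      using C(6) by simp
    then have "snd c q = snd c q'" using q by (intro inj_onD[OF r(2)]) auto
    then show "q = q'" using q C(2) by (simp add: inj_on_def)
  qed
  moreover have "openin (mtop M) ?A" by (rule C(4)) simp
  ultimately show ?thesis using that[of ?A] cd(2) r(1) by simp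
qed

text \<open>
  The inverse is continuous because \<open>f\<close> is open, and each of its chart representations is the inverse
  of a chart representation of \<open>f\<close>.
\<close>

lemma diffeomorphism_if_bijective_derivative:
  assumes b: "bij_betw f (carr M) (carr N)"
  shows "diffeomorphism M N f"
  unfolding diffeomorphism_def smooth_map_def[of N M]
proof (intro conjI b f ballI)
  let ?g = "inv_into (carr M) f"
  have gf: "?g (f p) = p" if "p \<in> carr M" for p using b that by (simp add: bij_betw_inv_into_left)
  have fg: "f (?g q) = q" if "q \<in> carr N" for q using b that by (simp add: bij_betw_inv_into_right)
  have gM: "?g q \<in> carr M" if "q \<in> carr N" for q
    using b that by (meson bij_betw_apply bij_betw_inv_into)
  show "continuous_map (mtop N) (mtop M) ?g"
    unfolding continuous_map
  proof (intro conjI allI impI)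
    show "?g ` carr N \<subseteq> carr M" using gM by blast
    fix A assume A: "openin (mtop M) A"
    have "{q \<in> carr N. ?g q \<in> A} = f ` A"
    proof (intro equalityI subsetI)
      fix q assume "q \<in> {q \<in> carr N. ?g q \<in> A}"
      then show "q \<in> f ` A" using fg[of q] by force
    next
      fix q assume "q \<in> f ` A"
      then obtain p where p: "p \<in> A" "q = f p" by blast
      then have "p \<in> carr M" using openin_subset[OF A] by blast
      then show "q \<in> {q \<in> carr N. ?g q \<in> A}" using p gf smooth_mapD(3)[OF f] by simp
    qed
    then show "openin (mtop N) {q \<in> carr N. ?g q \<in> A}"
      using open_image_if_bijective_derivative[OF A] by simp
  qed
  fix d c assume d: "d \<in> atlas N" and c: "c \<in> atlas M"
  note C = open_chartD[OF atlas_chart[OF M c]] and D = open_chartD[OF atlas_chart[OF N d]]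
  let ?S = "snd c ` (fst c \<inter> f -` fst d)"
  have im: "(snd d \<circ> f \<circ> chart_inv c) ` ?S = snd d ` (fst d \<inter> ?g -` fst c)"
  proof (intro equalityI subsetI)
    fix y assume "y \<in> (snd d \<circ> f \<circ> chart_inv c) ` ?S"
    then obtain p where p: "p \<in> fst c" "f p \<in> fst d" "y = snd d (f p)" using C(6) by auto
    then have "?g (f p) = p" using gf C(5) by blast
    then show "y \<in> snd d ` (fst d \<inter> ?g -` fst c)" using p by auto
  next
    fix y assume "y \<in> snd d ` (fst d \<inter> ?g -` fst c)"
    then obtain q where q: "q \<in> fst d" "?g q \<in> fst c" "y = snd d q" by blast
    then have "f (?g q) = q" using fg D(5) by blast
    then show "y \<in> (snd d \<circ> f \<circ> chart_inv c) ` ?S"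
      using q C(6)[OF q(2)] by (intro image_eqI[of _ _ "snd c (?g q)"]) auto
  qed
  show "smooth_on (snd d ` (fst d \<inter> ?g -` fst c)) (snd c \<circ> ?g \<circ> chart_inv d)"
    unfolding im[symmetric]
  proof (rule smooth_inverse)
    show "open ?S" by (rule open_overlap_image[OF M N f c d])
    show "smooth_on ?S (snd d \<circ> f \<circ> chart_inv c)" by (rule smooth_mapD(2)[OF f c d])
    show "bij (frechet_derivative (snd d \<circ> f \<circ> chart_inv c) (at x))" if "x \<in> ?S" for x
      using that by (rule bij_frechet_derivative_in_charts[OF c d])
    fix x assume "x \<in> ?S"
    then obtain p where p: "p \<in> fst c" "f p \<in> fst d" "x = snd c p" by blast
    then have "?g (f p) = p" using gf C(5) by blast
    then show "(snd c \<circ> ?g \<circ> chart_inv d) ((snd d \<circ> f \<circ> chart_inv c) x) = x"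
      using p C(6) D(6) by simp
  qed
qed

end

section \<open>Tangent vectors in charts\<close>

lemma tangent_space_iff:
  "\<xi> \<in> tangent_space M p \<longleftrightarrow>
     (\<forall>c \<in> charts_at M p. \<forall>d \<in> charts_at M p. \<xi> d = coord_deriv c d id p (\<xi> c)) \<and>
     (\<forall>c. c \<notin> charts_at M p \<longrightarrow> \<xi> c = 0)"
  by (simp add: tangent_space_def coord_deriv_def)

lemma tangent_space_transition:
  "\<xi> \<in> tangent_space M p \<Longrightarrow> c \<in> charts_at M p \<Longrightarrow> d \<in> charts_at M p \<Longrightarrow> \<xi> d = coord_deriv c d id p (\<xi> c)"
  unfolding tangent_space_iff by blast

lemma tangent_space_outside: "\<xi> \<in> tangent_space M p \<Longrightarrow> c \<notin> charts_at M p \<Longrightarrow> \<xi> c = 0"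
  unfolding tangent_space_iff by blast

text \<open>
  Together with the next lemma: each chart at \<open>p\<close> identifies the tangent space with the whole model
  space.
\<close>

lemma tangent_space_eqI:
  assumes "\<xi> \<in> tangent_space M p" "\<eta> \<in> tangent_space M p" "c \<in> charts_at M p" "\<xi> c = \<eta> c"
  shows "\<xi> = \<eta>"
proof
  fix d
  show "\<xi> d = \<eta> d"
    using tangent_space_transition[OF assms(1,3), of d] tangent_space_transition[OF assms(2,3), of d]
      tangent_space_outside[OF assms(1), of d] tangent_space_outside[OF assms(2), of d] assms(4)
    by (cases "d \<in> charts_at M p") simp_all
qed

lemma tangent_vector_exists:
  assumes M: "smooth_manifold M" and c: "c \<in> charts_at M p"
  obtains \<xi> where "\<xi> \<in> tangent_space M p" "\<xi> c = v"
proof -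
  define \<xi> where "\<xi> d = (if d \<in> charts_at M p then coord_deriv c d id p v else 0)" for d
  have "\<xi> e = coord_deriv d e id p (\<xi> d)" if d: "d \<in> charts_at M p" and e: "e \<in> charts_at M p" for d e
    using coord_deriv_compose[OF M M M smooth_map_id[OF M] smooth_map_id[OF M], of c p d e] c d e
    by (simp add: \<xi>_def)
  moreover have "\<xi> d = 0" if "d \<notin> charts_at M p" for d using that by (simp add: \<xi>_def)
  ultimately have "\<xi> \<in> tangent_space M p"
    unfolding tangent_space_iff by (intro conjI ballI allI impI)
  moreover have "\<xi> c = v" using c coord_deriv_id[OF M c] by (simp add: \<xi>_def)
  ultimately show ?thesis by (rule that)
qed

text \<open>
  The values \<open>s = 1\<close> and \<open>s = -1\<close> give sums and differences.
\<close>

lemma tangent_space_combination: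
  assumes M: "smooth_manifold M" and "\<xi> \<in> tangent_space M p" "\<eta> \<in> tangent_space M p"
  shows "(\<lambda>c. \<xi> c + s *\<^sub>R \<eta> c) \<in> tangent_space M p"
  unfolding tangent_space_iff
proof (intro conjI ballI allI impI)
  fix c d assume c: "c \<in> charts_at M p" and d: "d \<in> charts_at M p"
  interpret linear "coord_deriv c d id p"
    using c d by (intro linear_coord_deriv[OF M M smooth_map_id[OF M]]) auto
  show "\<xi> d + s *\<^sub>R \<eta> d = coord_deriv c d id p (\<xi> c + s *\<^sub>R \<eta> c)"
    using tangent_space_transition[OF assms(2) c d] tangent_space_transition[OF assms(3) c d]
    by (simp add: add scale)
qed (simp add: tangent_space_outside[OF assms(2)] tangent_space_outside[OF assms(3)])

lemma zero_in_tangent_space: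
  assumes "smooth_manifold M"
  shows "(\<lambda>_. 0) \<in> tangent_space M p"
  unfolding tangent_space_iff
proof (intro conjI ballI allI impI)
  fix c d assume "c \<in> charts_at M p" "d \<in> charts_at M p"
  then show "0 = coord_deriv c d id p 0"
    using linear_0[OF linear_coord_deriv[OF assms assms smooth_map_id[OF assms], of c p d]] by simp
qed simp

definition tangent_map_at ::
    "('m, 'e::findim_normed_vector) manifold \<Rightarrow> ('n, 'f::findim_normed_vector) manifold
       \<Rightarrow> ('m \<Rightarrow> 'n) \<Rightarrow> 'm \<Rightarrow> (('m, 'e) chart \<Rightarrow> 'e) \<Rightarrow> (('n, 'f) chart \<Rightarrow> 'f)" where
  "tangent_map_at M N f p \<xi> = snd (tangent_map M N f (p, \<xi>))"

lemma tangent_map_eq: "tangent_map M N f (p, \<xi>) = (f p, tangent_map_at M N f p \<xi>)"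
  by (simp add: tangent_map_at_def tangent_map_def)

lemma tangent_map_at_outside: "d \<notin> charts_at N (f p) \<Longrightarrow> tangent_map_at M N f p \<xi> d = 0"
  by (simp add: tangent_map_at_def tangent_map_def)

text \<open>
  The tangent map is defined by an arbitrary choice of chart at \<open>p\<close>; the chain rule shows that the
  choice does not matter.
\<close>

lemma tangent_map_at_chart:
  assumes M: "smooth_manifold M" and N: "smooth_manifold N" and f: "smooth_map M N f"
    and \<xi>: "\<xi> \<in> tangent_space M p" and c: "c \<in> charts_at M p" and d: "d \<in> charts_at N (f p)"
  shows "tangent_map_at M N f p \<xi> d = coord_deriv c d f p (\<xi> c)"
proof -
  define b where "b = (SOME c. c \<in> charts_at M p)"
  have b: "b \<in> charts_at M p" unfolding b_def using c by (rule someI)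
  have "tangent_map_at M N f p \<xi> d = coord_deriv b d f p (\<xi> b)"
    using d by (simp add: tangent_map_at_def tangent_map_def coord_deriv_def b_def Let_def)
  also have "\<xi> b = coord_deriv c b id p (\<xi> c)" by (rule tangent_space_transition[OF \<xi> c b])
  also have "coord_deriv b d f p (coord_deriv c b id p (\<xi> c)) = coord_deriv c d f p (\<xi> c)"
    using coord_deriv_compose[OF M M N smooth_map_id[OF M] f, of c p b d] b c d by simp
  finally show ?thesis .
qed

lemma tangent_map_at_eqI:
  assumes "\<And>d. d \<in> charts_at N (f p) \<Longrightarrow> tangent_map_at M N f p \<xi> d = \<eta> d"
    and "\<eta> \<in> tangent_space N (f p)"
  shows "tangent_map_at M N f p \<xi> = \<eta>"
proof
  show "tangent_map_at M N f p \<xi> d = \<eta> d" for d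
    using assms(1) tangent_map_at_outside[of d N f p M \<xi>] tangent_space_outside[OF assms(2), of d]
    by (cases "d \<in> charts_at N (f p)") simp_all
qed

lemma tangent_map_at_in_tangent_space:
  assumes M: "smooth_manifold M" and N: "smooth_manifold N" and f: "smooth_map M N f"
    and p: "p \<in> carr M" and \<xi>: "\<xi> \<in> tangent_space M p"
  shows "tangent_map_at M N f p \<xi> \<in> tangent_space N (f p)"
  unfolding tangent_space_iff
proof (intro conjI ballI allI impI)
  obtain c where c: "c \<in> charts_at M p" using charts_at_exists[OF M p] by blast
  fix d e assume d: "d \<in> charts_at N (f p)" and e: "e \<in> charts_at N (f p)"
  show "tangent_map_at M N f p \<xi> e = coord_deriv d e id (f p) (tangent_map_at M N f p \<xi> d)"
    using coord_deriv_compose[OF M N N f smooth_map_id[OF N] c d, of e] e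
    by (simp add: tangent_map_at_chart[OF M N f \<xi> c] d)
qed (rule tangent_map_at_outside)

lemma tangent_map_at_compose:
  assumes M: "smooth_manifold M" and N: "smooth_manifold N" and Q: "smooth_manifold Q"
    and f: "smooth_map M N f" and g: "smooth_map N Q g"
    and p: "p \<in> carr M" and \<xi>: "\<xi> \<in> tangent_space M p"
  shows "tangent_map_at M Q (g \<circ> f) p \<xi> = tangent_map_at N Q g (f p) (tangent_map_at M N f p \<xi>)"
proof (rule tangent_map_at_eqI)
  obtain c where c: "c \<in> charts_at M p" using charts_at_exists[OF M p] by blast
  obtain d where d: "d \<in> charts_at N (f p)" using charts_at_exists[OF N smooth_mapD(3)[OF f p]] by blast
  have \<eta>: "tangent_map_at M N f p \<xi> \<in> tangent_space N (f p)"
    by (rule tangent_map_at_in_tangent_space[OF M N f p \<xi>])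
  show "tangent_map_at N Q g (f p) (tangent_map_at M N f p \<xi>) \<in> tangent_space Q ((g \<circ> f) p)"
    using tangent_map_at_in_tangent_space[OF N Q g smooth_mapD(3)[OF f p] \<eta>] by simp
  fix e assume e: "e \<in> charts_at Q ((g \<circ> f) p)"
  then have e': "e \<in> charts_at Q (g (f p))" by simp
  show "tangent_map_at M Q (g \<circ> f) p \<xi> e = tangent_map_at N Q g (f p) (tangent_map_at M N f p \<xi>) e"
    unfolding tangent_map_at_chart[OF M Q smooth_map_compose[OF M N Q f g] \<xi> c e]
      tangent_map_at_chart[OF N Q g \<eta> d e'] tangent_map_at_chart[OF M N f \<xi> c d]
      coord_deriv_compose[OF M N Q f g c d e'] by (rule o_apply)
qed

lemma tangent_map_at_cong:
  assumes M: "smooth_manifold M" and N: "smooth_manifold N"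
    and f: "smooth_map M N f" and g: "smooth_map M N g"
    and eq: "\<And>q. q \<in> carr M \<Longrightarrow> f q = g q" and p: "p \<in> carr M" and \<xi>: "\<xi> \<in> tangent_space M p"
  shows "tangent_map_at M N f p \<xi> = tangent_map_at M N g p \<xi>"
proof (rule tangent_map_at_eqI)
  obtain c where c: "c \<in> charts_at M p" using charts_at_exists[OF M p] by blast
  note C = atlas_chart[OF M charts_atD(1)[OF c]]
  have fg: "f p = g p" using eq p .
  show "tangent_map_at M N g p \<xi> \<in> tangent_space N (f p)"
    using tangent_map_at_in_tangent_space[OF M N g p \<xi>] fg by simp
  fix d assume d: "d \<in> charts_at N (f p)"
  have "coord_deriv c d f p = coord_deriv c d g p"
    using eq open_chartD(5)[OF C] by (intro coord_deriv_germ[OF C C refl open_chartD(1)[OF C] charts_atD(2)[OF c]]) auto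
  then show "tangent_map_at M N f p \<xi> d = tangent_map_at M N g p \<xi> d"
    using tangent_map_at_chart[OF M N f \<xi> c d] tangent_map_at_chart[OF M N g \<xi> c] d fg by simp
qed

lemma tangent_map_at_id:
  assumes M: "smooth_manifold M" and p: "p \<in> carr M" and \<xi>: "\<xi> \<in> tangent_space M p"
  shows "tangent_map_at M M id p \<xi> = \<xi>"
proof (rule tangent_map_at_eqI)
  fix d assume d: "d \<in> charts_at M (id p)"
  then show "tangent_map_at M M id p \<xi> d = \<xi> d"
    using tangent_map_at_chart[OF M M smooth_map_id[OF M] \<xi>, of d d] coord_deriv_id[OF M, of d p] by simp
qed (use \<xi> in simp)

lemma tangent_map_at_const:
  assumes M: "smooth_manifold M" and N: "smooth_manifold N" and q: "q \<in> carr N"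
    and p: "p \<in> carr M" and \<xi>: "\<xi> \<in> tangent_space M p"
  shows "tangent_map_at M N (\<lambda>_. q) p \<xi> = (\<lambda>_. 0)"
proof (rule tangent_map_at_eqI)
  obtain c where c: "c \<in> charts_at M p" using charts_at_exists[OF M p] by blast
  fix d assume d: "d \<in> charts_at N q"
  have "coord_deriv c d (\<lambda>_. q) p = (\<lambda>_. 0)" by (simp add: coord_deriv_def o_def)
  then show "tangent_map_at M N (\<lambda>_. q) p \<xi> d = 0"
    using tangent_map_at_chart[OF M N smooth_map_const[OF M q] \<xi> c d] by simp
qed (rule zero_in_tangent_space[OF N])

lemma tangent_map_at_combination:
  assumes M: "smooth_manifold M" and N: "smooth_manifold N" and f: "smooth_map M N f"
    and p: "p \<in> carr M" and \<xi>: "\<xi> \<in> tangent_space M p" and \<eta>: "\<eta> \<in> tangent_space M p"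
  shows "tangent_map_at M N f p (\<lambda>c. \<xi> c + s *\<^sub>R \<eta> c) =
    (\<lambda>d. tangent_map_at M N f p \<xi> d + s *\<^sub>R tangent_map_at M N f p \<eta> d)"
proof (rule tangent_map_at_eqI)
  obtain c where c: "c \<in> charts_at M p" using charts_at_exists[OF M p] by blast
  show "(\<lambda>d. tangent_map_at M N f p \<xi> d + s *\<^sub>R tangent_map_at M N f p \<eta> d) \<in> tangent_space N (f p)"
    by (intro tangent_space_combination[OF N] tangent_map_at_in_tangent_space[OF M N f p] \<xi> \<eta>)
  fix d assume d: "d \<in> charts_at N (f p)"
  interpret linear "coord_deriv c d f p" by (rule linear_coord_deriv[OF M N f c d])
  show "tangent_map_at M N f p (\<lambda>c. \<xi> c + s *\<^sub>R \<eta> c) d =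
      tangent_map_at M N f p \<xi> d + s *\<^sub>R tangent_map_at M N f p \<eta> d"
    using tangent_map_at_chart[OF M N f \<xi> c d] tangent_map_at_chart[OF M N f \<eta> c d]
      tangent_map_at_chart[OF M N f tangent_space_combination[OF M \<xi> \<eta>] c d] by (simp add: add scale)
qed

lemma tangent_map_at_inclusion_chart:
  assumes M: "smooth_manifold M" and U: "openin (mtop M) U" and p: "p \<in> U"
    and \<xi>: "\<xi> \<in> tangent_space (open_submanifold M U) p" and c: "c \<in> charts_at M p"
  shows "tangent_map_at (open_submanifold M U) M id p \<xi> c = \<xi> (restrict_chart U c)"
proof -
  have c': "restrict_chart U c \<in> charts_at (open_submanifold M U) p"
    using c p by (simp add: charts_at_open_submanifold)
  have "tangent_map_at (open_submanifold M U) M id p \<xi> c =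
      coord_deriv (restrict_chart U c) c id p (\<xi> (restrict_chart U c))"
    using c by (intro tangent_map_at_chart[OF smooth_manifold_open_submanifold[OF M U] M
          smooth_map_inclusion[OF M U] \<xi> c']) simp
  also have "\<dots> = id (\<xi> (restrict_chart U c))"
    by (rule fun_cong[OF trans[OF coord_deriv_restrict_chart[OF M U p c refl] coord_deriv_id[OF M c]]])
  finally show ?thesis unfolding id_apply .
qed

text \<open>
  With respect to a chart of \<open>M\<close> and its restriction to \<open>U\<close>, the inclusion is represented by the
  identity.
\<close>

lemma bij_betw_tangent_map_inclusion:
  assumes M: "smooth_manifold M" and U: "openin (mtop M) U" and p: "p \<in> U"
  shows "bij_betw (tangent_map_at (open_submanifold M U) M id p)
    (tangent_space (open_submanifold M U) p) (tangent_space M p)"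
proof -
  let ?\<iota> = "tangent_map_at (open_submanifold M U) M id p" and ?MU = "open_submanifold M U"
  note MU = smooth_manifold_open_submanifold[OF M U]
  have pU: "p \<in> carr ?MU" using p by (simp add: carr_open_submanifold[OF U])
  have pM: "p \<in> carr M" using p openin_subset[OF U] by blast
  obtain c where c: "c \<in> charts_at M p" using charts_at_exists[OF M pM] by blast
  have c': "restrict_chart U c \<in> charts_at ?MU p"
    using c p by (simp add: charts_at_open_submanifold)
  have into: "?\<iota> \<xi> \<in> tangent_space M p" if "\<xi> \<in> tangent_space ?MU p" for \<xi>
    using tangent_map_at_in_tangent_space[OF MU M smooth_map_inclusion[OF M U] pU that] by simp
  show ?thesis
    unfolding bij_betw_def
  proof (intro conjI inj_onI equalityI subsetI)
    fix \<xi> \<eta> assume \<xi>: "\<xi> \<in> tangent_space ?MU p" and \<eta>: "\<eta> \<in> tangent_space ?MU p" and "?\<iota> \<xi> = ?\<iota> \<eta>"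
    then have "\<xi> (restrict_chart U c) = \<eta> (restrict_chart U c)"
      using tangent_map_at_inclusion_chart[OF M U p _ c] by metis
    then show "\<xi> = \<eta>" by (rule tangent_space_eqI[OF \<xi> \<eta> c'])
  next
    fix \<eta> assume "\<eta> \<in> ?\<iota> ` tangent_space ?MU p"
    then show "\<eta> \<in> tangent_space M p" using into by blast
  next
    fix \<eta> assume \<eta>: "\<eta> \<in> tangent_space M p"
    obtain \<xi> where \<xi>: "\<xi> \<in> tangent_space ?MU p" "\<xi> (restrict_chart U c) = \<eta> c"
      using tangent_vector_exists[OF MU c'] by blast
    have "?\<iota> \<xi> = \<eta>"
      using tangent_map_at_inclusion_chart[OF M U p \<xi>(1) c] \<xi>(2)
      by (intro tangent_space_eqI[OF into[OF \<xi>(1)] \<eta> c]) simp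
    then show "\<eta> \<in> ?\<iota> ` tangent_space ?MU p" using \<xi>(1) by blast
  qed
qed

section \<open>Transverse fibrations\<close>

definition tangent_splitting ::
    "('m, 'e::findim_normed_vector) manifold \<Rightarrow> ('n, 'f::findim_normed_vector) manifold
       \<Rightarrow> ('l, 'g::findim_normed_vector) manifold \<Rightarrow> ('m \<Rightarrow> 'n) \<Rightarrow> ('m \<Rightarrow> 'l) \<Rightarrow> bool" where
  "tangent_splitting M N L P F \<longleftrightarrow>
     (\<forall>p \<in> carr M. bij_betw (\<lambda>\<xi>. (tangent_map_at M N P p \<xi>, tangent_map_at M L F p \<xi>))
        (tangent_space M p) (tangent_space N (P p) \<times> tangent_space L (F p)))"

lemma tangent_splittingD:
  assumes "tangent_splitting M N L P F" "p \<in> carr M"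
  shows tangent_splitting_inj: "\<And>\<xi> \<eta>. \<xi> \<in> tangent_space M p \<Longrightarrow> \<eta> \<in> tangent_space M p \<Longrightarrow>
      tangent_map_at M N P p \<xi> = tangent_map_at M N P p \<eta> \<Longrightarrow>
      tangent_map_at M L F p \<xi> = tangent_map_at M L F p \<eta> \<Longrightarrow> \<xi> = \<eta>"
    and tangent_splitting_surj: "\<And>\<alpha> \<beta>. \<alpha> \<in> tangent_space N (P p) \<Longrightarrow> \<beta> \<in> tangent_space L (F p) \<Longrightarrow>
      \<exists>\<xi> \<in> tangent_space M p. tangent_map_at M N P p \<xi> = \<alpha> \<and> tangent_map_at M L F p \<xi> = \<beta>"
proof -
  have b: "bij_betw (\<lambda>\<xi>. (tangent_map_at M N P p \<xi>, tangent_map_at M L F p \<xi>))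
        (tangent_space M p) (tangent_space N (P p) \<times> tangent_space L (F p))"
    using assms unfolding tangent_splitting_def by blast
  show "\<xi> = \<eta>" if "\<xi> \<in> tangent_space M p" "\<eta> \<in> tangent_space M p"
    "tangent_map_at M N P p \<xi> = tangent_map_at M N P p \<eta>"
    "tangent_map_at M L F p \<xi> = tangent_map_at M L F p \<eta>" for \<xi> \<eta>
    using inj_onD[OF bij_betw_imp_inj_on[OF b], of \<xi> \<eta>] that by simp
  show "\<exists>\<xi> \<in> tangent_space M p. tangent_map_at M N P p \<xi> = \<alpha> \<and> tangent_map_at M L F p \<xi> = \<beta>"
    if "\<alpha> \<in> tangent_space N (P p)" "\<beta> \<in> tangent_space L (F p)" for \<alpha> \<beta>
  proof -
    have "(\<alpha>, \<beta>) \<in> (\<lambda>\<xi>. (tangent_map_at M N P p \<xi>, tangent_map_at M L F p \<xi>)) ` tangent_space M p"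
      using bij_betw_imp_surj_on[OF b] that by simp
    then show ?thesis by (elim imageE) auto
  qed
qed

lemma tangent_map_image: "tangent_map M N f ` ({p} \<times> S) = {f p} \<times> tangent_map_at M N f p ` S"
proof -
  have "{q} \<times> A = Pair q ` A" for q :: 'q and A :: "'r set" by blast
  note sing = this
  show ?thesis unfolding sing image_image tangent_map_eq by (rule refl)
qed

lemma fibrationD:
  assumes "fibration M N f"
  shows "smooth_manifold M" "smooth_manifold N" "smooth_map M N f" "f ` carr M = carr N"
    "\<And>p. p \<in> carr M \<Longrightarrow> tangent_map_at M N f p ` tangent_space M p = tangent_space N (f p)"
proof -
  show "smooth_manifold M" "smooth_manifold N" "smooth_map M N f" "f ` carr M = carr N"
    using assms by (simp_all add: fibration_def)
  fix p assume "p \<in> carr M"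
  then have "{f p} \<times> tangent_map_at M N f p ` tangent_space M p = {f p} \<times> tangent_space N (f p)"
    using assms by (simp add: fibration_def tangent_map_image)
  then show "tangent_map_at M N f p ` tangent_space M p = tangent_space N (f p)" by (auto simp: times_eq_iff)
qed

lemma fibrationI:
  assumes "smooth_manifold M" "smooth_manifold N" "smooth_map M N f" "f ` carr M = carr N"
    "\<And>p. p \<in> carr M \<Longrightarrow> tangent_map_at M N f p ` tangent_space M p = tangent_space N (f p)"
  shows "fibration M N f"
  unfolding fibration_def
proof (intro conjI ballI assms)
  fix p assume "p \<in> carr M"
  then show "tangent_map M N f ` ({p} \<times> tangent_space M p) = {f p} \<times> tangent_space N (f p)"
    by (simp only: tangent_map_image assms(5))
qed

lemma tangent_kernel_at:
  assumes "p \<in> carr M"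
  shows "tangent_kernel M N f `` {p} = {\<xi> \<in> tangent_space M p. tangent_map_at M N f p \<xi> = (\<lambda>_. 0)}"
  using assms by (auto simp: tangent_kernel_def tangent_bundle_def tangent_map_at_def)

text \<open>
  A vector killed by both tangent maps lies in both kernels, so it vanishes; this is injectivity.  For
  surjectivity, lift the two components separately: the \<open>F\<close>-vertical part of the lift of the first has
  the same image under \<open>P\<^sub>*\<close> and none under \<open>F\<^sub>*\<close>, symmetrically for the second, and the two parts can
  be added.
\<close>

lemma tangent_splitting_if_transverse:
  assumes P: "fibration M N P" and F: "fibration M L F" and tr: "transverse M N L P F"
  shows "tangent_splitting M N L P F"
  unfolding tangent_splitting_def
proof
  fix p assume p: "p \<in> carr M"
  note M = fibrationD(1)[OF P] and N = fibrationD(2)[OF P] and L = fibrationD(2)[OF F]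
    and sP = fibrationD(3)[OF P] and sF = fibrationD(3)[OF F]
  let ?T = "tangent_space M p" and ?tP = "tangent_map_at M N P p" and ?tF = "tangent_map_at M L F p"
  have sum: "?T = {(\<lambda>c. v c + w c) | v w. v \<in> tangent_kernel M N P `` {p} \<and> w \<in> tangent_kernel M L F `` {p}}"
    and int: "tangent_kernel M N P `` {p} \<inter> tangent_kernel M L F `` {p} = {\<lambda>_. 0}"
    using tr p unfolding transverse_def tangent_direct_sum_def by blast+
  have split: "\<exists>v\<in>?T. \<exists>w\<in>?T. \<xi> = (\<lambda>c. v c + 1 *\<^sub>R w c) \<and> ?tP v = (\<lambda>_. 0) \<and> ?tF w = (\<lambda>_. 0)"
    if "\<xi> \<in> ?T" for \<xi>
  proof -
    from that obtain v w where "\<xi> = (\<lambda>c. v c + w c)" "v \<in> tangent_kernel M N P `` {p}" "w \<in> tangent_kernel M L F `` {p}"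
      unfolding sum by blast
    then show ?thesis
      unfolding tangent_kernel_at[OF p] by (intro bexI[of _ v] bexI[of _ w]) auto
  qed
  note combP = tangent_map_at_combination[OF M N sP p] and combF = tangent_map_at_combination[OF M L sF p]
  show "bij_betw (\<lambda>\<xi>. (?tP \<xi>, ?tF \<xi>)) ?T (tangent_space N (P p) \<times> tangent_space L (F p))"
    unfolding bij_betw_def
  proof (intro conjI inj_onI equalityI subsetI)
    fix \<xi> \<eta> assume \<xi>: "\<xi> \<in> ?T" and \<eta>: "\<eta> \<in> ?T" and eq: "(?tP \<xi>, ?tF \<xi>) = (?tP \<eta>, ?tF \<eta>)"
    let ?\<delta> = "\<lambda>c. \<xi> c + (- 1) *\<^sub>R \<eta> c"
    have "?\<delta> \<in> ?T" by (rule tangent_space_combination[OF M \<xi> \<eta>])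
    moreover have "?tP ?\<delta> = (\<lambda>_. 0)" "?tF ?\<delta> = (\<lambda>_. 0)"
      unfolding combP[OF \<xi> \<eta>] combF[OF \<xi> \<eta>] using eq by simp_all
    ultimately have "?\<delta> \<in> tangent_kernel M N P `` {p} \<inter> tangent_kernel M L F `` {p}"
      unfolding tangent_kernel_at[OF p] by blast
    then have "?\<delta> = (\<lambda>_. 0)" unfolding int by blast
    then have "\<xi> c + (- 1) *\<^sub>R \<eta> c = 0" for c by (rule fun_cong)
    then show "\<xi> = \<eta>" by (simp add: fun_eq_iff)
  next
    fix z assume "z \<in> (\<lambda>\<xi>. (?tP \<xi>, ?tF \<xi>)) ` ?T"
    then show "z \<in> tangent_space N (P p) \<times> tangent_space L (F p)"
      using tangent_map_at_in_tangent_space[OF M N sP p] tangent_map_at_in_tangent_space[OF M L sF p] by blast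
  next
    fix z assume z: "z \<in> tangent_space N (P p) \<times> tangent_space L (F p)"
    obtain \<alpha> \<beta> where ab: "z = (\<alpha>, \<beta>)" by (cases z)
    have "\<alpha> \<in> ?tP ` ?T" "\<beta> \<in> ?tF ` ?T"
      using z fibrationD(5)[OF P p] fibrationD(5)[OF F p] by (simp_all add: ab)
    then obtain \<xi> \<eta> where \<xi>: "\<xi> \<in> ?T" "?tP \<xi> = \<alpha>" and \<eta>: "\<eta> \<in> ?T" "?tF \<eta> = \<beta>" by blast
    obtain v w where vw: "v \<in> ?T" "w \<in> ?T" "\<xi> = (\<lambda>c. v c + 1 *\<^sub>R w c)" "?tP v = (\<lambda>_. 0)" "?tF w = (\<lambda>_. 0)"
      using split[OF \<xi>(1)] by blast
    obtain v' w' where vw': "v' \<in> ?T" "w' \<in> ?T" "\<eta> = (\<lambda>c. v' c + 1 *\<^sub>R w' c)" "?tP v' = (\<lambda>_. 0)" "?tF w' = (\<lambda>_. 0)"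
      using split[OF \<eta>(1)] by blast
    have "?tP w = \<alpha>" using \<xi>(2) combP[OF vw(1,2), of 1] unfolding vw(3) by (simp add: vw(4))
    moreover have "?tF v' = \<beta>" using \<eta>(2) combF[OF vw'(1,2), of 1] unfolding vw'(3) by (simp add: vw'(5))
    ultimately have "?tP (\<lambda>c. w c + 1 *\<^sub>R v' c) = \<alpha>" "?tF (\<lambda>c. w c + 1 *\<^sub>R v' c) = \<beta>"
      unfolding combP[OF vw(2) vw'(1)] combF[OF vw(2) vw'(1)] by (simp_all add: vw(5) vw'(4))
    then show "z \<in> (\<lambda>\<xi>. (?tP \<xi>, ?tF \<xi>)) ` ?T"
      using tangent_space_combination[OF M vw(2) vw'(1), of 1] unfolding ab
      by (intro image_eqI[of _ _ "\<lambda>c. w c + 1 *\<^sub>R v' c"]) simp_all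
  qed
qed

text \<open>
  Both sides are the tangent map of \<open>f\<close> regarded as a map from \<open>U\<close> to \<open>N\<close>.
\<close>

lemma tangent_map_restrict_inclusion:
  assumes M: "smooth_manifold M" and N: "smooth_manifold N" and f: "smooth_map M N f"
    and U: "openin (mtop M) U" and W: "openin (mtop N) W" and fU: "f ` U \<subseteq> W"
    and p: "p \<in> U" and \<xi>: "\<xi> \<in> tangent_space (open_submanifold M U) p"
  shows "tangent_map_at (open_submanifold N W) N id (f p)
      (tangent_map_at (open_submanifold M U) (open_submanifold N W) f p \<xi>) =
    tangent_map_at M N f p (tangent_map_at (open_submanifold M U) M id p \<xi>)"
proof -
  note MU = smooth_manifold_open_submanifold[OF M U] and NW = smooth_manifold_open_submanifold[OF N W]
  have pU: "p \<in> carr (open_submanifold M U)" using p by (simp add: carr_open_submanifold[OF U])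
  have "tangent_map_at (open_submanifold M U) N (id \<circ> f) p \<xi> = tangent_map_at (open_submanifold M U) N (f \<circ> id) p \<xi>"
    by simp
  then show ?thesis
    unfolding tangent_map_at_compose[OF MU NW N smooth_map_restrict[OF M N f U fU] smooth_map_inclusion[OF N W] pU \<xi>]
      tangent_map_at_compose[OF MU M N smooth_map_inclusion[OF M U] f pU \<xi>] by simp
qed

text \<open>
  The tangent maps of the three inclusions are bijections that conjugate the restricted map to the
  original one.
\<close>

lemma tangent_splitting_open_submanifold:
  assumes M: "smooth_manifold M" and N: "smooth_manifold N" and L: "smooth_manifold L"
    and P: "smooth_map M N P" and F: "smooth_map M L F"
    and U: "openin (mtop M) U" and V: "openin (mtop N) V" and W: "openin (mtop L) W"
    and PU: "P ` U \<subseteq> V" and FU: "F ` U \<subseteq> W"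
    and split: "tangent_splitting M N L P F"
  shows "tangent_splitting (open_submanifold M U) (open_submanifold N V) (open_submanifold L W) P F"
  unfolding tangent_splitting_def carr_open_submanifold[OF U]
proof
  fix p assume p: "p \<in> U"
  let ?MU = "open_submanifold M U" and ?NV = "open_submanifold N V" and ?LW = "open_submanifold L W"
  note MU = smooth_manifold_open_submanifold[OF M U] and NV = smooth_manifold_open_submanifold[OF N V]
    and LW = smooth_manifold_open_submanifold[OF L W]
  have pM: "p \<in> carr M" using p openin_subset[OF U] by blast
  have pU: "p \<in> carr ?MU" using p by (simp add: carr_open_submanifold[OF U])
  have PV: "P p \<in> V" and FW: "F p \<in> W" using p PU FU by blast+
  define G where "G \<xi> = (tangent_map_at ?MU ?NV P p \<xi>, tangent_map_at ?MU ?LW F p \<xi>)" for \<xi>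
  define H where "H \<xi> = (tangent_map_at M N P p \<xi>, tangent_map_at M L F p \<xi>)" for \<xi>
  define \<iota> where "\<iota> = tangent_map_at ?MU M id p"
  define \<kappa> where "\<kappa> = map_prod (tangent_map_at ?NV N id (P p)) (tangent_map_at ?LW L id (F p))"
  have "bij_betw H (tangent_space M p) (tangent_space N (P p) \<times> tangent_space L (F p))"
    using split pM unfolding tangent_splitting_def H_def by blast
  then have H\<iota>: "bij_betw (H \<circ> \<iota>) (tangent_space ?MU p) (tangent_space N (P p) \<times> tangent_space L (F p))"
    using bij_betw_tangent_map_inclusion[OF M U p] unfolding \<iota>_def by (intro bij_betw_trans)
  have \<kappa>: "bij_betw \<kappa> (tangent_space ?NV (P p) \<times> tangent_space ?LW (F p))
      (tangent_space N (P p) \<times> tangent_space L (F p))"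
    unfolding \<kappa>_def by (intro bij_betw_map_prod bij_betw_tangent_map_inclusion N V PV L W FW)
  \<comment> \<open>Hence \<open>G\<close> is bijective because \<open>H\<close>, \<open>\<iota>\<close> and \<open>\<kappa>\<close> are.\<close>
  have eq: "(\<kappa> \<circ> G) \<xi> = (H \<circ> \<iota>) \<xi>" if "\<xi> \<in> tangent_space ?MU p" for \<xi>
    using tangent_map_restrict_inclusion[OF M N P U V PU p that]
      tangent_map_restrict_inclusion[OF M L F U W FU p that] by (simp add: \<kappa>_def G_def H_def \<iota>_def)
  have "G ` tangent_space ?MU p \<subseteq> tangent_space ?NV (P p) \<times> tangent_space ?LW (F p)"
    using tangent_map_at_in_tangent_space[OF MU NV smooth_map_restrict[OF M N P U PU] pU]
      tangent_map_at_in_tangent_space[OF MU LW smooth_map_restrict[OF M L F U FU] pU]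
    by (auto simp: G_def)
  then have "bij_betw G (tangent_space ?MU p) (tangent_space ?NV (P p) \<times> tangent_space ?LW (F p))"
    using H\<iota> bij_betw_cong[of "tangent_space ?MU p" "\<kappa> \<circ> G" "H \<circ> \<iota>", OF eq] bij_betw_comp_iff2[OF \<kappa>] by blast
  then show "bij_betw (\<lambda>\<xi>. (tangent_map_at ?MU ?NV P p \<xi>, tangent_map_at ?MU ?LW F p \<xi>))
      (tangent_space ?MU p) (tangent_space ?NV (P p) \<times> tangent_space ?LW (F p))"
    by (simp add: G_def[abs_def])
qed

text \<open>
  Through the identification of tangent spaces with the model spaces, the derivative of \<open>(P, F)\<close> in
  charts is the splitting.
\<close>

lemma bijective_derivative_Pair:
  assumes M: "smooth_manifold M" and N: "smooth_manifold N" and L: "smooth_manifold L"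
    and P: "smooth_map M N P" and F: "smooth_map M L F"
    and split: "tangent_splitting M N L P F"
  shows "bijective_derivative M (prod_manifold N L) (\<lambda>x. (P x, F x))"
  unfolding bijective_derivative_def
proof (intro allI impI)
  fix p c d assume c: "c \<in> charts_at M p" and "d \<in> charts_at (prod_manifold N L) (P p, F p)"
  then obtain a b where d: "d = prod_chart a b" and a: "a \<in> charts_at N (P p)" and b: "b \<in> charts_at L (F p)"
    by (auto simp: charts_at_def prod_manifold_simps)
  have p: "p \<in> carr M" by (rule charts_at_in_carr[OF M c])
  note D = coord_deriv_Pair[OF M N L P F c a b, folded d]
  note tP = tangent_map_at_chart[OF M N P _ c a] and tF = tangent_map_at_chart[OF M L F _ c b]
  note intoP = tangent_map_at_in_tangent_space[OF M N P p] and intoF = tangent_map_at_in_tangent_space[OF M L F p]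
  show "bij (coord_deriv c d (\<lambda>x. (P x, F x)) p)"
    unfolding bij_def
  proof
    show "inj (coord_deriv c d (\<lambda>x. (P x, F x)) p)"
    proof (rule injI)
      fix v w assume "coord_deriv c d (\<lambda>x. (P x, F x)) p v = coord_deriv c d (\<lambda>x. (P x, F x)) p w"
      then have eq: "coord_deriv c a P p v = coord_deriv c a P p w" "coord_deriv c b F p v = coord_deriv c b F p w"
        by (simp_all add: D)
      obtain \<xi> where \<xi>: "\<xi> \<in> tangent_space M p" "\<xi> c = v" by (rule tangent_vector_exists[OF M c])
      obtain \<eta> where \<eta>: "\<eta> \<in> tangent_space M p" "\<eta> c = w" by (rule tangent_vector_exists[OF M c])
      have "tangent_map_at M N P p \<xi> = tangent_map_at M N P p \<eta>"
        by (rule tangent_space_eqI[OF intoP[OF \<xi>(1)] intoP[OF \<eta>(1)] a]) (simp add: tP \<xi> \<eta> eq)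
      moreover have "tangent_map_at M L F p \<xi> = tangent_map_at M L F p \<eta>"
        by (rule tangent_space_eqI[OF intoF[OF \<xi>(1)] intoF[OF \<eta>(1)] b]) (simp add: tF \<xi> \<eta> eq)
      ultimately have "\<xi> = \<eta>" by (rule tangent_splitting_inj[OF split p \<xi>(1) \<eta>(1)])
      then show "v = w" using \<xi>(2) \<eta>(2) by simp
    qed
    show "surj (coord_deriv c d (\<lambda>x. (P x, F x)) p)"
    proof -
      have "\<exists>u. coord_deriv c d (\<lambda>x. (P x, F x)) p u = (v, w)" for v w
      proof -
        obtain \<alpha> where \<alpha>: "\<alpha> \<in> tangent_space N (P p)" "\<alpha> a = v" by (rule tangent_vector_exists[OF N a])
        obtain \<beta> where \<beta>: "\<beta> \<in> tangent_space L (F p)" "\<beta> b = w" by (rule tangent_vector_exists[OF L b])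
        obtain \<xi> where \<xi>: "\<xi> \<in> tangent_space M p" "tangent_map_at M N P p \<xi> = \<alpha>" "tangent_map_at M L F p \<xi> = \<beta>"
          using tangent_splitting_surj[OF split p \<alpha>(1) \<beta>(1)] by blast
        have "coord_deriv c d (\<lambda>x. (P x, F x)) p (\<xi> c) = (v, w)"
          using tP[OF \<xi>(1)] tF[OF \<xi>(1)] \<xi>(2,3) \<alpha>(2) \<beta>(2) by (simp add: D)
        then show ?thesis by blast
      qed
      then show ?thesis unfolding surj_def by (metis surj_pair)
    qed
  qed
qed

section \<open>Complete solutions from global product decompositions\<close>

text \<open>
  The vector \<open>\<sigma>\<^sub>* P\<^sub>* X\<close> has the same projection to \<open>N\<close> as \<open>X\<close> because \<open>\<sigma>\<close> is a section, and both
  are annihilated by \<open>F\<^sub>*\<close>, the first because \<open>F\<close> is constant along \<open>\<sigma>\<close>.  The splitting separates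
  tangent vectors, so they agree.
\<close>

lemma HJE_solution_if_constant_momentum:
  assumes X: "vector_field M X" and P: "fibration M N P" and F: "fibration M L F"
    and XF: "\<And>p. p \<in> carr M \<Longrightarrow> tangent_map_at M L F p (snd (X p)) = (\<lambda>_. 0)"
    and split: "tangent_splitting M N L P F"
    and \<sigma>: "smooth_section M N P \<sigma>" and l: "l \<in> carr L" and F\<sigma>: "\<And>n. n \<in> carr N \<Longrightarrow> F (\<sigma> n) = l"
  shows "HJE_solution M X N P \<sigma>"
  unfolding HJE_solution_def
proof (intro conjI ballI \<sigma>)
  fix n assume n: "n \<in> carr N"
  note M = fibrationD(1)[OF P] and N = fibrationD(2)[OF P] and L = fibrationD(2)[OF F]
    and sP = fibrationD(3)[OF P] and sF = fibrationD(3)[OF F]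
  have s\<sigma>: "smooth_map N M \<sigma>" and P\<sigma>: "\<And>n. n \<in> carr N \<Longrightarrow> P (\<sigma> n) = n"
    using \<sigma> by (simp_all add: smooth_section_def)
  define p where "p = \<sigma> n"
  have p: "p \<in> carr M" using smooth_mapD(3)[OF s\<sigma> n] by (simp add: p_def)
  define \<xi> where "\<xi> = snd (X p)"
  have Xp: "X p = (p, \<xi>)" and \<xi>: "\<xi> \<in> tangent_space M p"
    using X p unfolding vector_field_def tangent_bundle_def \<xi>_def
    by (metis prod.collapse, metis SigmaE2 prod.collapse)
  have Pp: "P p = n" using P\<sigma>[OF n] by (simp add: p_def)
  define \<eta> where "\<eta> = tangent_map_at M N P p \<xi>"
  have \<eta>: "\<eta> \<in> tangent_space N n"
    using tangent_map_at_in_tangent_space[OF M N sP p \<xi>] by (simp add: \<eta>_def Pp)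
  define \<zeta> where "\<zeta> = tangent_map_at N M \<sigma> n \<eta>"
  have \<zeta>: "\<zeta> \<in> tangent_space M p"
    using tangent_map_at_in_tangent_space[OF N M s\<sigma> n \<eta>] by (simp add: \<zeta>_def p_def)
  have "\<zeta> = \<xi>"
  proof (rule tangent_splitting_inj[OF split p \<zeta> \<xi>])
    have "tangent_map_at M N P p \<zeta> = tangent_map_at N N (P \<circ> \<sigma>) n \<eta>"
      unfolding \<zeta>_def p_def by (rule tangent_map_at_compose[OF N M N s\<sigma> sP n \<eta>, symmetric])
    also have "\<dots> = tangent_map_at N N id n \<eta>"
      by (rule tangent_map_at_cong[OF N N smooth_map_compose[OF N M N s\<sigma> sP] smooth_map_id[OF N] _ n \<eta>])
        (simp add: P\<sigma>)
    also have "\<dots> = \<eta>" by (rule tangent_map_at_id[OF N n \<eta>])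
    finally show "tangent_map_at M N P p \<zeta> = tangent_map_at M N P p \<xi>" by (simp add: \<eta>_def)
    have "tangent_map_at M L F p \<zeta> = tangent_map_at N L (F \<circ> \<sigma>) n \<eta>"
      unfolding \<zeta>_def p_def by (rule tangent_map_at_compose[OF N M L s\<sigma> sF n \<eta>, symmetric])
    also have "\<dots> = tangent_map_at N L (\<lambda>_. l) n \<eta>"
      by (rule tangent_map_at_cong[OF N L smooth_map_compose[OF N M L s\<sigma> sF] smooth_map_const[OF N l] _ n \<eta>])
        (simp add: F\<sigma>)
    also have "\<dots> = (\<lambda>_. 0)" by (rule tangent_map_at_const[OF N L l n \<eta>])
    finally show "tangent_map_at M L F p \<zeta> = tangent_map_at M L F p \<xi>" using XF[OF p] by (simp add: \<xi>_def)
  qed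
  then show "(tangent_map N M \<sigma> \<circ> tangent_map M N P \<circ> X \<circ> \<sigma>) n = (X \<circ> \<sigma>) n"
    by (simp add: p_def[symmetric] Xp tangent_map_eq Pp \<eta>_def[symmetric] \<zeta>_def[symmetric])
qed

lemma local_diffeomorphism_if_diffeomorphism:
  assumes M: "smooth_manifold M" and N: "smooth_manifold N" and f: "diffeomorphism M N f"
  shows "local_diffeomorphism M N f"
  unfolding local_diffeomorphism_def
proof
  fix p assume "p \<in> carr M"
  moreover have "f ` carr M = carr N" using f by (simp add: diffeomorphism_def bij_betw_imp_surj_on)
  ultimately show "\<exists>U. openin (mtop M) U \<and> p \<in> U \<and> openin (mtop N) (f ` U) \<and>
      diffeomorphism (open_submanifold M U) (open_submanifold N (f ` U)) f"
    using f by (intro exI[of _ "carr M"]) (simp add: open_submanifold_carr[OF M] open_submanifold_carr[OF N])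
qed

lemma diffeomorphism_inverse:
  assumes M: "smooth_manifold M" and N: "smooth_manifold N" and f: "diffeomorphism M N f"
  shows "diffeomorphism N M (inv_into (carr M) f)"
  unfolding diffeomorphism_def
proof (intro conjI)
  have b: "bij_betw f (carr M) (carr N)" and s: "smooth_map M N f" using f by (simp_all add: diffeomorphism_def)
  show "bij_betw (inv_into (carr M) f) (carr N) (carr M)" using b by (rule bij_betw_inv_into)
  show "smooth_map N M (inv_into (carr M) f)" using f by (simp add: diffeomorphism_def)
  show "smooth_map M N (inv_into (carr N) (inv_into (carr M) f))"
    by (rule smooth_map_cong[OF M N s]) (simp add: inv_into_inv_into_eq[OF b])
qed

text \<open>
  The case to which the theorem is reduced by shrinking \<open>M\<close>: the pair \<open>(P, F)\<close> is a bijection onto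
  the product of the carriers.
\<close>

lemma complete_solution_if_bijective:
  assumes X: "dynamical_system M X" and P: "fibration M N P" and F: "fibration M L F"
    and dim: "int (mdim L) = int (mdim M) - int (mdim N)"
    and XF: "\<And>p. p \<in> carr M \<Longrightarrow> tangent_map_at M L F p (snd (X p)) = (\<lambda>_. 0)"
    and split: "tangent_splitting M N L P F"
    and bij: "bij_betw (\<lambda>x. (P x, F x)) (carr M) (carr N \<times> carr L)"
  defines "\<Sigma> \<equiv> inv_into (carr M) (\<lambda>x. (P x, F x))"
  shows "diffeomorphism M (prod_manifold N L) (\<lambda>x. (P x, F x))"
    and "complete_solution M X N P L \<Sigma>"
    and "global_momentum_map M X N P L \<Sigma> F"
proof -
  note M = fibrationD(1)[OF P] and N = fibrationD(2)[OF P] and L = fibrationD(2)[OF F]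
    and sP = fibrationD(3)[OF P] and sF = fibrationD(3)[OF F]
  note NL = smooth_manifold_prod_manifold[OF N L]
  show diff: "diffeomorphism M (prod_manifold N L) (\<lambda>x. (P x, F x))"
    using bij by (intro diffeomorphism_if_bijective_derivative[OF M NL smooth_map_Pair[OF M N L sP sF]
          bijective_derivative_Pair[OF M N L sP sF split]]) (simp only: carr_prod_manifold)
  have d\<Sigma>: "diffeomorphism (prod_manifold N L) M \<Sigma>"
    unfolding \<Sigma>_def by (rule diffeomorphism_inverse[OF M NL diff])
  then have s\<Sigma>: "smooth_map (prod_manifold N L) M \<Sigma>" by (simp add: diffeomorphism_def)
  have PF\<Sigma>: "P (\<Sigma> (n, l)) = n" "F (\<Sigma> (n, l)) = l" if "n \<in> carr N" "l \<in> carr L" for n l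
    using bij_betw_inv_into_right[OF bij, of "(n, l)"] that by (simp_all add: \<Sigma>_def)
  show cs: "complete_solution M X N P L \<Sigma>"
    unfolding complete_solution_def
  proof (intro conjI X P L dim ballI local_diffeomorphism_if_diffeomorphism[OF NL M d\<Sigma>])
    show "\<Sigma> ` (carr N \<times> carr L) = carr M"
      unfolding \<Sigma>_def using bij_betw_imp_surj_on[OF bij_betw_inv_into[OF bij]] .
    fix l assume l: "l \<in> carr L"
    have "smooth_map N M (\<Sigma> \<circ> (\<lambda>n. (id n, l)))"
      by (rule smooth_map_compose[OF N NL M smooth_map_Pair[OF N N L smooth_map_id[OF N] smooth_map_const[OF N l]] s\<Sigma>])
    then have "smooth_section M N P (\<lambda>n. \<Sigma> (n, l))"
      using PF\<Sigma>(1) l by (simp add: smooth_section_def o_def)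
    moreover have "vector_field M X" using X by (simp add: dynamical_system_def)
    ultimately show "HJE_solution M X N P (\<lambda>n. \<Sigma> (n, l))"
      using PF\<Sigma>(2) l by (intro HJE_solution_if_constant_momentum[OF _ P F XF split _ l])
  qed
  show "global_momentum_map M X N P L \<Sigma> F"
    unfolding global_momentum_map_def
    using cs d\<Sigma> by (simp add: \<Sigma>_def inv_into_inv_into_eq[OF bij])
qed

section \<open>Restriction to a neighbourhood\<close>

text \<open>
  Restricting an injective open map to the preimage of a box inside its image makes its image a product;
  the factors are then the images under \<open>P\<close> and \<open>F\<close>.
\<close>

lemma box_neighbourhood:
  assumes M: "smooth_manifold M" and N: "smooth_manifold N" and L: "smooth_manifold L"
    and P: "smooth_map M N P" and F: "smooth_map M L F"
    and split: "tangent_splitting M N L P F" and m: "m \<in> carr M"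
  obtains U where "openin (mtop M) U" "m \<in> U" "openin (mtop N) (P ` U)" "openin (mtop L) (F ` U)"
    "bij_betw (\<lambda>x. (P x, F x)) U (P ` U \<times> F ` U)"
proof -
  let ?\<Phi> = "\<lambda>x. (P x, F x)"
  note NL = smooth_manifold_prod_manifold[OF N L] and s\<Phi> = smooth_map_Pair[OF M N L P F]
    and b\<Phi> = bijective_derivative_Pair[OF M N L P F split]
  obtain A where A: "openin (mtop M) A" "m \<in> A" "inj_on ?\<Phi> A"
    by (rule locally_injective_if_bijective_derivative[OF M NL s\<Phi> b\<Phi> m])
  have "openin (prod_topology (mtop N) (mtop L)) (?\<Phi> ` A)"
    using open_image_if_bijective_derivative[OF M NL s\<Phi> b\<Phi> A(1)] by (simp add: prod_manifold_simps)
  moreover have "(P m, F m) \<in> ?\<Phi> ` A" using A(2) by blast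
  ultimately obtain V W where V: "openin (mtop N) V" "P m \<in> V" and W: "openin (mtop L) W" "F m \<in> W"
    and VW: "V \<times> W \<subseteq> ?\<Phi> ` A"
    unfolding openin_prod_topology_alt by meson
  define U where "U = A \<inter> {x \<in> carr M. P x \<in> V} \<inter> {x \<in> carr M. F x \<in> W}"
  have U: "openin (mtop M) U" unfolding U_def
    by (intro openin_Int A(1) openin_continuous_map_preimage[OF smooth_mapD(1)[OF P] V(1)]
        openin_continuous_map_preimage[OF smooth_mapD(1)[OF F] W(1)])
  have mU: "m \<in> U" using A(2) m V(2) W(2) by (simp add: U_def)
  have im: "?\<Phi> ` U = V \<times> W"
  proof (intro equalityI subsetI)
    fix z assume z: "z \<in> V \<times> W"
    then obtain x where "x \<in> A" "z = ?\<Phi> x" using VW by blast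
    then show "z \<in> ?\<Phi> ` U" using z openin_subset[OF A(1)] by (auto simp: U_def)
  qed (auto simp: U_def)
  have "P ` U = fst ` ?\<Phi> ` U" "F ` U = snd ` ?\<Phi> ` U" by (simp_all add: image_image)
  then have PU: "P ` U = V" and FU: "F ` U = W" using V(2) W(2) by (simp_all add: im) blast+
  have "inj_on ?\<Phi> U" using A(3) by (rule inj_on_subset) (auto simp: U_def)
  then have "bij_betw ?\<Phi> U (P ` U \<times> F ` U)" unfolding bij_betw_def PU FU using im by blast
  then show ?thesis using that U mU V(1) W(1) by (simp add: PU FU)
qed

text \<open>
  The description defining the restricted field denotes a unique vector because the tangent map of the
  inclusion is bijective.
\<close>

lemma restrict_field_at:
  assumes M: "smooth_manifold M" and X: "vector_field M X" and U: "openin (mtop M) U" and p: "p \<in> U"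
  obtains \<xi> where "restrict_field M U X p = (p, \<xi>)" "\<xi> \<in> tangent_space (open_submanifold M U) p"
    "tangent_map_at (open_submanifold M U) M id p \<xi> = snd (X p)"
proof -
  let ?MU = "open_submanifold M U"
  have pM: "p \<in> carr M" using p openin_subset[OF U] by blast
  have Xp: "X p \<in> tangent_bundle M" "fst (X p) = p" using X pM unfolding vector_field_def by blast+
  then have XT: "snd (X p) \<in> tangent_space M p" unfolding tangent_bundle_def by (metis SigmaE2 prod.collapse)
  note b = bij_betw_tangent_map_inclusion[OF M U p]
  have "snd (X p) \<in> tangent_map_at ?MU M id p ` tangent_space ?MU p"
    using XT bij_betw_imp_surj_on[OF b] by simp
  then obtain \<xi> where \<xi>: "\<xi> \<in> tangent_space ?MU p" "tangent_map_at ?MU M id p \<xi> = snd (X p)"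
    by (elim imageE) simp
  have "restrict_field M U X p = (p, \<xi>)"
    unfolding restrict_field_def
  proof (rule the_equality)
    show "(p, \<xi>) \<in> tangent_bundle ?MU \<and> tangent_map ?MU M id (p, \<xi>) = X p"
      using \<xi> p Xp(2) by (simp add: tangent_bundle_def carr_open_submanifold[OF U] tangent_map_eq prod_eq_iff)
    fix \<zeta> assume \<zeta>: "\<zeta> \<in> tangent_bundle ?MU \<and> tangent_map ?MU M id \<zeta> = X p"
    obtain q \<eta> where q: "\<zeta> = (q, \<eta>)" by (cases \<zeta>)
    have qp: "q = p" and \<eta>: "tangent_map_at ?MU M id q \<eta> = snd (X p)"
      using \<zeta> Xp(2) unfolding q by (auto simp: tangent_map_eq prod_eq_iff)
    have "\<eta> \<in> tangent_space ?MU q" using \<zeta> unfolding q tangent_bundle_def by blast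
    moreover have "tangent_map_at ?MU M id p \<eta> = tangent_map_at ?MU M id p \<xi>"
      using \<eta> \<xi>(2) qp by simp
    ultimately have "\<eta> = \<xi>"
      using bij_betw_imp_inj_on[OF b] \<xi>(1) unfolding qp inj_on_def by blast
    then show "\<zeta> = (p, \<xi>)" using q qp by simp
  qed
  then show ?thesis using that \<xi> by blast
qed

text \<open>
  The component of the restricted field in a restricted chart is the component of \<open>X\<close> in the original
  chart, so smoothness is inherited.
\<close>

lemma dynamical_system_restrict:
  assumes X: "dynamical_system M X" and U: "openin (mtop M) U"
  shows "dynamical_system (open_submanifold M U) (restrict_field M U X)"
proof -
  let ?MU = "open_submanifold M U" and ?XU = "restrict_field M U X"
  have M: "smooth_manifold M" and vX: "vector_field M X" using X by (simp_all add: dynamical_system_def)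
  have "vector_field ?MU ?XU"
    unfolding vector_field_def
  proof (intro conjI ballI)
    fix p assume "p \<in> carr ?MU"
    then have p: "p \<in> U" by (simp add: carr_open_submanifold[OF U])
    show "?XU p \<in> tangent_bundle ?MU" "fst (?XU p) = p"
      by (rule restrict_field_at[OF M vX U p], simp add: tangent_bundle_def carr_open_submanifold[OF U] p)+
  next
    fix c' assume "c' \<in> atlas ?MU"
    then obtain c where c: "c \<in> atlas M" "c' = restrict_chart U c" unfolding open_submanifold_simps by blast
    note C = open_chartD[OF atlas_chart[OF M c(1)]]
    note R = open_chartD[OF open_chart_restrict[OF atlas_chart[OF M c(1)] U]]
    have op: "open (snd c ` (U \<inter> fst c))" using U C(1) by (intro C(3) openin_Int) auto
    have "smooth_on (snd c ` fst c) (\<lambda>x. snd (X (chart_inv c x)) c)"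
      using vX c(1) by (simp add: vector_field_def)
    then have "smooth_on (snd c ` (U \<inter> fst c)) (\<lambda>x. snd (X (chart_inv c x)) c)"
      by (rule smooth_on_subset) blast
    moreover have "snd (X (chart_inv c x)) c = snd (?XU (chart_inv c' x)) c'"
      if "x \<in> snd c ` (U \<inter> fst c)" for x
    proof -
      from that obtain p where p: "p \<in> U" "p \<in> fst c" "x = snd c p" by blast
      have "c \<in> charts_at M p" using c(1) p(2) by (simp add: charts_at_def)
      then have "snd (X p) c = snd (?XU p) c'"
        using tangent_map_at_inclusion_chart[OF M U p(1)] restrict_field_at[OF M vX U p(1)] unfolding c(2)
        by (metis snd_conv)
      moreover have "chart_inv c x = p" "chart_inv c' x = p" using C(6)[OF p(2)] R(6)[of p] p by (simp_all add: c(2))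
      ultimately show ?thesis by simp
    qed
    ultimately have "smooth_on (snd c ` (U \<inter> fst c)) (\<lambda>x. snd (?XU (chart_inv c' x)) c')"
      by (rule iffD1[OF smooth_on_cong[OF op], rotated])
    then show "smooth_on (snd c' ` fst c') (\<lambda>x. snd (?XU (chart_inv c' x)) c')" by (simp add: c(2))
  qed
  then show ?thesis using smooth_manifold_open_submanifold[OF M U] by (simp add: dynamical_system_def)
qed

lemma fibration_if_tangent_splitting:
  assumes M: "smooth_manifold M" and N: "smooth_manifold N" and L: "smooth_manifold L"
    and P: "smooth_map M N P" and F: "smooth_map M L F" and split: "tangent_splitting M N L P F"
  shows "P ` carr M = carr N \<Longrightarrow> fibration M N P" and "F ` carr M = carr L \<Longrightarrow> fibration M L F"
proof -
  have "tangent_map_at M N P p ` tangent_space M p = tangent_space N (P p)" if p: "p \<in> carr M" for p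
    using tangent_map_at_in_tangent_space[OF M N P p]
      tangent_splitting_surj[OF split p _ zero_in_tangent_space[OF L]] by blast
  then show "fibration M N P" if "P ` carr M = carr N" using that by (intro fibrationI[OF M N P])
  have "tangent_map_at M L F p ` tangent_space M p = tangent_space L (F p)" if p: "p \<in> carr M" for p
    using tangent_map_at_in_tangent_space[OF M L F p]
      tangent_splitting_surj[OF split p zero_in_tangent_space[OF N]] by blast
  then show "fibration M L F" if "F ` carr M = carr L" using that by (intro fibrationI[OF M L F])
qed

theorem theorem4p9:
  fixes M :: "('m, 'e::findim_normed_vector) manifold"
    and X :: "'m \<Rightarrow> 'm \<times> (('m, 'e) chart \<Rightarrow> 'e)"
    and N :: "('n, 'f::findim_normed_vector) manifold"
    and P :: "'m \<Rightarrow> 'n"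
    and L :: "('l, 'g::findim_normed_vector) manifold"
    and F :: "'m \<Rightarrow> 'l"
  assumes "dynamical_system M X"
    and "fibration M N P"
    and "smooth_manifold L"
    and "int (mdim L) = int (mdim M) - int (mdim N)"
    and "fibration M L F"
    and "X ` carr M \<subseteq> tangent_kernel M L F"
    and "transverse M N L P F"
  shows "\<forall>m \<in> carr M. \<exists>U. openin (mtop M) U \<and> m \<in> U \<and>
    openin (mtop N) (P ` U) \<and> openin (mtop L) (F ` U) \<and>
    (let MU = open_submanifold M U; XU = restrict_field M U X;
         NU = open_submanifold N (P ` U); LU = open_submanifold L (F ` U);
         \<Sigma> = inv_into U (\<lambda>x. (P x, F x))
     in diffeomorphism MU (prod_manifold NU LU) (\<lambda>x. (P x, F x)) \<and>
        complete_solution MU XU NU P LU \<Sigma> \<and>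
        global_momentum_map MU XU NU P LU \<Sigma> F)"
proof
  fix m assume m: "m \<in> carr M"
  note M = fibrationD(1)[OF assms(2)] and N = fibrationD(2)[OF assms(2)] and L = assms(3)
    and P = fibrationD(3)[OF assms(2)] and F = fibrationD(3)[OF assms(5)]
  have X: "vector_field M X" using assms(1) by (simp add: dynamical_system_def)
  have split: "tangent_splitting M N L P F"
    by (rule tangent_splitting_if_transverse[OF assms(2,5,7)])
  obtain U where U: "openin (mtop M) U" and mU: "m \<in> U" and V: "openin (mtop N) (P ` U)"
    and W: "openin (mtop L) (F ` U)" and bij: "bij_betw (\<lambda>x. (P x, F x)) U (P ` U \<times> F ` U)"
    by (rule box_neighbourhood[OF M N L P F split m])
  let ?MU = "open_submanifold M U" and ?XU = "restrict_field M U X"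
    and ?NU = "open_submanifold N (P ` U)" and ?LU = "open_submanifold L (F ` U)"
  note MU = smooth_manifold_open_submanifold[OF M U] and NU = smooth_manifold_open_submanifold[OF N V]
    and LU = smooth_manifold_open_submanifold[OF L W]
  note PU = smooth_map_restrict[OF M N P U subset_refl] and FU = smooth_map_restrict[OF M L F U subset_refl]
  note carr = carr_open_submanifold[OF U] carr_open_submanifold[OF V] carr_open_submanifold[OF W]
  have splitU: "tangent_splitting ?MU ?NU ?LU P F"
    by (rule tangent_splitting_open_submanifold[OF M N L P F U V W subset_refl subset_refl split])
  have XF: "tangent_map_at ?MU ?LU F p (snd (?XU p)) = (\<lambda>_. 0)" if "p \<in> carr ?MU" for p
  proof -
    have p: "p \<in> U" "p \<in> carr M" using that openin_subset[OF U] by (auto simp: carr)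
    obtain \<xi> where \<xi>: "?XU p = (p, \<xi>)" "\<xi> \<in> tangent_space ?MU p" "tangent_map_at ?MU M id p \<xi> = snd (X p)"
      by (rule restrict_field_at[OF M X U p(1)])
    have Fp: "F p \<in> F ` U" using p(1) by blast
    \<comment> \<open>The tangent map of the inclusion of \<open>F(U)\<close> sends \<open>F\<^sub>*(X|\<^sub>U)\<close> to \<open>F\<^sub>* X = 0\<close>, and it preserves components.\<close>
    have "X p \<in> tangent_kernel M L F" using assms(6) p(2) by blast
    moreover have "X p = (p, snd (X p))" using X p(2) by (simp add: vector_field_def prod_eq_iff)
    ultimately have "tangent_map_at M L F p (snd (X p)) = (\<lambda>_. 0)"
      unfolding tangent_kernel_def tangent_map_at_def by (metis (mono_tags, lifting) mem_Collect_eq)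
    then have "tangent_map_at ?LU L id (F p) (tangent_map_at ?MU ?LU F p \<xi>) = (\<lambda>_. 0)"
      using tangent_map_restrict_inclusion[OF M L F U W subset_refl p(1) \<xi>(2)] \<xi>(3) by simp
    then have zero: "tangent_map_at ?MU ?LU F p \<xi> (restrict_chart (F ` U) d) = 0" if "d \<in> charts_at L (F p)" for d
      using tangent_map_at_inclusion_chart[OF L W Fp
          tangent_map_at_in_tangent_space[OF MU LU FU \<open>p \<in> carr ?MU\<close> \<xi>(2)] that] by simp
    have "tangent_map_at ?MU ?LU F p \<xi> = (\<lambda>_. 0)"
    proof (rule tangent_map_at_eqI[OF _ zero_in_tangent_space[OF LU]])
      fix d assume "d \<in> charts_at ?LU (F p)"
      then show "tangent_map_at ?MU ?LU F p \<xi> d = 0"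
        using zero by (auto simp: charts_at_open_submanifold[OF Fp])
    qed
    then show ?thesis by (simp add: \<xi>(1))
  qed
  have fib: "fibration ?MU ?NU P" "fibration ?MU ?LU F"
    by (rule fibration_if_tangent_splitting[OF MU NU LU PU FU splitU], simp add: carr)+
  have dim: "int (mdim ?LU) = int (mdim ?MU) - int (mdim ?NU)" using assms(4) by (simp add: mdim_def)
  have bijU: "bij_betw (\<lambda>x. (P x, F x)) (carr ?MU) (carr ?NU \<times> carr ?LU)" using bij by (simp only: carr)
  note sol = complete_solution_if_bijective[OF dynamical_system_restrict[OF assms(1) U] fib dim XF splitU bijU,
      unfolded carr(1)]
  show "\<exists>U. openin (mtop M) U \<and> m \<in> U \<and>
    openin (mtop N) (P ` U) \<and> openin (mtop L) (F ` U) \<and>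
    (let MU = open_submanifold M U; XU = restrict_field M U X;
         NU = open_submanifold N (P ` U); LU = open_submanifold L (F ` U);
         \<Sigma> = inv_into U (\<lambda>x. (P x, F x))
     in diffeomorphism MU (prod_manifold NU LU) (\<lambda>x. (P x, F x)) \<and>
        complete_solution MU XU NU P LU \<Sigma> \<and>
        global_momentum_map MU XU NU P LU \<Sigma> F)"
    unfolding Let_def by (intro exI[of _ U] conjI U mU V W sol)
qed

end
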